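(* The variety $BL_4$ of four-dimensional binary Lie algebra structures over $\mathbb{C}$ has exactly five irreducible components $\mathcal{C}_1,\dots,\mathcal{C}_5$, where $$\mathcal{C}_1=\overline{O(sl_2\oplus\mathbb{C})}=O\left(\{sl_2\oplus\mathbb{C},g_5(-1),g_4(-1,0),n_4,n_3\oplus\mathbb{C},\mathbb{C}^4\}\right),$$ $$\mathcal{C}_2=\overline{O(r_2\oplus r_2)}=O\Big(\{r_2\oplus r_2,g_5(0),g_2(0),r_2\oplus\mathbb{C}^2,n_4,n_3\oplus\mathbb{C},\mathbb{C}^4\}\cup\bigcup_{\alpha\in\mathbb{C}}\{g_4(\alpha,0)\}\Big),$$ $$\mathcal{C}_3=\overline{\bigcup_{\alpha\in\mathbb{C}}O(g_5(\alpha))}=O\Big(\bigcup_{\alpha\in\mathbb{C}}\{g_5(\alpha),g_4(\alpha,\alpha+1)\}\cup\{g_2(0),g_2(2),g_3(2),n_4,n_3\oplus\mathbb{C},\mathbb{C}^4\}\Big),$$ $$\mathcal{C}_4=\overline{\bigcup_{\alpha,\beta\in\mathbb{C}}O(g_4(\alpha,\beta))}=O\Big(\bigcup_{\alpha,\beta\in\mathbb{C}}\{g_4(\alpha,\beta),g_2(\beta)\}\cup\{r_2\oplus\mathbb{C}^2,n_4,n_3\oplus\mathbb{C},g_1,\mathbb{C}^4\}\Big),$$ $$\mathcal{C}_5=\overline{\bigcup_{\beta\in\mathbb{C}}O(g_3(\beta))}=O\Big(\bigcup_{\beta\in\mathbb{C}}\{g_3(\beta),g_2(\beta)\}\cup\{g_6,r_2\oplus\mathbb{C}^2,n_3\oplus\mathbb{C},g_1,\mathbb{C}^4\}\Big).$$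 In particular, the set of rigid algebras of $BL_4$ and the set of rigid algebras of the variety $Lie_4$ of four-dimensional Lie algebras coincide (up to isomorphism): $Rig(BL_4)=Rig(Lie_4)=\{sl_2\oplus\mathbb{C},\,r_2\oplus r_2\}$.
   Context: All algebras are over $\mathbb{C}$. An algebra is binary Lie (BL) if all its 2-generated subalgebras are Lie algebras; equivalently it satisfies $xy=-yx$ and $J(x,y,xy)=0$, where $J(x,y,z)=(xy)z+(yz)x+(zx)y$. Fix an $n$-dimensional vector space $V$ (here $n=4$). $BL_n$ (resp. $Lie_n$) is the Zariski closed subset of $\mathrm{Hom}(V\otimes V,V)\cong\mathbb{C}^{n^3}$ consisting of BL (resp. Lie) multiplications on $V$. $GL_n(\mathbb{C})$ acts by $(g*\mu)(x\otimes y)=g(\mu(g^{-1}x\otimes g^{-1}y))$; for an $n$-dimensional algebra $A$, $O(A)$ denotes the orbit of structures isomorphic to $A$, and for a set $S$ of algebras $O(S)=\bigcup_{A\in S}O(A)$. Closures are Zariski closures. An irreducible component is a maximal irreducible closed subset. An algebra $A$ is rigid in a variety if $O(A)$ is an open subset of the variety; $Rig(\cdot)$ is the set of rigid algebras up to isomorphism. Known classification: every four-dimensional BL algebra is isomorphic to one of the following, given in a basis $e_1,\dots,e_4$ (products not listed are zero or follow from anticommutativity; $\alpha,\beta\in\mathbb{C}$): $\mathbb{C}^4$: zero multiplication. $n_3\oplus\mathbb{C}$: $e_1e_2=e_3$. $n_4$: $e_1e_2=e_3$, $e_1e_3=e_4$. $r_2\oplus\mathbb{C}^2$: $e_1e_2=e_2$.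 $r_2\oplus r_2$: $e_1e_2=e_2$, $e_3e_4=e_4$. $sl_2\oplus\mathbb{C}$: $e_1e_2=e_2$, $e_1e_3=-e_3$, $e_2e_3=e_1$. $g_1$: $e_1e_2=e_2$, $e_1e_3=e_3$, $e_1e_4=e_4$. $g_2(\beta)$: $e_1e_2=e_2$, $e_1e_3=e_3$, $e_1e_4=e_3+\beta e_4$. $g_3(\beta)$: $e_1e_2=e_2$, $e_1e_3=e_3$, $e_1e_4=\beta e_4$, $e_2e_3=e_4$. $g_4(\alpha,\beta)$: $e_1e_2=e_2$, $e_1e_3=e_2+\alpha e_3$, $e_1e_4=e_3+\beta e_4$. $g_5(\alpha)$: $e_1e_2=e_2$, $e_1e_3=e_2+\alpha e_3$, $e_1e_4=(\alpha+1)e_4$, $e_2e_3=e_4$. $g_6$: $e_1e_2=e_3$, $e_3e_4=e_3$. Among these the Lie algebras are all except $g_6$ and $g_3(\beta)$ with $\beta\neq 2$. The only isomorphisms between these are: $g_4(\alpha_1,\beta_1)\cong g_4(\alpha_2,\beta_2)$ iff the proportions $1:\alpha_1:\beta_1$ and $1:\alpha_2:\beta_2$ coincide after some permutation; and $g_5(\alpha)\cong g_5(\beta)$ iff $\alpha=\beta$ or $\alpha\beta=1$. *)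

theory Defs
  imports "HOL-Analysis.Analysis"
begin

section \<open>Algebra structures on \<open>\<complex>\<^sup>n\<close>\<close>

text \<open>
  A bilinear multiplication \<open>\<mu>\<close> on \<open>V = \<complex>\<^sup>n\<close> is given by its structure constants:
  \<open>\<mu> $ i $ j $ k\<close> is the coefficient of the basis vector \<open>e\<^sub>k\<close> in the product \<open>e\<^sub>i e\<^sub>j\<close>, so
  \<open>\<mu> $ i $ j\<close> is the vector \<open>e\<^sub>i e\<^sub>j\<close>. This is the identification of
  \<open>Hom (V \<otimes> V, V)\<close> with affine \<open>n\<^sup>3\<close>-space.
\<close>

type_synonym 'n alg = "complex ^ 'n ^ 'n ^ 'n"

definition mult :: "'n::finite alg \<Rightarrow> complex ^ 'n \<Rightarrow> complex ^ 'n \<Rightarrow> complex ^ 'n" where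
  "mult \<mu> x y = (\<Sum>i\<in>UNIV. \<Sum>j\<in>UNIV. (x $ i * y $ j) *s (\<mu> $ i $ j))"

definition jacobian :: "'n::finite alg \<Rightarrow> complex ^ 'n \<Rightarrow> complex ^ 'n \<Rightarrow> complex ^ 'n \<Rightarrow> complex ^ 'n"
  where
  "jacobian \<mu> x y z =
     mult \<mu> (mult \<mu> x y) z + mult \<mu> (mult \<mu> y z) x + mult \<mu> (mult \<mu> z x) y"

definition subalgebra :: "'n::finite alg \<Rightarrow> (complex ^ 'n) set \<Rightarrow> bool" where
  "subalgebra \<mu> S \<longleftrightarrow> vec.subspace S \<and> (\<forall>x\<in>S. \<forall>y\<in>S. mult \<mu> x y \<in> S)"

text \<open>For a subalgebra \<open>S\<close>: the restriction of \<open>\<mu>\<close> to \<open>S\<close> is a Lie multiplication.\<close>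

definition lie_on :: "'n::finite alg \<Rightarrow> (complex ^ 'n) set \<Rightarrow> bool" where
  "lie_on \<mu> S \<longleftrightarrow>
     (\<forall>x\<in>S. \<forall>y\<in>S. mult \<mu> x y = - mult \<mu> y x) \<and>
     (\<forall>x\<in>S. \<forall>y\<in>S. \<forall>z\<in>S. jacobian \<mu> x y z = 0)"

definition Lie :: "'n::finite alg set" where
  "Lie = {\<mu>. lie_on \<mu> UNIV}"

definition BL :: "'n::finite alg set" where
  "BL = {\<mu>. \<forall>x y. lie_on \<mu> (subalgebra \<mu> hull {x, y})}"

definition act :: "complex ^ 'n ^ 'n \<Rightarrow> 'n::finite alg \<Rightarrow> 'n alg" where
  "act g \<mu> = (\<chi> i j. g *v mult \<mu> (matrix_inv g *v axis i 1) (matrix_inv g *v axis j 1))"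

definition orbit :: "'n::finite alg \<Rightarrow> 'n alg set" where
  "orbit \<mu> = {act g \<mu> |g. invertible g}"

definition orbits :: "'n::finite alg set \<Rightarrow> 'n alg set" where
  "orbits S = (\<Union>\<mu>\<in>S. orbit \<mu>)"

lemma mult_axis: "mult \<mu> (axis i 1) (axis j 1) = \<mu> $ i $ j"
proof -
  have "(axis i 1 $ a * axis j 1 $ b) *s (\<mu> $ a $ b)
      = (if b = j then if a = i then \<mu> $ a $ b else 0 else 0)" for a b
    by (auto simp: axis_def)
  then show ?thesis
    unfolding mult_def by simp
qed

lemma mult_add_left: "mult \<mu> (x + x') y = mult \<mu> x y + mult \<mu> x' y"
  by (simp add: mult_def distrib_right distrib_left vec.scale_left_distrib sum.distrib)

lemma mult_add_right: "mult \<mu> x (y + y') = mult \<mu> x y + mult \<mu> x y'"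
  by (simp add: mult_def distrib_right distrib_left vec.scale_left_distrib sum.distrib)

lemma mult_scale_left: "mult \<mu> (c *s x) y = c *s mult \<mu> x y"
  by (simp add: mult_def vec.scale_sum_right mult_ac)

lemma mult_scale_right: "mult \<mu> x (c *s y) = c *s mult \<mu> x y"
  by (simp add: mult_def vec.scale_sum_right mult_ac)


section \<open>The Zariski topology\<close>

inductive_set poly_functions :: "('n::finite alg \<Rightarrow> complex) set" where
  const: "(\<lambda>_. c) \<in> poly_functions"
| coord: "(\<lambda>\<mu>. \<mu> $ i $ j $ k) \<in> poly_functions"
| add: "p \<in> poly_functions \<Longrightarrow> q \<in> poly_functions \<Longrightarrow> (\<lambda>\<mu>. p \<mu> + q \<mu>) \<in> poly_functions"
| mult: "p \<in> poly_functions \<Longrightarrow> q \<in> poly_functions \<Longrightarrow> (\<lambda>\<mu>. p \<mu> * q \<mu>) \<in> poly_functions"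

definition zero_locus :: "('n::finite alg \<Rightarrow> complex) set \<Rightarrow> 'n alg set" where
  "zero_locus P = {\<mu>. \<forall>p\<in>P. p \<mu> = 0}"

definition zariski :: "'n::finite alg topology" where
  "zariski = topology (\<lambda>U. \<exists>P\<subseteq>poly_functions. - U = zero_locus P)"

lemma istopology_zariski:
  "istopology (\<lambda>U::'n::finite alg set. \<exists>P\<subseteq>poly_functions. - U = zero_locus P)"
  unfolding istopology_def
proof (intro conjI allI impI)
  fix S T :: "'n alg set"
  assume "\<exists>P\<subseteq>poly_functions. - S = zero_locus P" "\<exists>P\<subseteq>poly_functions. - T = zero_locus P"
  then obtain P Q where P: "P \<subseteq> poly_functions" "- S = zero_locus P"
    and Q: "Q \<subseteq> poly_functions" "- T = zero_locus Q"
    by auto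
  let ?R = "{\<lambda>\<mu>. p \<mu> * q \<mu> |p q. p \<in> P \<and> q \<in> Q}"
  have "?R \<subseteq> poly_functions"
    using P(1) Q(1) by (auto intro: poly_functions.mult)
  moreover have "zero_locus ?R = zero_locus P \<union> zero_locus Q"
    unfolding zero_locus_def by fastforce
  ultimately show "\<exists>R\<subseteq>poly_functions. - (S \<inter> T) = zero_locus R"
    unfolding Compl_Int P(2) Q(2) by blast
next
  fix K :: "'n alg set set"
  assume "\<forall>S\<in>K. \<exists>P\<subseteq>poly_functions. - S = zero_locus P"
  then have "\<exists>f. \<forall>S\<in>K. f S \<subseteq> poly_functions \<and> - S = zero_locus (f S)"
    by (intro bchoice) simp
  then obtain f where f: "\<And>S. S \<in> K \<Longrightarrow> f S \<subseteq> poly_functions \<and> - S = zero_locus (f S)"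
    by blast
  have "zero_locus (\<Union>(f ` K)) = (\<Inter>S\<in>K. zero_locus (f S))"
    by (auto simp: zero_locus_def)
  also have "\<dots> = (\<Inter>S\<in>K. - S)"
    using f by auto
  also have "\<dots> = - \<Union>K"
    by auto
  finally show "\<exists>P\<subseteq>poly_functions. - \<Union>K = zero_locus P"
    using f by (intro exI[of _ "\<Union>(f ` K)"]) auto
qed

lemma openin_zariski: "openin zariski U \<longleftrightarrow> (\<exists>P\<subseteq>poly_functions. - U = zero_locus P)"
  unfolding zariski_def by (simp add: topology_inverse'[OF istopology_zariski])

lemma topspace_zariski [simp]: "topspace zariski = (UNIV :: 'n::finite alg set)"
proof -
  have "openin zariski (UNIV :: 'n alg set)"
    unfolding openin_zariski
    by (rule exI[of _ "{\<lambda>_. 1}"]) (auto simp: zero_locus_def intro: poly_functions.const)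
  then show ?thesis
    using openin_subset by blast
qed

lemma closedin_zariski: "closedin zariski S \<longleftrightarrow> (\<exists>P\<subseteq>poly_functions. S = zero_locus P)"
  by (simp add: closedin_def openin_zariski flip: Compl_eq_Diff_UNIV)

definition irreducible_in :: "'a topology \<Rightarrow> 'a set \<Rightarrow> bool" where
  "irreducible_in X S \<longleftrightarrow> S \<subseteq> topspace X \<and> S \<noteq> {} \<and>
     (\<forall>A B. closedin X A \<longrightarrow> closedin X B \<longrightarrow> S \<subseteq> A \<union> B \<longrightarrow> S \<subseteq> A \<or> S \<subseteq> B)"

definition irreducible_components :: "'a topology \<Rightarrow> 'a set set" where
  "irreducible_components X = {C. closedin X C \<and> irreducible_in X C \<and>
     (\<forall>D. closedin X D \<and> irreducible_in X D \<and> C \<subseteq> D \<longrightarrow> D = C)}"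

text \<open>Isomorphism classes of algebras are represented by orbits.\<close>

definition Rig :: "'n::finite alg set \<Rightarrow> 'n alg set set" where
  "Rig W = {orbit \<mu> |\<mu>. \<mu> \<in> W \<and> openin (subtopology zariski W) (orbit \<mu>)}"


section \<open>Four-dimensional algebras\<close>

text \<open>
  \<open>bracket i j v\<close> is the anticommutative multiplication with \<open>e\<^sub>i e\<^sub>j = v = - e\<^sub>j e\<^sub>i\<close> and all other
  products of basis vectors zero. The index type \<open>4\<close> has elements \<open>1\<close>, \<open>2\<close>, \<open>3\<close>, \<open>4\<close>, where
  \<open>4 = 0\<close>.
\<close>

definition bracket :: "'n \<Rightarrow> 'n \<Rightarrow> complex ^ 'n \<Rightarrow> 'n::finite alg" where
  "bracket i j v = (\<chi> a b. if a = i \<and> b = j then v else if a = j \<and> b = i then - v else 0)"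

abbreviation e :: "4 \<Rightarrow> complex ^ 4" where
  "e i \<equiv> axis i 1"

definition C4 :: "4 alg" where
  "C4 = 0"

definition n3_C :: "4 alg" where
  "n3_C = bracket 1 2 (e 3)"

definition n4 :: "4 alg" where
  "n4 = bracket 1 2 (e 3) + bracket 1 3 (e 4)"

definition r2_C2 :: "4 alg" where
  "r2_C2 = bracket 1 2 (e 2)"

definition r2_r2 :: "4 alg" where
  "r2_r2 = bracket 1 2 (e 2) + bracket 3 4 (e 4)"

definition sl2_C :: "4 alg" where
  "sl2_C = bracket 1 2 (e 2) + bracket 1 3 (- e 3) + bracket 2 3 (e 1)"

definition g1 :: "4 alg" where
  "g1 = bracket 1 2 (e 2) + bracket 1 3 (e 3) + bracket 1 4 (e 4)"

definition g2 :: "complex \<Rightarrow> 4 alg" where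
  "g2 \<beta> = bracket 1 2 (e 2) + bracket 1 3 (e 3) + bracket 1 4 (e 3 + \<beta> *s e 4)"

definition g3 :: "complex \<Rightarrow> 4 alg" where
  "g3 \<beta> = bracket 1 2 (e 2) + bracket 1 3 (e 3) + bracket 1 4 (\<beta> *s e 4) + bracket 2 3 (e 4)"

definition g4 :: "complex \<Rightarrow> complex \<Rightarrow> 4 alg" where
  "g4 \<alpha> \<beta> = bracket 1 2 (e 2) + bracket 1 3 (e 2 + \<alpha> *s e 3) + bracket 1 4 (e 3 + \<beta> *s e 4)"

definition g5 :: "complex \<Rightarrow> 4 alg" where
  "g5 \<alpha> = bracket 1 2 (e 2) + bracket 1 3 (e 2 + \<alpha> *s e 3) + bracket 1 4 ((\<alpha> + 1) *s e 4)
     + bracket 2 3 (e 4)"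

definition g6 :: "4 alg" where
  "g6 = bracket 1 2 (e 3) + bracket 3 4 (e 3)"

end

theory Submission
  imports Defs "HOL-Computational_Algebra.Fundamental_Theorem_Algebra"
begin

text \<open>
  An algebra satisfying \<open>J(x, y, xy) = 0\<close> that is not Lie has all products \<open>xy\<close> in the span of \<open>x\<close>, \<open>y\<close>
  and a fixed vector, which leaves only \<open>g3\<close> and \<open>g6\<close>. A Lie algebra of dimension four has a
  unimodular ideal of codimension one: the kernel of the trace of \<open>ad\<close> if this is nonzero, and otherwise
  the kernel of any functional vanishing on products, which exists because the products, read as
  2-forms, span an isotropic space. The ideal is abelian, Heisenberg, Euclidean or \<open>sl\<^sub>2\<close>, and normal
  forms of its derivations yield the list.

  Each component is cut out by polynomial identities in \<open>\<mu>\<close> and the traces of powers of \<open>ad x\<close>.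
  Testing these on the list bounds the closure from above; explicit curves of structures bound it from
  below. An open orbit must meet the generic family of the component it lies in, and inside the
  families with parameters the ratio of \<open>(tr ad x)\<^sup>2\<close> to \<open>tr (ad x)\<^sup>2\<close> moves, so only \<open>sl2_C\<close> and \<open>r2_r2\<close>
  are rigid.
\<close>

section \<open>Isomorphisms and bases\<close>

text \<open>The classification is proved and not assumed, but only its exhaustiveness: models are
  told apart solely by the closed conditions that separate them. No closure is computed directly.
  For each component a closed set \<open>K\<close>, invariant under isomorphism and containing the
  generic family, contains the closure; \<open>K\<close> lies in the union of the listed orbits
  because only models have to be tested; and the listed models lie in the closure. The circle of
  inclusions makes all three sets equal. Limits are algebraic: a polynomial in t that vanishes for
  all but finitely many t vanishes identically, so a closed set containing almost all points of a
  polynomial curve contains the exceptional ones too. The definition of \<open>BL\<close> speaks of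
  generated subalgebras and is not visibly polynomial. The identity J(x, y, xy) = 0 is, and that it
  implies \<open>BL\<close> in dimension four is read off from the classification.\<close>

lemma mult_zero_left [simp]: "mult \<mu> 0 y = 0"
  by (simp add: mult_def)

lemma mult_zero_right [simp]: "mult \<mu> x 0 = 0"
  by (simp add: mult_def)

lemma mult_minus_left [simp]: "mult \<mu> (- x) y = - mult \<mu> x y"
  using mult_scale_left[of \<mu> "-1" x y] by simp

lemma mult_minus_right [simp]: "mult \<mu> x (- y) = - mult \<mu> x y"
  using mult_scale_right[of \<mu> x "-1" y] by simp

lemma mult_diff_left: "mult \<mu> (x - x') y = mult \<mu> x y - mult \<mu> x' y"
  using mult_add_left[of \<mu> x "- x'" y] by simp

lemma mult_diff_right: "mult \<mu> x (y - y') = mult \<mu> x y - mult \<mu> x y'"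
  using mult_add_right[of \<mu> x y "- y'"] by simp

lemmas mult_linear = mult_add_left mult_add_right mult_diff_left mult_diff_right
  mult_scale_left mult_scale_right

lemma mult_sum_left: "mult \<mu> (\<Sum>i\<in>A. f i) y = (\<Sum>i\<in>A. mult \<mu> (f i) y)"
  by (induction A rule: infinite_finite_induct) (simp_all add: mult_add_left)

lemma mult_sum_right: "mult \<mu> x (\<Sum>i\<in>A. f i) = (\<Sum>i\<in>A. mult \<mu> x (f i))"
  by (induction A rule: infinite_finite_induct) (simp_all add: mult_add_right)

lemma alg_eqI: "(\<And>x y. mult \<mu> x y = mult \<nu> x y) \<Longrightarrow> \<mu> = \<nu>"
  by (metis mult_axis vec_eq_iff)

text \<open>Membership in an orbit without \<open>matrix_inv\<close>: a matrix that intertwines the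
  two products. Identities and traces are transported by substituting \<open>g *v x\<close>, and
  \<open>orbit_iso\<close> translates back.\<close>

definition iso :: "complex ^ 'n ^ 'n \<Rightarrow> 'n::finite alg \<Rightarrow> 'n alg \<Rightarrow> bool" where
  "iso g \<mu> \<nu> \<longleftrightarrow> invertible g \<and> (\<forall>x y. mult \<nu> (g *v x) (g *v y) = g *v mult \<mu> x y)"

lemma basis_sum: "(x :: complex ^ 'n::finite) = (\<Sum>i\<in>UNIV. x $ i *s axis i 1)"
  by (simp add: vec_eq_iff axis_def if_distrib cong: if_cong)

lemma matrix_inv_mult:
  assumes "invertible A"
  shows "A ** matrix_inv A = mat 1" "matrix_inv A ** A = mat 1"
  using someI_ex[OF assms[unfolded invertible_def]] unfolding matrix_inv_def by auto

lemma invertible_inv_mult: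
  fixes g :: "complex ^ 'n ^ 'n"
  assumes "invertible g"
  shows "g *v (matrix_inv g *v x) = x" "matrix_inv g *v (g *v x) = x"
  using matrix_inv_mult[OF assms] by (simp_all add: matrix_vector_mul_assoc)

lemma invertible_matrix_inv: "invertible g \<Longrightarrow> invertible (matrix_inv (g :: complex ^ 'n ^ 'n))"
  using matrix_inv_mult unfolding invertible_def by blast

lemma mult_act: "mult (act g \<mu>) x y = g *v mult \<mu> (matrix_inv g *v x) (matrix_inv g *v y)"
proof -
  have exp: "matrix_inv g *v x = (\<Sum>i\<in>UNIV. x $ i *s (matrix_inv g *v axis i 1))"
    for x :: "complex ^ 'a"
    using arg_cong[OF basis_sum[of x], of "\<lambda>v. matrix_inv g *v v"] by (simp only: vec.sum vec.scale)
  have "mult (act g \<mu>) x y = (\<Sum>i\<in>UNIV. \<Sum>j\<in>UNIV. (x $ i * y $ j) *s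
      (g *v mult \<mu> (matrix_inv g *v axis i 1) (matrix_inv g *v axis j 1)))"
    by (simp add: mult_def[of "act g \<mu>"]) (simp add: act_def)
  also have "\<dots> = g *v mult \<mu> (matrix_inv g *v x) (matrix_inv g *v y)"
    unfolding exp[of x] exp[of y]
    unfolding mult_sum_left mult_scale_left
    unfolding mult_sum_right mult_scale_right vec.sum vec.scale
    by (simp add: vec.scale_sum_right)
  finally show ?thesis .
qed

lemma iso_act: "invertible g \<Longrightarrow> iso g \<mu> (act g \<mu>)"
  by (simp add: iso_def mult_act invertible_inv_mult)

lemma iso_imp_act: "iso g \<mu> \<nu> \<Longrightarrow> \<nu> = act g \<mu>"
proof (rule alg_eqI)
  fix x y
  assume g: "iso g \<mu> \<nu>"
  then have inv: "invertible g"
    by (simp add: iso_def)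
  have "mult \<nu> (g *v (matrix_inv g *v x)) (g *v (matrix_inv g *v y))
      = g *v mult \<mu> (matrix_inv g *v x) (matrix_inv g *v y)"
    using g unfolding iso_def by blast
  then show "mult \<nu> x y = mult (act g \<mu>) x y"
    by (simp add: mult_act invertible_inv_mult(1)[OF inv])
qed

lemma orbit_iso: "\<nu> \<in> orbit \<mu> \<longleftrightarrow> (\<exists>g. iso g \<mu> \<nu>)"
proof
  assume "\<nu> \<in> orbit \<mu>"
  then show "\<exists>g. iso g \<mu> \<nu>"
    unfolding orbit_def using iso_act by blast
next
  assume "\<exists>g. iso g \<mu> \<nu>"
  then show "\<nu> \<in> orbit \<mu>"
    unfolding orbit_def using iso_imp_act iso_def by blast
qed

lemma iso_mat_1: "iso (mat 1) \<mu> \<mu>"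
  unfolding iso_def invertible_def by (auto intro: exI[of _ "mat 1"])

lemma iso_sym: "iso g \<mu> \<nu> \<Longrightarrow> iso (matrix_inv g) \<nu> \<mu>"
  unfolding iso_def by (metis invertible_inv_mult invertible_matrix_inv)

lemma iso_trans: "iso g \<mu> \<nu> \<Longrightarrow> iso h \<nu> \<rho> \<Longrightarrow> iso (h ** g) \<mu> \<rho>"
  unfolding iso_def by (simp add: invertible_mult flip: matrix_vector_mul_assoc)

lemma orbit_refl: "\<mu> \<in> orbit \<mu>"
  using orbit_iso iso_mat_1 by blast

lemma orbit_sym: "\<mu> \<in> orbit \<nu> \<Longrightarrow> \<nu> \<in> orbit \<mu>"
  using orbit_iso iso_sym by blast

lemma orbit_trans: "\<mu> \<in> orbit \<nu> \<Longrightarrow> \<nu> \<in> orbit \<rho> \<Longrightarrow> \<mu> \<in> orbit \<rho>"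
  using orbit_iso iso_trans by blast

lemma orbit_eq: "\<mu> \<in> orbit \<nu> \<Longrightarrow> orbit \<mu> = orbit \<nu>"
  using orbit_sym orbit_trans by blast

lemma iso_jacobian: "iso g \<mu> \<nu> \<Longrightarrow> jacobian \<nu> (g *v x) (g *v y) (g *v z) = g *v jacobian \<mu> x y z"
  by (simp add: jacobian_def iso_def matrix_vector_right_distrib)

lemma iso_surj: "iso g \<mu> \<nu> \<Longrightarrow> \<exists>x'. x = g *v x'"
  unfolding iso_def using invertible_inv_mult(1) by metis

section \<open>Anticommutativity, ordered bases and change of basis\<close>

definition alternating :: "'n::finite alg \<Rightarrow> bool" where
  "alternating \<mu> \<longleftrightarrow> (\<forall>x y. mult \<mu> x y = - mult \<mu> y x)"

lemma alternating_self:
  assumes "alternating \<mu>"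
  shows "mult \<mu> x x = 0"
proof -
  have "mult \<mu> x x = - mult \<mu> x x"
    using assms unfolding alternating_def by blast
  then have "mult \<mu> x x $ i = - (mult \<mu> x x $ i)" for i
    by (metis vector_uminus_component)
  then show ?thesis
    by (simp add: vec_eq_iff equal_neg_zero)
qed

text \<open>Independence of an ordered quadruple through its coefficients: structure constants
  depend on the order, and for explicit vectors the condition becomes a small linear system.\<close>

definition indep4 :: "complex ^ 4 \<Rightarrow> complex ^ 4 \<Rightarrow> complex ^ 4 \<Rightarrow> complex ^ 4 \<Rightarrow> bool" where
  "indep4 x y z w \<longleftrightarrow>
     (\<forall>a b c d. a *s x + b *s y + c *s z + d *s w = 0 \<longrightarrow> a = 0 \<and> b = 0 \<and> c = 0 \<and> d = 0)"

definition basis_matrix :: "complex ^ 4 \<Rightarrow> complex ^ 4 \<Rightarrow> complex ^ 4 \<Rightarrow> complex ^ 4 \<Rightarrow> complex ^ 4 ^ 4"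
  where
  "basis_matrix x y z w = (\<chi> i j. if j = 1 then x $ i else if j = 2 then y $ i
     else if j = 3 then z $ i else w $ i)"

lemma basis_matrix_mult:
  "basis_matrix x y z w *v c = c $ 1 *s x + c $ 2 *s y + c $ 3 *s z + c $ 4 *s w"
  by (simp add: vec_eq_iff basis_matrix_def matrix_vector_mult_def sum_4 mult.commute)

lemma invertible_basis_matrix:
  assumes "indep4 x y z w"
  shows "invertible (basis_matrix x y z w)"
  unfolding invertible_left_inverse matrix_left_invertible_ker
proof (intro allI impI)
  fix c
  assume "basis_matrix x y z w *v c = 0"
  then have "c $ 1 = 0 \<and> c $ 2 = 0 \<and> c $ 3 = 0 \<and> c $ 4 = 0"
    using assms unfolding basis_matrix_mult indep4_def by blast
  then show "c = 0"
    by (simp add: vec_eq_iff forall_4)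
qed

lemma indep4_span:
  assumes "indep4 x y z w"
  obtains a b c d where "v = a *s x + b *s y + c *s z + d *s w"
  using invertible_inv_mult(1)[OF invertible_basis_matrix[OF assms], of v]
  unfolding basis_matrix_mult by metis

lemma indep4_eq:
  assumes "indep4 x y z w"
    and "a *s x + b *s y + c *s z + d *s w = a' *s x + b' *s y + c' *s z + d' *s w"
  shows "a = a' \<and> b = b' \<and> c = c' \<and> d = d'"
proof -
  have "(a - a') *s x + (b - b') *s y + (c - c') *s z + (d - d') *s w = 0"
    using assms(2) by (simp add: vec_eq_iff algebra_simps)
  then show ?thesis
    using assms(1) unfolding indep4_def by fastforce
qed

text \<open>The source of the isomorphisms with models below. The matrix with columns
  \<open>x\<close>, \<open>y\<close>, \<open>z\<close>, \<open>w\<close> carries the standard basis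
  to this one; bilinearity and anticommutativity reduce the intertwining property to six
  products.\<close>

lemma orbit_basisI:
  fixes \<mu> \<nu> :: "4 alg"
  assumes "alternating \<mu>" "alternating \<nu>" "indep4 x y z w"
    and "mult \<mu> x y = basis_matrix x y z w *v (\<nu> $ 1 $ 2)"
    and "mult \<mu> x z = basis_matrix x y z w *v (\<nu> $ 1 $ 3)"
    and "mult \<mu> x w = basis_matrix x y z w *v (\<nu> $ 1 $ 4)"
    and "mult \<mu> y z = basis_matrix x y z w *v (\<nu> $ 2 $ 3)"
    and "mult \<mu> y w = basis_matrix x y z w *v (\<nu> $ 2 $ 4)"
    and "mult \<mu> z w = basis_matrix x y z w *v (\<nu> $ 3 $ 4)"
  shows "\<mu> \<in> orbit \<nu>"
proof -
  let ?g = "basis_matrix x y z w"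
  have g: "?g *v axis 1 1 = x" "?g *v axis 2 1 = y" "?g *v axis 3 1 = z" "?g *v axis 4 1 = w"
    unfolding basis_matrix_mult by (simp_all add: axis_def)
  have sw: "mult \<mu> v u = - (?g *v c')" if "mult \<mu> u v = ?g *v c'" for u v c'
    using assms(1) that unfolding alternating_def by metis
  have sn: "\<nu> $ i $ j = - \<nu> $ j $ i" for i j
    using assms(2) unfolding alternating_def by (metis mult_axis)
  have sd: "\<nu> $ i $ i = 0" for i
    using alternating_self[OF assms(2)] by (metis mult_axis)
  have "\<forall>i j. mult \<mu> (?g *v axis i 1) (?g *v axis j 1) = ?g *v (\<nu> $ i $ j)"
    unfolding forall_4 g
    using assms(4-) sw[OF assms(4)] sw[OF assms(5)] sw[OF assms(6)] sw[OF assms(7)] sw[OF assms(8)]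
      sw[OF assms(9)]
    by (simp add: sd alternating_self[OF assms(1)] sn[of 2 1] sn[of 3 1] sn[of 4 1] sn[of 3 2]
        sn[of 4 2] sn[of 4 3] vec.neg)
  then have b: "mult \<mu> (?g *v axis i 1) (?g *v axis j 1) = ?g *v mult \<nu> (axis i 1) (axis j 1)" for i j
    by (simp add: mult_axis)
  have "mult \<mu> (?g *v a) (?g *v b) = ?g *v mult \<nu> a b" for a b :: "complex ^ 4"
  proof -
    have "mult \<mu> (?g *v (\<Sum>i\<in>UNIV. a $ i *s axis i 1)) (?g *v (\<Sum>i\<in>UNIV. b $ i *s axis i 1))
      = ?g *v mult \<nu> (\<Sum>i\<in>UNIV. a $ i *s axis i 1) (\<Sum>i\<in>UNIV. b $ i *s axis i 1)"
      by (simp only: vec.sum vec.scale mult_sum_left mult_sum_right mult_scale_left mult_scale_right b)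
    then show ?thesis
      by (simp only: flip: basis_sum)
  qed
  then show ?thesis
    unfolding orbit_iso iso_def using invertible_basis_matrix[OF assms(3)] by blast
qed

lemma indep4_comb:
  assumes "indep4 x y z w"
    and "\<And>a b c d. a * x1 + b * y1 + c * z1 + d * w1 = 0 \<Longrightarrow> a * x2 + b * y2 + c * z2 + d * w2 = 0 \<Longrightarrow>
        a * x3 + b * y3 + c * z3 + d * w3 = 0 \<Longrightarrow> a * x4 + b * y4 + c * z4 + d * w4 = 0 \<Longrightarrow>
        a = 0 \<and> b = 0 \<and> c = 0 \<and> d = 0"
  shows "indep4 (x1 *s x + x2 *s y + x3 *s z + x4 *s w) (y1 *s x + y2 *s y + y3 *s z + y4 *s w)
    (z1 *s x + z2 *s y + z3 *s z + z4 *s w) (w1 *s x + w2 *s y + w3 *s z + w4 *s w)"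
  unfolding indep4_def
proof (intro allI impI)
  fix a b c d
  assume h: "a *s (x1 *s x + x2 *s y + x3 *s z + x4 *s w) + b *s (y1 *s x + y2 *s y + y3 *s z + y4 *s w)
    + c *s (z1 *s x + z2 *s y + z3 *s z + z4 *s w) + d *s (w1 *s x + w2 *s y + w3 *s z + w4 *s w) = 0"
  have "(a * x1 + b * y1 + c * z1 + d * w1) *s x + (a * x2 + b * y2 + c * z2 + d * w2) *s y
    + (a * x3 + b * y3 + c * z3 + d * w3) *s z + (a * x4 + b * y4 + c * z4 + d * w4) *s w = 0"
    unfolding h[symmetric] by (simp add: vec_eq_iff algebra_simps)
  then show "a = 0 \<and> b = 0 \<and> c = 0 \<and> d = 0"
    using assms unfolding indep4_def by blast
qed

text \<open>The form used for changes of basis. After \<open>OF\<close> its \<open>of\<close> list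
  reads row by row: a placeholder for each new vector, followed by its four old coordinates.\<close>

lemma indep4_combI:
  assumes "indep4 x y z w"
    and "x' = x1 *s x + x2 *s y + x3 *s z + x4 *s w" "y' = y1 *s x + y2 *s y + y3 *s z + y4 *s w"
    and "z' = z1 *s x + z2 *s y + z3 *s z + z4 *s w" "w' = w1 *s x + w2 *s y + w3 *s z + w4 *s w"
    and "\<And>a b c d. a * x1 + b * y1 + c * z1 + d * w1 = 0 \<Longrightarrow> a * x2 + b * y2 + c * z2 + d * w2 = 0 \<Longrightarrow>
        a * x3 + b * y3 + c * z3 + d * w3 = 0 \<Longrightarrow> a * x4 + b * y4 + c * z4 + d * w4 = 0 \<Longrightarrow>
        a = 0 \<and> b = 0 \<and> c = 0 \<and> d = 0"
  shows "indep4 x' y' z' w'"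
  unfolding assms(2-5) by (rule indep4_comb[OF assms(1)]) (rule assms(6))

lemma indep4_axis: "indep4 (e 1) (e 2) (e 3) (e 4)"
  by (simp add: indep4_def vec_eq_iff forall_4 axis_def)

section \<open>Recognising the algebras of the list\<close>

lemma mult_plus: "mult (\<mu> + \<nu>) x y = mult \<mu> x y + mult \<nu> x y"
  by (simp add: mult_def vec.scale_right_distrib sum.distrib)

lemma mult_bracket:
  assumes "i \<noteq> j"
  shows "mult (bracket i j v) x y = (x $ i * y $ j - x $ j * y $ i) *s v"
proof -
  have "(x $ a * y $ b) *s (bracket i j v $ a $ b)
      = (if b = j then if a = i then (x $ i * y $ j) *s v else 0 else 0)
      + (if b = i then if a = j then - (x $ j * y $ i) *s v else 0 else 0)" for a b
    using assms by (auto simp: bracket_def vec_eq_iff)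
  then show ?thesis
    by (simp add: mult_def sum.distrib vec.scale_left_diff_distrib)
qed

lemma alternating_bracket: "i \<noteq> j \<Longrightarrow> alternating (bracket i j v)"
  by (simp add: alternating_def mult_bracket vec_eq_iff algebra_simps)

lemma alternating_plus: "alternating \<mu> \<Longrightarrow> alternating \<nu> \<Longrightarrow> alternating (\<mu> + \<nu>)"
  unfolding alternating_def mult_plus by (metis minus_add_distrib)

lemma alternating_C4: "alternating C4"
  by (simp add: alternating_def mult_def C4_def)

lemmas model_defs = C4_def n3_C_def n4_def r2_C2_def r2_r2_def sl2_C_def g1_def g2_def g3_def g4_def g5_def g6_def

lemma alternating_n3_C: "alternating n3_C"
  unfolding n3_C_def by (intro alternating_plus alternating_bracket) simp_all

lemma alternating_n4: "alternating n4"
  unfolding n4_def by (intro alternating_plus alternating_bracket) simp_all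

lemma alternating_r2_C2: "alternating r2_C2"
  unfolding r2_C2_def by (intro alternating_plus alternating_bracket) simp_all

lemma alternating_r2_r2: "alternating r2_r2"
  unfolding r2_r2_def by (intro alternating_plus alternating_bracket) simp_all

lemma alternating_sl2_C: "alternating sl2_C"
  unfolding sl2_C_def by (intro alternating_plus alternating_bracket) simp_all

lemma alternating_g1: "alternating g1"
  unfolding g1_def by (intro alternating_plus alternating_bracket) simp_all

lemma alternating_g2: "alternating (g2 \<beta>)"
  unfolding g2_def by (intro alternating_plus alternating_bracket) simp_all

lemma alternating_g3: "alternating (g3 \<beta>)"
  unfolding g3_def by (intro alternating_plus alternating_bracket) simp_all

lemma alternating_g4: "alternating (g4 \<alpha> \<beta>)"
  unfolding g4_def by (intro alternating_plus alternating_bracket) simp_all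

lemma alternating_g5: "alternating (g5 \<alpha>)"
  unfolding g5_def by (intro alternating_plus alternating_bracket) simp_all

lemma alternating_g6: "alternating g6"
  unfolding g6_def by (intro alternating_plus alternating_bracket) simp_all

text \<open>From here to \<open>orbit_g6I\<close>, \<open>orbit_basisI\<close> is specialised to one
  multiplication table per model, so that recognising an algebra amounts to exhibiting a
  basis.\<close>

lemma orbit_C4I:
  assumes "alternating \<mu>" "indep4 x y z w"
    and "mult \<mu> x y = 0" "mult \<mu> x z = 0" "mult \<mu> x w = 0"
    and "mult \<mu> y z = 0" "mult \<mu> y w = 0" "mult \<mu> z w = 0"
  shows "\<mu> \<in> orbit C4"
  by (rule orbit_basisI[OF assms(1) alternating_C4 assms(2)])
    (simp_all add: assms C4_def bracket_def basis_matrix_mult axis_def)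

lemma orbit_n3_CI:
  assumes "alternating \<mu>" "indep4 x y z w"
    and "mult \<mu> x y = z" "mult \<mu> x z = 0" "mult \<mu> x w = 0"
    and "mult \<mu> y z = 0" "mult \<mu> y w = 0" "mult \<mu> z w = 0"
  shows "\<mu> \<in> orbit n3_C"
  by (rule orbit_basisI[OF assms(1) alternating_n3_C assms(2)])
    (simp_all add: assms n3_C_def bracket_def basis_matrix_mult axis_def)

lemma orbit_n4I:
  assumes "alternating \<mu>" "indep4 x y z w"
    and "mult \<mu> x y = z" "mult \<mu> x z = w" "mult \<mu> x w = 0"
    and "mult \<mu> y z = 0" "mult \<mu> y w = 0" "mult \<mu> z w = 0"
  shows "\<mu> \<in> orbit n4"
  by (rule orbit_basisI[OF assms(1) alternating_n4 assms(2)])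
    (simp_all add: assms n4_def bracket_def basis_matrix_mult axis_def)

lemma orbit_r2_C2I:
  assumes "alternating \<mu>" "indep4 x y z w"
    and "mult \<mu> x y = y" "mult \<mu> x z = 0" "mult \<mu> x w = 0"
    and "mult \<mu> y z = 0" "mult \<mu> y w = 0" "mult \<mu> z w = 0"
  shows "\<mu> \<in> orbit r2_C2"
  by (rule orbit_basisI[OF assms(1) alternating_r2_C2 assms(2)])
    (simp_all add: assms r2_C2_def bracket_def basis_matrix_mult axis_def)

lemma orbit_r2_r2I:
  assumes "alternating \<mu>" "indep4 x y z w"
    and "mult \<mu> x y = y" "mult \<mu> x z = 0" "mult \<mu> x w = 0"
    and "mult \<mu> y z = 0" "mult \<mu> y w = 0" "mult \<mu> z w = w"
  shows "\<mu> \<in> orbit r2_r2"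
  by (rule orbit_basisI[OF assms(1) alternating_r2_r2 assms(2)])
    (simp_all add: assms r2_r2_def bracket_def basis_matrix_mult axis_def)

lemma orbit_sl2_CI:
  assumes "alternating \<mu>" "indep4 x y z w"
    and "mult \<mu> x y = y" "mult \<mu> x z = - z" "mult \<mu> x w = 0"
    and "mult \<mu> y z = x" "mult \<mu> y w = 0" "mult \<mu> z w = 0"
  shows "\<mu> \<in> orbit sl2_C"
  by (rule orbit_basisI[OF assms(1) alternating_sl2_C assms(2)])
    (simp_all add: assms sl2_C_def bracket_def basis_matrix_mult axis_def)

lemma orbit_g1I:
  assumes "alternating \<mu>" "indep4 x y z w"
    and "mult \<mu> x y = y" "mult \<mu> x z = z" "mult \<mu> x w = w"
    and "mult \<mu> y z = 0" "mult \<mu> y w = 0" "mult \<mu> z w = 0"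
  shows "\<mu> \<in> orbit g1"
  by (rule orbit_basisI[OF assms(1) alternating_g1 assms(2)])
    (simp_all add: assms g1_def bracket_def basis_matrix_mult axis_def)

lemma orbit_g2I:
  assumes "alternating \<mu>" "indep4 x y z w"
    and "mult \<mu> x y = y" "mult \<mu> x z = z" "mult \<mu> x w = z + \<beta> *s w"
    and "mult \<mu> y z = 0" "mult \<mu> y w = 0" "mult \<mu> z w = 0"
  shows "\<mu> \<in> orbit (g2 \<beta>)"
  by (rule orbit_basisI[OF assms(1) alternating_g2 assms(2)])
    (simp_all add: assms g2_def bracket_def basis_matrix_mult axis_def)

lemma orbit_g3I:
  assumes "alternating \<mu>" "indep4 x y z w"
    and "mult \<mu> x y = y" "mult \<mu> x z = z" "mult \<mu> x w = \<beta> *s w"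
    and "mult \<mu> y z = w" "mult \<mu> y w = 0" "mult \<mu> z w = 0"
  shows "\<mu> \<in> orbit (g3 \<beta>)"
  by (rule orbit_basisI[OF assms(1) alternating_g3 assms(2)])
    (simp_all add: assms g3_def bracket_def basis_matrix_mult axis_def)

lemma orbit_g4I:
  assumes "alternating \<mu>" "indep4 x y z w"
    and "mult \<mu> x y = y" "mult \<mu> x z = y + \<alpha> *s z" "mult \<mu> x w = z + \<beta> *s w"
    and "mult \<mu> y z = 0" "mult \<mu> y w = 0" "mult \<mu> z w = 0"
  shows "\<mu> \<in> orbit (g4 \<alpha> \<beta>)"
  by (rule orbit_basisI[OF assms(1) alternating_g4 assms(2)])
    (simp_all add: assms g4_def bracket_def basis_matrix_mult axis_def)

lemma orbit_g5I:
  assumes "alternating \<mu>" "indep4 x y z w"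
    and "mult \<mu> x y = y" "mult \<mu> x z = y + \<alpha> *s z" "mult \<mu> x w = (\<alpha> + 1) *s w"
    and "mult \<mu> y z = w" "mult \<mu> y w = 0" "mult \<mu> z w = 0"
  shows "\<mu> \<in> orbit (g5 \<alpha>)"
  by (rule orbit_basisI[OF assms(1) alternating_g5 assms(2)])
    (simp_all add: assms g5_def bracket_def basis_matrix_mult axis_def)

lemma orbit_g6I:
  assumes "alternating \<mu>" "indep4 x y z w"
    and "mult \<mu> x y = z" "mult \<mu> x z = 0" "mult \<mu> x w = 0"
    and "mult \<mu> y z = 0" "mult \<mu> y w = 0" "mult \<mu> z w = z"
  shows "\<mu> \<in> orbit g6"
  by (rule orbit_basisI[OF assms(1) alternating_g6 assms(2)])
    (simp_all add: assms g6_def bracket_def basis_matrix_mult axis_def)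

section \<open>Abelian ideals of codimension one\<close>

lemma quadratic_roots:
  fixes s m :: complex
  obtains a b where "a + b = s" "a * b = m"
proof
  show "(s + csqrt (s\<^sup>2 - 4 * m)) / 2 + (s - csqrt (s\<^sup>2 - 4 * m)) / 2 = s"
    by (simp add: field_simps)
  have "(s + csqrt (s\<^sup>2 - 4 * m)) * (s - csqrt (s\<^sup>2 - 4 * m)) = s\<^sup>2 - (csqrt (s\<^sup>2 - 4 * m))\<^sup>2"
    by (simp add: algebra_simps power2_eq_square)
  then show "(s + csqrt (s\<^sup>2 - 4 * m)) / 2 * ((s - csqrt (s\<^sup>2 - 4 * m)) / 2) = m"
    by simp
qed

text \<open>A nonzero root, if there is one, comes first, since the normal forms divide by
  \<open>a\<close>.\<close>

lemma quadratic_roots_nz: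
  fixes s m :: complex
  obtains a b where "a + b = s" "a * b = m" "a = 0 \<Longrightarrow> b = 0"
  using quadratic_roots[of s m] by (metis add.commute mult.commute)

text \<open>These are the roots of t^3 - r t^2 - q t - p, the characteristic polynomial of the
  companion form in \<open>abelian_companion\<close>. Again \<open>a\<close> vanishes only if all
  roots do.\<close>

lemma cubic_roots:
  fixes p q r :: complex
  obtains a b c where "r = a + b + c" "q = - (a * b + a * c + b * c)" "p = a * b * c"
    "a = 0 \<Longrightarrow> b = 0 \<and> c = 0"
proof -
  have "\<exists>l. poly [:-p, -q, -r, 1:] l = 0"
    by (rule fundamental_theorem_of_algebra) (simp add: constant_degree)
  then obtain l where l: "l ^ 3 - r * l\<^sup>2 - q * l - p = 0"
    by (auto simp: algebra_simps power2_eq_square power3_eq_cube)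
  obtain b c where bc: "b + c = r - l" "b * c = l\<^sup>2 - r * l - q"
    by (rule quadratic_roots)
  have *: "r = l + b + c" "q = - (l * b + l * c + b * c)" "p = l * b * c"
    using l bc by algebra+
  show ?thesis
  proof (cases "l = 0")
    case False
    then show ?thesis
      using that[OF *] by blast
  next
    case True
    show ?thesis
      using that[of b c l] that[of c b l] * True by (cases "b = 0") (auto simp: algebra_simps)
  qed
qed

lemma indep4_scale:
  assumes "indep4 x y z w" "a \<noteq> 0" "b \<noteq> 0" "c \<noteq> 0" "d \<noteq> 0"
  shows "indep4 (a *s x) (b *s y) (c *s z) (d *s w)"
  using indep4_comb[OF assms(1), of a 0 0 0 0 b 0 0 0 0 c 0 0 0 0 d] assms(2-) by simp

lemma indep4_perm:
  assumes "indep4 x y z w"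
  shows "indep4 x z y w" "indep4 x y w z" "indep4 y x z w"
  using indep4_comb[OF assms, of 1 0 0 0 0 0 1 0 0 1 0 0 0 0 0 1]
    indep4_comb[OF assms, of 1 0 0 0 0 1 0 0 0 0 0 1 0 0 1 0]
    indep4_comb[OF assms, of 0 1 0 0 1 0 0 0 0 0 1 0 0 0 0 1] by simp_all

lemma alternating_swap: "alternating \<mu> \<Longrightarrow> mult \<mu> x y = v \<Longrightarrow> mult \<mu> y x = - v"
  unfolding alternating_def by metis

lemma alternating_swap0: "alternating \<mu> \<Longrightarrow> mult \<mu> x y = 0 \<Longrightarrow> mult \<mu> y x = 0"
  unfolding alternating_def by (metis minus_zero)

text \<open>On the abelian ideal \<open>x\<close> acts by a triangular matrix with eigenvalues a, b,
  c. Dividing \<open>x\<close> by a nonzero eigenvalue normalises it to 1, so only the proportion a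
  : b : c survives.\<close>

lemma abelian_triangular:
  assumes alt: "alternating \<mu>" and ind: "indep4 x y z w"
    and ab: "mult \<mu> y z = 0" "mult \<mu> y w = 0" "mult \<mu> z w = 0"
    and D: "mult \<mu> x y = a *s y" "mult \<mu> x z = y + b *s z" "mult \<mu> x w = z + c *s w"
    and "a \<noteq> 0"
  shows "\<mu> \<in> orbit (g4 (b / a) (c / a))"
proof (rule orbit_g4I[OF alt])
  \<comment> \<open>Dividing \<open>x\<close> by a also divides the ones above the diagonal; the
    factors on \<open>y\<close> and \<open>z\<close> restore them.\<close>
  show "indep4 ((1/a) *s x) ((1/a\<^sup>2) *s y) ((1/a) *s z) (1 *s w)"
    by (rule indep4_scale[OF ind]) (use \<open>a \<noteq> 0\<close> in auto)
qed (use \<open>a \<noteq> 0\<close> in \<open>simp_all add: mult_linear D ab vec_eq_iff field_simps power2_eq_square\<close>)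

text \<open>Here \<open>y\<close> is a cyclic vector for multiplication by \<open>x\<close>. Such an
  operator is triangular with ones above the diagonal in a suitable basis, whether or not its
  eigenvalues are distinct.\<close>

lemma abelian_companion:
  assumes alt: "alternating \<mu>" and ind: "indep4 x y z w"
    and ab: "mult \<mu> y z = 0" "mult \<mu> y w = 0" "mult \<mu> z w = 0"
    and D: "mult \<mu> x y = z" "mult \<mu> x z = w" "mult \<mu> x w = p *s y + q *s z + r *s w"
  shows "\<mu> \<in> orbits ({n4} \<union> (\<Union>\<alpha>. \<Union>\<beta>. {g4 \<alpha> \<beta>}))"
proof -
  obtain a b c where r: "r = a + b + c" "q = - (a * b + a * c + b * c)" "p = a * b * c"
    and nz: "a = 0 \<Longrightarrow> b = 0 \<and> c = 0"
    by (rule cubic_roots[of r q p]) blast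
  show ?thesis
  proof (cases "a = 0")
    case True
    then have "\<mu> \<in> orbit n4"
      using nz by (intro orbit_n4I[OF alt ind]) (simp_all add: D ab r)
    then show ?thesis
      by (auto simp: orbits_def)
  next
    case False
    note sw = alternating_swap0[OF alt ab(1)] alternating_swap0[OF alt ab(2)] alternating_swap0[OF alt ab(3)]
    \<comment> \<open>For D the multiplication by \<open>x\<close> these are (D - b)(D - c)y, (D -
      c)y and y; by Cayley-Hamilton the first is an eigenvector for a.\<close>
    have "indep4 x (w - (b + c) *s z + (b * c) *s y) (z - c *s y) y"
      by (rule indep4_combI[OF ind, of _ 1 0 0 0 _ 0 "b * c" "- (b + c)" 1 _ 0 "- c" 1 0 _ 0 1 0 0])
        (auto simp: vec_eq_iff algebra_simps)
    then have "\<mu> \<in> orbit (g4 (b / a) (c / a))"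
      by (rule abelian_triangular[OF alt])
        (use False in \<open>simp_all add: mult_linear D ab sw alternating_self[OF alt] r vec_eq_iff algebra_simps\<close>)
    then show ?thesis
      by (auto simp: orbits_def)
  qed
qed

definition abelian_models :: "4 alg set" where
  "abelian_models = {n4, n3_C, C4, r2_C2, g1} \<union> (\<Union>\<alpha>. \<Union>\<beta>. {g4 \<alpha> \<beta>}) \<union> (\<Union>\<beta>. {g2 \<beta>})"

lemma abelian_modelsI:
  "\<mu> \<in> orbit n4 \<Longrightarrow> \<mu> \<in> orbits abelian_models"
  "\<mu> \<in> orbit n3_C \<Longrightarrow> \<mu> \<in> orbits abelian_models"
  "\<mu> \<in> orbit C4 \<Longrightarrow> \<mu> \<in> orbits abelian_models"
  "\<mu> \<in> orbit r2_C2 \<Longrightarrow> \<mu> \<in> orbits abelian_models"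
  "\<mu> \<in> orbit g1 \<Longrightarrow> \<mu> \<in> orbits abelian_models"
  "\<mu> \<in> orbit (g2 \<beta>) \<Longrightarrow> \<mu> \<in> orbits abelian_models"
  "\<mu> \<in> orbit (g4 \<alpha> \<beta>) \<Longrightarrow> \<mu> \<in> orbits abelian_models"
  by (auto simp: orbits_def abelian_models_def)

text \<open>Multiplication by \<open>x\<close> minus r has the line of \<open>v\<close> as image.
  The model depends on whether r and m vanish and whether they agree.\<close>

lemma abelian_rank_one:
  assumes alt: "alternating \<mu>" and ind: "indep4 x y v z"
    and ab: "mult \<mu> y v = 0" "mult \<mu> y z = 0" "mult \<mu> v z = 0"
    and D: "mult \<mu> x y = r *s y + v" "mult \<mu> x v = m *s v" "mult \<mu> x z = r *s z"
  shows "\<mu> \<in> orbits abelian_models"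
proof -
  note sw = ab alternating_swap0[OF alt ab(1)] alternating_swap0[OF alt ab(2)]
    alternating_swap0[OF alt ab(3)] alternating_self[OF alt]
  consider "r = 0" "m = 0" | "r = 0" "m \<noteq> 0" | "r \<noteq> 0" "m = r" | "r \<noteq> 0" "m \<noteq> r"
    by blast
  then show ?thesis
  proof cases
    case 1
    have "\<mu> \<in> orbit n3_C"
      by (rule orbit_n3_CI[OF alt ind]) (simp_all add: D sw 1)
    then show ?thesis
      by (rule abelian_modelsI)
  next
    case 2
    have "indep4 ((1/m) *s x) v (y - (1/m) *s v) z"
      by (rule indep4_combI[OF ind, of _ "1/m" 0 0 0 _ 0 0 1 0 _ 0 1 "-1/m" 0 _ 0 0 0 1])
        (use 2 in \<open>auto simp: vec_eq_iff algebra_simps\<close>)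
    then have "\<mu> \<in> orbit r2_C2"
      by (rule orbit_r2_C2I[OF alt])
        (use 2 in \<open>simp_all add: D sw mult_linear vec_eq_iff algebra_simps\<close>)
    then show ?thesis
      by (rule abelian_modelsI)
  next
    case 3
    have "indep4 ((1/r) *s x) z ((1/r) *s v) y"
      by (rule indep4_combI[OF ind, of _ "1/r" 0 0 0 _ 0 0 0 1 _ 0 0 "1/r" 0 _ 0 1 0 0])
        (use 3 in \<open>auto simp: vec_eq_iff algebra_simps\<close>)
    then have "\<mu> \<in> orbit (g2 1)"
      by (rule orbit_g2I[OF alt])
        (use 3 in \<open>simp_all add: D sw mult_linear vec_eq_iff field_simps\<close>)
    then show ?thesis
      by (rule abelian_modelsI)
  next
    case 4
    have k: "r - m \<noteq> 0"
      using 4 by simp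
    \<comment> \<open>\<open>(r - m) *s y + v\<close> is an eigenvector for r, and x/r sends
      \<open>r *s y\<close> to this vector plus m/r times \<open>r *s y\<close>.\<close>
    have "indep4 ((1/r) *s x) z ((r - m) *s y + v) (r *s y)"
      by (rule indep4_combI[OF ind, of _ "1/r" 0 0 0 _ 0 0 0 1 _ 0 "r - m" 1 0 _ 0 r 0 0])
        (use 4 in \<open>auto simp: vec_eq_iff algebra_simps\<close>)
    then have "\<mu> \<in> orbit (g2 (m / r))"
      by (rule orbit_g2I[OF alt])
        (use 4 in \<open>simp_all add: D sw mult_linear vec_eq_iff field_simps\<close>)
    then show ?thesis
      by (rule abelian_modelsI)
  qed
qed

text \<open>For \<open>d = 0\<close>, \<open>t P(t)\<close> below is the determinant of \<open>u\<close>, \<open>xu\<close>, \<open>x(xu)\<close> for \<open>u = y + tz\<close>. If it vanishes for all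
  \<open>t\<close>, then multiplication by \<open>x\<close> is a scalar plus an operator of rank one.\<close>

lemma abelian_cyclic_or_rank_one:
  assumes alt: "alternating \<mu>" and ind: "indep4 x y f z"
    and ab: "mult \<mu> y f = 0" "mult \<mu> y z = 0" "mult \<mu> f z = 0"
    and D: "mult \<mu> x y = f" "mult \<mu> x f = b *s y + c *s f + d *s z"
      "mult \<mu> x z = p *s y + q *s f + r *s z"
  shows "\<mu> \<in> orbits abelian_models"
proof -
  note sw = ab alternating_swap0[OF alt ab(1)] alternating_swap0[OF alt ab(2)]
    alternating_swap0[OF alt ab(3)] alternating_self[OF alt]
  have comp: "\<mu> \<in> orbits abelian_models" if "\<mu> \<in> orbits ({n4} \<union> (\<Union>\<alpha>. \<Union>\<beta>. {g4 \<alpha> \<beta>}))"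
    using that by (auto simp: orbits_def abelian_models_def)
  show ?thesis
  proof (cases "d = 0")
    case False
    have "indep4 x y f (b *s y + c *s f + d *s z)"
      by (rule indep4_combI[OF ind, of _ 1 0 0 0 _ 0 1 0 0 _ 0 0 1 0 _ 0 b c d])
        (use False in \<open>auto simp: vec_eq_iff algebra_simps\<close>)
    \<comment> \<open>The constants used here are the coordinates of D(Df) in y, f, Df, where D is
      multiplication by \<open>x\<close> and d z has been replaced by Df - b y - c f.\<close>
    then have "\<mu> \<in> orbits ({n4} \<union> (\<Union>\<alpha>. \<Union>\<beta>. {g4 \<alpha> \<beta>}))"
      by (rule abelian_companion[OF alt, of _ _ _ _ "d * p - r * b" "b + d * q - r * c" "c + r"])
        (simp_all add: D sw mult_linear vec_eq_iff algebra_simps)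
    then show ?thesis
      by (rule comp)
  next
    case d: True
    define P where "P t = r\<^sup>2 - r * c - b + t * ((c - 2 * r) * p - r * q * c - 2 * q * b)
      + t\<^sup>2 * (p\<^sup>2 + p * q * c - q\<^sup>2 * b)" for t
    show ?thesis
    proof (cases "\<exists>t. t \<noteq> 0 \<and> P t \<noteq> 0")
      case True
      then obtain t where t: "t \<noteq> 0" "P t \<noteq> 0"
        by blast
      have "indep4 x (y + t *s z) (f + t *s (p *s y + q *s f + r *s z))
        (b *s y + c *s f + t *s (p *s f + q *s (b *s y + c *s f) + r *s (p *s y + q *s f + r *s z)))"
      proof (rule indep4_combI[OF ind, of _ 1 0 0 0 _ 0 1 0 t _ 0 "t * p" "1 + t * q" "t * r"
            _ 0 "b + t * (q * b + r * p)" "c + t * (p + q * c + r * q)" "t * r\<^sup>2"])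
        fix a1 a2 a3 a4 :: complex
        assume h: "a1 * 1 + a2 * 0 + a3 * 0 + a4 * 0 = 0"
          "a1 * 0 + a2 * 1 + a3 * (t * p) + a4 * (b + t * (q * b + r * p)) = 0"
          "a1 * 0 + a2 * 0 + a3 * (1 + t * q) + a4 * (c + t * (p + q * c + r * q)) = 0"
          "a1 * 0 + a2 * t + a3 * (t * r) + a4 * (t * r\<^sup>2) = 0"
        then have "a4 * t * P t = 0"
          unfolding P_def by algebra
        then have a4: "a4 = 0"
          using t by simp
        have "a3 * t * P t = 0"
          using h unfolding P_def by algebra
        then have "a3 = 0"
          using t by simp
        then show "a1 = 0 \<and> a2 = 0 \<and> a3 = 0 \<and> a4 = 0"
          using h a4 by simp
      qed (simp_all add: vec_eq_iff algebra_simps power2_eq_square)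
      then have "\<mu> \<in> orbits ({n4} \<union> (\<Union>\<alpha>. \<Union>\<beta>. {g4 \<alpha> \<beta>}))"
        by (rule abelian_companion[OF alt, of _ _ _ _ "- b * r" "b - c * r" "c + r"])
          (simp_all add: D d sw mult_linear vec_eq_iff algebra_simps power2_eq_square)
      then show ?thesis
        by (rule comp)
    next
      case False
      \<comment> \<open>\<open>P\<close> has degree at most two in t, so three values determine its
        coefficients.\<close>
      then have "P 1 = 0" "P (-1) = 0" "P 2 = 0"
        using one_neq_zero zero_neq_neg_one zero_neq_numeral by metis+
      then have P: "(r\<^sup>2 - r * c - b) + ((c - 2 * r) * p - r * q * c - 2 * q * b)
          + (p\<^sup>2 + p * q * c - q\<^sup>2 * b) = 0"
        "(r\<^sup>2 - r * c - b) - ((c - 2 * r) * p - r * q * c - 2 * q * b)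
          + (p\<^sup>2 + p * q * c - q\<^sup>2 * b) = 0"
        "(r\<^sup>2 - r * c - b) + 2 * ((c - 2 * r) * p - r * q * c - 2 * q * b)
          + 4 * (p\<^sup>2 + p * q * c - q\<^sup>2 * b) = 0"
        unfolding P_def by (simp_all add: algebra_simps)
      have lin: "A + B + C = 0 \<Longrightarrow> A - B + C = 0 \<Longrightarrow> A + 2 * B + 4 * C = 0 \<Longrightarrow> A = 0 \<and> B = 0 \<and> C = 0"
        for A B C :: complex
      proof -
        assume h: "A + B + C = 0" "A - B + C = 0" "A + 2 * B + 4 * C = 0"
        have "2 * B = (A + B + C) - (A - B + C)" "3 * C = (A + 2 * B + 4 * C) - (A + B + C) - B"
          by simp_all
        then have "B = 0" "C = 0"
          unfolding h by simp_all
        then show ?thesis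
          using h(1) by simp
      qed
      from lin[OF P] have 1: "r\<^sup>2 - r * c - b = 0" "(c - 2 * r) * p - r * q * c - 2 * q * b = 0"
        "p\<^sup>2 + p * q * c - q\<^sup>2 * b = 0"
        by blast+
      \<comment> \<open>The second factor of the second product is p + q r + q (c - 2 r), so the two
        relations combine to a square.\<close>
      have "(c - 2 * r) * (p + q * r) = 0" "(p + q * r) * (p - q * r + q * c) = 0"
        using 1 by algebra+
      then have "(p + q * r)\<^sup>2 = 0"
        by algebra
      then have p: "p = - q * r"
        by (simp add: add_eq_0_iff2)
      have b: "b = r * (r - c)"
        using 1(1) by (simp add: algebra_simps power2_eq_square)
      \<comment> \<open>With these values of p and b, multiplication by \<open>x\<close> minus r
        sends \<open>y\<close> to \<open>f - r *s y\<close> and \<open>z\<close> to q times that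
        vector, hence kills \<open>z - q *s y\<close>.\<close>
      have "indep4 x y (f - r *s y) (z - q *s y)"
        by (rule indep4_combI[OF ind, of _ 1 0 0 0 _ 0 1 0 0 _ 0 "- r" 1 0 _ 0 "- q" 0 1])
          (auto simp: vec_eq_iff algebra_simps)
      then show ?thesis
        by (rule abelian_rank_one[OF alt, of _ _ _ _ r "c - r"])
          (simp_all add: D d sw mult_linear vec_eq_iff algebra_simps p b)
    qed
  qed
qed

text \<open>After renaming the basis, a nonzero off-diagonal entry makes \<open>y1\<close>
  independent of its image. A diagonal matrix that is not scalar acquires such an entry in another
  basis, and scalar matrices give \<open>C4\<close> and \<open>g1\<close>.\<close>

lemma abelian_ideal:
  assumes alt: "alternating \<mu>" and ind: "indep4 x y1 y2 y3"
    and ab: "mult \<mu> y1 y2 = 0" "mult \<mu> y1 y3 = 0" "mult \<mu> y2 y3 = 0"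
    and D: "mult \<mu> x y1 = a1 *s y1 + a2 *s y2 + a3 *s y3"
      "mult \<mu> x y2 = b1 *s y1 + b2 *s y2 + b3 *s y3"
      "mult \<mu> x y3 = c1 *s y1 + c2 *s y2 + c3 *s y3"
  shows "\<mu> \<in> orbits abelian_models"
proof -
  have off_diagonal: "\<mu> \<in> orbits abelian_models"
    if ind: "indep4 x y1 y2 y3"
      and ab: "mult \<mu> y1 y2 = 0" "mult \<mu> y1 y3 = 0" "mult \<mu> y2 y3 = 0"
      and D: "mult \<mu> x y1 = a1 *s y1 + a2 *s y2 + a3 *s y3"
      "mult \<mu> x y2 = b1 *s y1 + b2 *s y2 + b3 *s y3"
      "mult \<mu> x y3 = c1 *s y1 + c2 *s y2 + c3 *s y3" and "a2 \<noteq> 0"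
    for y1 y2 y3 a1 a2 a3 b1 b2 b3 c1 c2 c3
  proof -
    let ?f = "a1 *s y1 + a2 *s y2 + a3 *s y3"
    note sw = ab alternating_swap0[OF alt ab(1)] alternating_swap0[OF alt ab(2)]
      alternating_swap0[OF alt ab(3)] alternating_self[OF alt]
    have i: "indep4 x y1 ?f y3"
      by (rule indep4_combI[OF ind, of _ 1 0 0 0 _ 0 1 0 0 _ 0 a1 a2 a3 _ 0 0 0 1])
        (use \<open>a2 \<noteq> 0\<close> in \<open>auto simp: vec_eq_iff algebra_simps\<close>)
    have f: "mult \<mu> x ?f = (a2 * b1 + a3 * c1 - a1 * (a2 * b2 + a3 * c2) / a2) *s y1
        + (a1 + (a2 * b2 + a3 * c2) / a2) *s ?f
        + (a2 * b3 + a3 * c3 - a3 * (a2 * b2 + a3 * c2) / a2) *s y3"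
      "mult \<mu> x y3 = (c1 - a1 * c2 / a2) *s y1 + (c2 / a2) *s ?f + (c3 - a3 * c2 / a2) *s y3"
      using \<open>a2 \<noteq> 0\<close> by (simp_all add: mult_linear D vec_eq_iff field_simps)
    have "mult \<mu> y1 ?f = 0" "mult \<mu> ?f y3 = 0"
      by (simp_all add: sw mult_linear)
    from abelian_cyclic_or_rank_one[OF alt i this(1) ab(2) this(2) D(1) f] show ?thesis .
  qed
  note sw = alternating_swap0[OF alt ab(1)] alternating_swap0[OF alt ab(2)] alternating_swap0[OF alt ab(3)]
  note ind213 = indep4_perm(1)[OF ind]
  note ind132 = indep4_perm(2)[OF ind]
  note ind231 = indep4_perm(2)[OF ind213]
  note ind312 = indep4_perm(1)[OF ind132]
  have D': "mult \<mu> x y1 = a1 *s y1 + a3 *s y3 + a2 *s y2" "mult \<mu> x y3 = c1 *s y1 + c3 *s y3 + c2 *s y2"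
    "mult \<mu> x y2 = b1 *s y1 + b3 *s y3 + b2 *s y2" "mult \<mu> x y2 = b2 *s y2 + b1 *s y1 + b3 *s y3"
    "mult \<mu> x y1 = a2 *s y2 + a1 *s y1 + a3 *s y3" "mult \<mu> x y3 = c2 *s y2 + c1 *s y1 + c3 *s y3"
    "mult \<mu> x y2 = b2 *s y2 + b3 *s y3 + b1 *s y1" "mult \<mu> x y1 = a2 *s y2 + a3 *s y3 + a1 *s y1"
    "mult \<mu> x y3 = c2 *s y2 + c3 *s y3 + c1 *s y1"
    "mult \<mu> x y1 = a3 *s y3 + a1 *s y1 + a2 *s y2" "mult \<mu> x y2 = b3 *s y3 + b1 *s y1 + b2 *s y2"
    "mult \<mu> x y3 = c3 *s y3 + c1 *s y1 + c2 *s y2"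
    "mult \<mu> x y1 = a3 *s y3 + a2 *s y2 + a1 *s y1" "mult \<mu> x y2 = b3 *s y3 + b2 *s y2 + b1 *s y1"
    "mult \<mu> x y3 = c3 *s y3 + c2 *s y2 + c1 *s y1"
    by (simp_all add: D add_ac)
  consider "a2 \<noteq> 0" | "a3 \<noteq> 0" | "b1 \<noteq> 0" | "b3 \<noteq> 0" | "c1 \<noteq> 0" | "c2 \<noteq> 0"
    | "a2 = 0" "a3 = 0" "b1 = 0" "b3 = 0" "c1 = 0" "c2 = 0"
    by blast
  then show ?thesis
  proof cases
    case 1
    then show ?thesis by (rule off_diagonal[OF ind ab D])
  next
    case 2
    show ?thesis by (rule off_diagonal[OF ind132 ab(2,1) sw(3) D'(1,2,3) 2])
  next
    case 3
    show ?thesis by (rule off_diagonal[OF ind213 sw(1) ab(3,2) D'(4,5,6) 3])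
  next
    case 4
    show ?thesis by (rule off_diagonal[OF ind231 ab(3) sw(1,2) D'(7,9,8) 4])
  next
    case 5
    show ?thesis by (rule off_diagonal[OF ind312 sw(2,3) ab(1) D'(12,10,11) 5])
  next
    case 6
    show ?thesis by (rule off_diagonal[OF indep4_perm(2)[OF ind312] sw(3,2,1) D'(15,14,13) 6])
  next
    case diag: 7
    show ?thesis
    proof (cases "a1 = b2 \<and> a1 = c3")
      case True
      then have eq: "b2 = a1" "c3 = a1"
        by auto
      show ?thesis
      proof (cases "a1 = 0")
        case True
        then have "\<mu> \<in> orbit C4"
          using diag by (intro orbit_C4I[OF alt ind]) (simp_all add: D ab eq)
        then show ?thesis
          by (rule abelian_modelsI)
      next
        case False
        have "indep4 ((1/a1) *s x) (1 *s y1) (1 *s y2) (1 *s y3)"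
          by (rule indep4_scale[OF ind]) (use False in auto)
        then have "\<mu> \<in> orbit g1"
          by (rule orbit_g1I[OF alt])
            (use False diag in \<open>simp_all add: D ab eq mult_linear vec_eq_iff\<close>)
        then show ?thesis
          by (rule abelian_modelsI)
      qed
    next
      case False
      show ?thesis
      proof (cases "a1 = b2")
        case False
        \<comment> \<open>The sum of two eigenvectors with different eigenvalues is not an
          eigenvector.\<close>
        have "indep4 x (y1 + y2) y2 y3"
          by (rule indep4_combI[OF ind, of _ 1 0 0 0 _ 0 1 1 0 _ 0 0 1 0 _ 0 0 0 1])
            (auto simp: vec_eq_iff algebra_simps)
        then show ?thesis
          by (rule off_diagonal[of "y1 + y2" y2 y3 a1 "b2 - a1" 0 0 b2 0 0 0 c3])
            (use False diag in \<open>simp_all add: D ab sw alternating_self[OF alt] mult_linear vec_eq_iff algebra_simps\<close>)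
      next
        case True
        have "indep4 x (y1 + y3) y3 y2"
          by (rule indep4_combI[OF ind, of _ 1 0 0 0 _ 0 1 0 1 _ 0 0 0 1 _ 0 0 1 0])
            (auto simp: vec_eq_iff algebra_simps)
        then show ?thesis
          by (rule off_diagonal[of "y1 + y3" y3 y2 a1 "c3 - a1" 0 0 c3 0 0 0 b2])
            (use True False diag in \<open>simp_all add: D ab sw alternating_self[OF alt] mult_linear vec_eq_iff algebra_simps\<close>)
      qed
    qed
  qed
qed

section \<open>The Heisenberg ideal\<close>

definition heisenberg_models :: "4 alg set" where
  "heisenberg_models = {n4, n3_C, g3 2} \<union> (\<Union>\<alpha>. {g5 \<alpha>})"

lemma heisenberg_modelsI:
  "\<mu> \<in> orbit n4 \<Longrightarrow> \<mu> \<in> orbits heisenberg_models"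
  "\<mu> \<in> orbit n3_C \<Longrightarrow> \<mu> \<in> orbits heisenberg_models"
  "\<mu> \<in> orbit (g3 2) \<Longrightarrow> \<mu> \<in> orbits heisenberg_models"
  "\<mu> \<in> orbit (g5 \<alpha>) \<Longrightarrow> \<mu> \<in> orbits heisenberg_models"
  by (auto simp: orbits_def heisenberg_models_def)

text \<open>The centre of the ideal is the line of \<open>t\<close>, where a derivation acts by its
  trace s on the quotient; on the quotient \<open>y\<close> is cyclic, with characteristic
  polynomial T^2 - s T + m.\<close>

lemma heisenberg_cyclic:
  assumes alt: "alternating \<mu>" and ind: "indep4 x y f t"
    and U: "mult \<mu> y f = k *s t" "mult \<mu> y t = 0" "mult \<mu> f t = 0" and "k \<noteq> 0"
    and D: "mult \<mu> x y = f" "mult \<mu> x f = s *s f - m *s y" "mult \<mu> x t = s *s t"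
  shows "\<mu> \<in> orbits heisenberg_models"
proof -
  obtain a b where ab: "a + b = s" "a * b = m" "a = 0 \<Longrightarrow> b = 0"
    using quadratic_roots_nz[of s m] by blast
  note sw = U D alternating_swap[OF alt U(1)] alternating_swap0[OF alt U(2)] alternating_swap0[OF alt U(3)]
    alternating_swap[OF alt D(1)] alternating_self[OF alt]
  show ?thesis
  proof (cases "a = 0")
    case True
    then have "s = 0" "m = 0"
      using ab by auto
    \<comment> \<open>Both roots vanish, and \<open>y\<close> takes over as the multiplying element:
      it sends -x to f and f to k t.\<close>
    have "indep4 y ((- 1) *s x) f (k *s t)"
      by (rule indep4_combI[OF ind, of _ 0 1 0 0 _ "-1" 0 0 0 _ 0 0 1 0 _ 0 0 0 k])
        (use \<open>k \<noteq> 0\<close> in \<open>auto simp: vec_eq_iff\<close>)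
    then have "\<mu> \<in> orbit n4"
      by (rule orbit_n4I[OF alt])
        (simp_all add: \<open>s = 0\<close> \<open>m = 0\<close> sw mult_linear vec_eq_iff algebra_simps)
    then show ?thesis
      by (rule heisenberg_modelsI)
  next
    case False
    \<comment> \<open>\<open>f - b *s y\<close> is the eigenvector for a, and \<open>x\<close> sends
      \<open>y\<close> to it plus b y.\<close>
    have "indep4 ((1/a) *s x) ((1/a) *s (f - b *s y)) y ((-k/a) *s t)"
      by (rule indep4_combI[OF ind, of _ "1/a" 0 0 0 _ 0 "-b/a" "1/a" 0 _ 0 1 0 0 _ 0 0 0 "-k/a"])
        (use \<open>k \<noteq> 0\<close> False in \<open>auto simp: vec_eq_iff field_simps\<close>)
    then have "\<mu> \<in> orbit (g5 (b / a))"
      by (rule orbit_g5I[OF alt])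
        (use \<open>k \<noteq> 0\<close> False in \<open>simp_all add: ab(1,2)[symmetric] sw mult_linear vec_eq_iff field_simps\<close>)
    then show ?thesis
      by (rule heisenberg_modelsI)
  qed
qed

text \<open>If \<open>x\<close> is not scalar modulo the centre, the quotient has a cyclic vector.
  If it is a scalar a, the centre has eigenvalue 2a, whence \<open>g3 2\<close>, or
  \<open>n3_C\<close> for a = 0.\<close>

lemma heisenberg_ideal:
  assumes alt: "alternating \<mu>" and ind: "indep4 x u w t"
    and U: "mult \<mu> u w = t" "mult \<mu> u t = 0" "mult \<mu> w t = 0"
    and D: "mult \<mu> x u = a *s u + b *s w + k *s t" "mult \<mu> x w = c *s u + d *s w + l *s t"
      "mult \<mu> x t = (a + d) *s t"
  shows "\<mu> \<in> orbits heisenberg_models"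
proof -
  \<comment> \<open>Adding elements of the ideal to \<open>x\<close> changes its action by inner
    derivations, which here remove the components along \<open>t\<close>.\<close>
  define x' where "x' = x + k *s w - l *s u"
  note sw = alternating_swap[OF alt U(1)] alternating_swap0[OF alt U(2)] alternating_swap0[OF alt U(3)]
    alternating_self[OF alt]
  have ind: "indep4 x' u w t"
    by (rule indep4_combI[OF ind, of _ 1 "-l" k 0 _ 0 1 0 0 _ 0 0 1 0 _ 0 0 0 1])
      (auto simp: vec_eq_iff x'_def)
  have D: "mult \<mu> x' u = a *s u + b *s w" "mult \<mu> x' w = c *s u + d *s w" "mult \<mu> x' t = (a + d) *s t"
    by (simp_all add: x'_def mult_linear D U sw vec_eq_iff)
  consider "b \<noteq> 0" | "c \<noteq> 0" | "b = 0" "c = 0" "a \<noteq> d" | "b = 0" "c = 0" "a = d"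
    by blast
  then show ?thesis
  proof cases
    case 1
    have "indep4 x' u (a *s u + b *s w) t"
      by (rule indep4_combI[OF ind, of _ 1 0 0 0 _ 0 1 0 0 _ 0 a b 0 _ 0 0 0 1])
        (use 1 in \<open>auto simp: vec_eq_iff\<close>)
    then show ?thesis
      by (rule heisenberg_cyclic[OF alt, of _ _ _ _ b "a + d" "a * d - b * c"])
        (use 1 in \<open>simp_all add: mult_linear U sw D vec_eq_iff algebra_simps\<close>)
  next
    case 2
    have "indep4 x' w (c *s u + d *s w) t"
      by (rule indep4_combI[OF ind, of _ 1 0 0 0 _ 0 0 1 0 _ 0 c d 0 _ 0 0 0 1])
        (use 2 in \<open>auto simp: vec_eq_iff\<close>)
    then show ?thesis
      by (rule heisenberg_cyclic[OF alt, of _ _ _ _ "- c" "a + d" "a * d - b * c"])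
        (use 2 in \<open>simp_all add: mult_linear U sw D vec_eq_iff algebra_simps\<close>)
  next
    case 3
    have "indep4 x' (u + w) (a *s u + d *s w) t"
      by (rule indep4_combI[OF ind, of _ 1 0 0 0 _ 0 1 1 0 _ 0 a d 0 _ 0 0 0 1])
        (use 3 in \<open>auto simp: vec_eq_iff add_eq_0_iff2\<close>)
    then show ?thesis
      by (rule heisenberg_cyclic[OF alt, of _ _ _ _ "d - a" "a + d" "a * d"])
        (use 3 in \<open>simp_all add: mult_linear U sw D vec_eq_iff algebra_simps\<close>)
  next
    case 4
    show ?thesis
    proof (cases "a = 0")
      case True
      have "indep4 u w t x'"
        by (rule indep4_combI[OF ind, of _ 0 1 0 0 _ 0 0 1 0 _ 0 0 0 1 _ 1 0 0 0])
          (auto simp: vec_eq_iff)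
      then have "\<mu> \<in> orbit n3_C"
        by (rule orbit_n3_CI[OF alt]) (use True 4 in \<open>auto simp: U D alternating_swap0[OF alt]\<close>)
      then show ?thesis
        by (rule heisenberg_modelsI)
    next
      case False
      have "indep4 ((1/a) *s x') (1 *s u) (1 *s w) (1 *s t)"
        by (rule indep4_scale[OF ind]) (use False in auto)
      then have "\<mu> \<in> orbit (g3 2)"
        by (rule orbit_g3I[OF alt]) (use False 4 in \<open>auto simp: mult_linear U D vec_eq_iff field_simps\<close>)
      then show ?thesis
        by (rule heisenberg_modelsI)
    qed
  qed
qed

section \<open>The remaining unimodular ideals\<close>

lemma lie_derivation:
  assumes "\<mu> \<in> Lie"
  shows "mult \<mu> x (mult \<mu> y z) = mult \<mu> (mult \<mu> x y) z + mult \<mu> y (mult \<mu> x z)"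
proof -
  have alt: "mult \<mu> a b = - mult \<mu> b a" for a b
    using assms unfolding Lie_def lie_on_def by blast
  have "mult \<mu> (mult \<mu> x y) z + mult \<mu> (mult \<mu> y z) x + mult \<mu> (mult \<mu> z x) y = 0"
    using assms unfolding Lie_def lie_on_def jacobian_def by blast
  moreover have "mult \<mu> (mult \<mu> y z) x = - mult \<mu> x (mult \<mu> y z)"
    by (rule alt)
  moreover have "mult \<mu> (mult \<mu> z x) y = mult \<mu> y (mult \<mu> x z)"
    using alt[of "mult \<mu> z x" y] alt[of z x] by simp
  ultimately show ?thesis
    by (simp add: algebra_simps)
qed

lemma Lie_alternating: "\<mu> \<in> Lie \<Longrightarrow> alternating \<mu>"
  unfolding Lie_def lie_on_def alternating_def by blast

text \<open>Modulo inner ones, the derivations of this ideal are the multiples s of the map killing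
  \<open>h\<close> and fixing \<open>a\<close>, \<open>b\<close>. For s = 0 the complement is
  central, and a different ideal of codimension one is abelian.\<close>

lemma euclidean_ideal:
  assumes lie: "\<mu> \<in> Lie" and ind: "indep4 x h a b"
    and U: "mult \<mu> h a = a" "mult \<mu> h b = - b" "mult \<mu> a b = 0"
    and D: "mult \<mu> x h = p1 *s h + p2 *s a + p3 *s b" "mult \<mu> x a = q1 *s h + q2 *s a + q3 *s b"
      "mult \<mu> x b = r1 *s h + r2 *s a + r3 *s b"
  shows "\<mu> \<in> orbit r2_r2 \<or> \<mu> \<in> orbit (g4 (- 1) 0)"
proof -
  note alt = Lie_alternating[OF lie]
  note sw = alternating_swap[OF alt U(1)] alternating_swap[OF alt U(2)] alternating_swap0[OF alt U(3)]
    alternating_self[OF alt]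
  have "0 *s x + q1 *s h + (- p1) *s a + (2 * q3) *s b = 0 *s x + 0 *s h + 0 *s a + 0 *s b"
    using lie_derivation[OF lie, of x h a] by (simp add: mult_linear D U sw vec_eq_iff algebra_simps)
  then have 1: "q1 = 0" "p1 = 0" "q3 = 0"
    using indep4_eq[OF ind] by fastforce+
  have "0 *s x + r1 *s h + (2 * r2) *s a + (- p1) *s b = 0 *s x + 0 *s h + 0 *s a + 0 *s b"
    using lie_derivation[OF lie, of x h b] by (simp add: mult_linear D U sw vec_eq_iff algebra_simps)
  then have 2: "r1 = 0" "r2 = 0"
    using indep4_eq[OF ind] by fastforce+
  define s where "s = (q2 + r3) / 2"
  \<comment> \<open>The inner corrections cancel x h and move the eigenvalues q2, r3 to their mean
    s.\<close>
  define x' where "x' = x + p2 *s a - p3 *s b - ((q2 - r3) / 2) *s h"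
  have ind: "indep4 x' h a b"
    by (rule indep4_combI[OF ind, of _ 1 "- (q2 - r3) / 2" p2 "- p3" _ 0 1 0 0 _ 0 0 1 0 _ 0 0 0 1])
      (auto simp: vec_eq_iff x'_def field_simps)
  have D: "mult \<mu> x' h = 0" "mult \<mu> x' a = s *s a" "mult \<mu> x' b = s *s b"
    by (simp_all add: x'_def s_def mult_linear D U sw 1 2 vec_eq_iff field_simps)
  show ?thesis
  proof (cases "s = 0")
    case True
    then have x': "mult \<mu> x' h = 0" "mult \<mu> x' a = 0" "mult \<mu> x' b = 0"
      by (simp_all add: D)
    \<comment> \<open>\<open>h\<close> acts on the span of \<open>a\<close>, \<open>b\<close>,
      \<open>x'\<close> with eigenvalues 1, -1, 0, and the sum of the three eigenvectors is
      cyclic.\<close>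
    have "indep4 h (2 *s a) (a - b) (a + b + x')"
      by (rule indep4_combI[OF ind, of _ 0 1 0 0 _ 0 0 2 0 _ 0 0 1 "-1" _ 1 0 1 1])
        (auto simp: vec_eq_iff)
    then have "\<mu> \<in> orbit (g4 (- 1 / 1) (0 / 1))"
      by (rule abelian_triangular[OF alt])
        (simp_all add: mult_linear x' alternating_swap0[OF alt x'(1)] alternating_swap0[OF alt x'(2)]
          alternating_swap0[OF alt x'(3)] U sw vec_eq_iff)
    then show ?thesis
      by simp
  next
    case False
    \<comment> \<open>Half the sum and half the difference of x'/s and h each act as 1 on one of
      \<open>a\<close>, \<open>b\<close> and as 0 on the other.\<close>
    have "indep4 ((1/2) *s ((1/s) *s x' + h)) a ((1/2) *s ((1/s) *s x' - h)) b"
      by (rule indep4_combI[OF ind, of _ "1/(2 * s)" "1/2" 0 0 _ 0 0 1 0 _ "1/(2 * s)" "- (1/2)" 0 0 _ 0 0 0 1])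
        (use False in \<open>auto simp: vec_eq_iff\<close>)
    then have "\<mu> \<in> orbit r2_r2"
      by (rule orbit_r2_r2I[OF alt])
        (use False in \<open>simp_all add: mult_linear D U sw alternating_swap0[OF alt D(1)] 
          alternating_swap[OF alt D(2)] vec_eq_iff\<close>)
    then show ?thesis ..
  qed
qed

text \<open>Every derivation of this ideal is inner, so subtracting an element of the ideal from
  \<open>x\<close> leaves a central complement.\<close>

lemma sl2_ideal:
  assumes lie: "\<mu> \<in> Lie" and ind: "indep4 x h a b"
    and U: "mult \<mu> h a = a" "mult \<mu> h b = - b" "mult \<mu> a b = h"
    and D: "mult \<mu> x h = p1 *s h + p2 *s a + p3 *s b" "mult \<mu> x a = q1 *s h + q2 *s a + q3 *s b"
      "mult \<mu> x b = r1 *s h + r2 *s a + r3 *s b"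
  shows "\<mu> \<in> orbit sl2_C"
proof -
  note alt = Lie_alternating[OF lie]
  note sw = alternating_swap[OF alt U(1)] alternating_swap[OF alt U(2)] alternating_swap[OF alt U(3)]
    alternating_self[OF alt]
  have "0 *s x + (q1 + p3) *s h + (- p1) *s a + (2 * q3) *s b = 0 *s x + 0 *s h + 0 *s a + 0 *s b"
    using lie_derivation[OF lie, of x h a] by (simp add: mult_linear D U sw vec_eq_iff algebra_simps)
  then have "q1 + p3 = 0" "p1 = 0" "q3 = 0"
    using indep4_eq[OF ind] by fastforce+
  then have 1: "q1 = - p3" "p1 = 0" "q3 = 0"
    by (simp_all add: add_eq_0_iff2)
  have "0 *s x + (r1 + p2) *s h + (2 * r2) *s a + (- p1) *s b = 0 *s x + 0 *s h + 0 *s a + 0 *s b"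
    using lie_derivation[OF lie, of x h b] by (simp add: mult_linear D U sw vec_eq_iff algebra_simps)
  then have "r1 + p2 = 0" "r2 = 0"
    using indep4_eq[OF ind] by fastforce+
  then have 2: "r1 = - p2" "r2 = 0"
    by (simp_all add: add_eq_0_iff2)
  have "0 *s x + (q2 + r3) *s h + (- r1 - p2) *s a + (- q1 - p3) *s b = 0 *s x + 0 *s h + 0 *s a + 0 *s b"
    using lie_derivation[OF lie, of x a b] by (simp add: mult_linear D U sw 1 2 vec_eq_iff algebra_simps)
  then have "q2 + r3 = 0"
    using indep4_eq[OF ind] by fastforce+
  then have 3: "r3 = - q2"
    by (simp add: add_eq_0_iff)
  define z where "z = x + p2 *s a - p3 *s b - q2 *s h"
  have ind': "indep4 h a b z"
    by (rule indep4_combI[OF ind, of _ 0 1 0 0 _ 0 0 1 0 _ 0 0 0 1 _ 1 "- q2" p2 "- p3"])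
      (auto simp: vec_eq_iff z_def)
  have z: "mult \<mu> z h = 0" "mult \<mu> z a = 0" "mult \<mu> z b = 0"
    by (simp_all add: z_def mult_linear D U sw 1 2 3 vec_eq_iff)
  show ?thesis
    by (rule orbit_sl2_CI[OF alt ind']) (simp_all add: U alternating_swap0[OF alt] z)
qed

section \<open>Adjoint maps and traces\<close>

definition ad :: "'n::finite alg \<Rightarrow> complex ^ 'n \<Rightarrow> complex ^ 'n ^ 'n" where
  "ad \<mu> x = (\<chi> i j. mult \<mu> x (axis j 1) $ i)"

lemma ad_mult: "ad \<mu> x *v y = mult \<mu> x y"
proof -
  have "mult \<mu> x y = mult \<mu> x (\<Sum>j\<in>UNIV. y $ j *s axis j 1)"
    by (simp flip: basis_sum)
  then show ?thesis
    by (simp add: vec_eq_iff ad_def matrix_vector_mult_def mult_sum_right mult_scale_right mult.commute)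
qed

lemma trace_ad_basis:
  assumes ind: "indep4 x y z w"
    and "mult \<mu> v x = a1 *s x + a2 *s y + a3 *s z + a4 *s w"
    and "mult \<mu> v y = b1 *s x + b2 *s y + b3 *s z + b4 *s w"
    and "mult \<mu> v z = c1 *s x + c2 *s y + c3 *s z + c4 *s w"
    and "mult \<mu> v w = d1 *s x + d2 *s y + d3 *s z + d4 *s w"
  shows "trace (ad \<mu> v) = a1 + b2 + c3 + d4"
proof -
  let ?G = "basis_matrix x y z w"
  define M :: "complex ^ 4 ^ 4" where "M = basis_matrix (a1 *s e 1 + a2 *s e 2 + a3 *s e 3 + a4 *s e 4)
    (b1 *s e 1 + b2 *s e 2 + b3 *s e 3 + b4 *s e 4) (c1 *s e 1 + c2 *s e 2 + c3 *s e 3 + c4 *s e 4)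
    (d1 *s e 1 + d2 *s e 2 + d3 *s e 3 + d4 *s e 4)"
  have "(ad \<mu> v ** ?G) *v c = (?G ** M) *v c" for c
    unfolding matrix_vector_mul_assoc[symmetric] ad_mult M_def
    by (simp add: basis_matrix_mult mult_linear assms(2-) axis_def vec_eq_iff algebra_simps)
  then have "ad \<mu> v ** ?G = ?G ** M"
    by (simp add: matrix_eq)
  then have "ad \<mu> v ** (?G ** matrix_inv ?G) = ?G ** (M ** matrix_inv ?G)"
    by (simp add: matrix_mul_assoc)
  then have "ad \<mu> v = ?G ** (M ** matrix_inv ?G)"
    by (simp add: matrix_inv_mult[OF invertible_basis_matrix[OF ind]])
  then have "trace (ad \<mu> v) = trace (M ** (matrix_inv ?G ** ?G))"
    by (metis trace_mul_sym matrix_mul_assoc)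
  also have "\<dots> = trace M"
    by (simp add: matrix_inv_mult[OF invertible_basis_matrix[OF ind]])
  also have "\<dots> = a1 + b2 + c3 + d4"
    by (simp add: trace_def sum_4 M_def basis_matrix_def axis_def)
  finally show ?thesis .
qed

lemma Lie_ad_mult:
  assumes "\<mu> \<in> Lie"
  shows "ad \<mu> (mult \<mu> x y) = ad \<mu> x ** ad \<mu> y - ad \<mu> y ** ad \<mu> x"
proof -
  have "mult \<mu> (mult \<mu> x y) z = mult \<mu> x (mult \<mu> y z) - mult \<mu> y (mult \<mu> x z)" for z
    using lie_derivation[OF assms, of x y z] by simp
  then show ?thesis
    by (simp add: matrix_eq matrix_vector_mult_diff_rdistrib ad_mult flip: matrix_vector_mul_assoc)
qed

lemma Lie_trace_ad_mult: "\<mu> \<in> Lie \<Longrightarrow> trace (ad \<mu> (mult \<mu> x y)) = 0"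
  by (simp add: Lie_ad_mult trace_sub trace_mul_sym[of "ad \<mu> x"])

section \<open>Functionals that vanish on all products\<close>

definition pair :: "complex ^ 4 \<Rightarrow> complex ^ 4 \<Rightarrow> complex" where
  "pair f y = f $ 1 * y $ 1 + f $ 2 * y $ 2 + f $ 3 * y $ 3 + f $ 4 * y $ 4"

lemma pair_linear:
  "pair f (x + y) = pair f x + pair f y" "pair f (x - y) = pair f x - pair f y"
  "pair f (c *s x) = c * pair f x" "pair f (- x) = - pair f x" "pair f 0 = 0"
  by (simp_all add: pair_def algebra_simps)

lemma trace_ad_pair: "trace (ad \<mu> y) = pair (\<chi> i. trace (ad \<mu> (axis i 1))) y"
proof -
  have "trace (ad \<mu> y) = trace (ad \<mu> (\<Sum>i\<in>UNIV. y $ i *s axis i 1))"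
    by (simp flip: basis_sum)
  also have "\<dots> = pair (\<chi> i. trace (ad \<mu> (axis i 1))) y"
    by (simp add: trace_def ad_def pair_def sum_4 mult_linear algebra_simps)
  finally show ?thesis .
qed

lemma exhaust_6:
  fixes x :: 6
  shows "x = 1 \<or> x = 2 \<or> x = 3 \<or> x = 4 \<or> x = 5 \<or> x = 6"
proof (induct x)
  case (of_int z)
  then have "z = 0 \<or> z = 1 \<or> z = 2 \<or> z = 3 \<or> z = 4 \<or> z = 5" by simp arith
  then show ?case by auto
qed

lemma sum_6: "sum f (UNIV :: 6 set) = f 1 + f 2 + f 3 + f 4 + f 5 + f 6"
proof -
  have *: "UNIV = {1, 2, 3, 4, 5, 6 :: 6}"
    using exhaust_6 by auto
  show ?thesis
    unfolding * by (simp add: add.assoc)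
qed

text \<open>For a unimodular Lie algebra of dimension four the Jacobi identity says that the coordinates of
  the products, read as 2-forms, are pairwise orthogonal for the wedge form on the six-dimensional
  space of 2-forms. Isotropic subspaces have dimension at most three, so these four forms are dependent.\<close>

definition wedge :: "complex ^ 6 \<Rightarrow> complex ^ 6" where
  "wedge v = (\<chi> i. if i = 1 then v $ 6 else if i = 2 then - v $ 5 else if i = 3 then v $ 4
     else if i = 4 then v $ 3 else if i = 5 then - v $ 2 else v $ 1)"

text \<open>Row k is the 2-form giving the coefficient of \<open>e k\<close> in a product, in the
  basis 12, 13, 14, 23, 24, 34. In this order \<open>wedge\<close> pairs 12 with 34, 13 with 24
  (with a minus sign) and 14 with 23.\<close>

definition two_forms :: "4 alg \<Rightarrow> complex ^ 6 ^ 4" where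
  "two_forms \<mu> = (\<chi> k i. if i = 1 then \<mu> $ 1 $ 2 $ k else if i = 2 then \<mu> $ 1 $ 3 $ k
     else if i = 3 then \<mu> $ 1 $ 4 $ k else if i = 4 then \<mu> $ 2 $ 3 $ k
     else if i = 5 then \<mu> $ 2 $ 4 $ k else \<mu> $ 3 $ 4 $ k)"

lemma unimodular_isotropic:
  assumes lie: "\<mu> \<in> Lie" and tr: "\<And>y. trace (ad \<mu> y) = 0"
  shows "two_forms \<mu> *v wedge (two_forms \<mu> $ k) = 0"
proof -
  note alt = Lie_alternating[OF lie]
  have an: "\<mu> $ i $ j $ m = - \<mu> $ j $ i $ m" for i j m
    using alt unfolding alternating_def by (metis mult_axis vector_uminus_component)
  have dg: "\<mu> $ i $ i $ m = 0" for i m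
    using alternating_self[OF alt] by (metis mult_axis zero_index)
  note an' = an[of 2 1] an[of 3 1] an[of 4 1] an[of 3 2] an[of 4 2] an[of 4 3] dg
  have "mult \<mu> v (axis j 1) = (\<Sum>i\<in>UNIV. v $ i *s (\<mu> $ i $ j))" for v :: "complex ^ 4" and j
  proof -
    have "mult \<mu> v (axis j 1) = mult \<mu> (\<Sum>i\<in>UNIV. v $ i *s axis i 1) (axis j 1)"
      by (simp flip: basis_sum)
    then show ?thesis
      by (simp add: mult_sum_left mult_scale_left mult_axis)
  qed
  then have jac: "(\<Sum>m\<in>UNIV. \<mu> $ a $ b $ m * \<mu> $ m $ c $ l) + (\<Sum>m\<in>UNIV. \<mu> $ b $ c $ m * \<mu> $ m $ a $ l)
      + (\<Sum>m\<in>UNIV. \<mu> $ c $ a $ m * \<mu> $ m $ b $ l) = 0" for a b c l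
  proof -
    assume *: "\<And>(v :: complex ^ 4) j. mult \<mu> v (axis j 1) = (\<Sum>i\<in>UNIV. v $ i *s (\<mu> $ i $ j))"
    have "jacobian \<mu> (axis a 1) (axis b 1) (axis c 1) $ l = 0"
      using lie unfolding Lie_def lie_on_def by simp
    then show ?thesis
      unfolding jacobian_def mult_axis * by simp
  qed
  have tr': "(\<Sum>j\<in>UNIV. \<mu> $ i $ j $ j) = 0" for i
    using tr[of "axis i 1"] by (simp add: trace_def ad_def mult_axis)
  define p q r s t u where defs: "p = (($) (\<mu> $ 1 $ 2))" "q = (($) (\<mu> $ 1 $ 3))" "r = (($) (\<mu> $ 1 $ 4))"
    "s = (($) (\<mu> $ 2 $ 3))" "t = (($) (\<mu> $ 2 $ 4))" "u = (($) (\<mu> $ 3 $ 4))"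
  have "p 2 + q 3 + r 4 = 0" "- p 1 + s 3 + t 4 = 0" "- q 1 - s 2 + u 4 = 0" "- r 1 - t 2 - u 3 = 0"
    using tr'[of 1] tr'[of 2] tr'[of 3] tr'[of 4] by (simp_all add: sum_4 an' defs)
  then have e: "r 4 = - p 2 - q 3" "t 4 = p 1 - s 3" "u 4 = q 1 + s 2" "u 3 = - r 1 - t 2"
    by (simp_all add: algebra_simps add_eq_0_iff)
  have j: "p 1 * q l + p 2 * s l - p 4 * u l - s 2 * p l - s 3 * q l - s 4 * r l - q 1 * p l + q 3 * s l + q 4 * t l = 0"
    "p 1 * r l + p 2 * t l + p 3 * u l - t 2 * p l - t 3 * q l - t 4 * r l - r 1 * p l + r 3 * s l + r 4 * t l = 0"
    "q 1 * r l + q 2 * t l + q 3 * u l - u 2 * p l - u 3 * q l - u 4 * r l - r 1 * q l - r 2 * s l + r 4 * u l = 0"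
    "s 1 * r l + s 2 * t l + s 3 * u l + u 1 * p l - u 3 * s l - u 4 * t l - t 1 * q l - t 2 * s l + t 4 * u l = 0" for l
    using jac[of 1 2 3 l] jac[of 1 2 4 l] jac[of 1 3 4 l] jac[of 2 3 4 l]
    by (simp_all add: sum_4 an' defs algebra_simps)
  \<comment> \<open>Once the trace relations \<open>e\<close> are substituted, the Jacobi identity
    for three basis vectors is orthogonality to the row of the missing index.\<close>
  have "p 4 * u l - q 4 * t l + r 4 * s l + s 4 * r l - t 4 * q l + u 4 * p l = 0"
    "p 3 * u l - q 3 * t l + r 3 * s l + s 3 * r l - t 3 * q l + u 3 * p l = 0"
    "p 2 * u l - q 2 * t l + r 2 * s l + s 2 * r l - t 2 * q l + u 2 * p l = 0"
    "p 1 * u l - q 1 * t l + r 1 * s l + s 1 * r l - t 1 * q l + u 1 * p l = 0" for l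
    using j[of l] by (simp_all add: e algebra_simps)
  then have "\<forall>k l. (two_forms \<mu> *v wedge (two_forms \<mu> $ k)) $ l = 0"
    unfolding forall_4
    by (simp add: matrix_vector_mult_def two_forms_def wedge_def sum_6 defs algebra_simps)
  then show ?thesis
    by (simp add: vec_eq_iff)
qed

lemma unimodular_functional:
  assumes lie: "\<mu> \<in> Lie" and tr: "\<And>y. trace (ad \<mu> y) = 0"
  obtains f where "f \<noteq> 0" "\<And>x y. pair f (mult \<mu> x y) = 0"
proof -
  let ?M = "two_forms \<mu>"
  have "\<exists>f. f \<noteq> 0 \<and> transpose ?M *v f = 0"
  proof (rule ccontr)
    assume "\<not> ?thesis"
    then have ker: "\<And>f. transpose ?M *v f = 0 \<Longrightarrow> f = 0"
      by blast
    then obtain B where "B ** transpose ?M = mat 1"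
      using matrix_left_invertible_ker[of "transpose ?M"] by blast
    then have "transpose (B ** transpose ?M) = mat 1"
      by simp
    then have C: "?M ** transpose B = mat 1"
      by (simp add: matrix_transpose_mul)
    define N :: "complex ^ 4 ^ 6" where "N = (\<chi> i k. wedge (?M $ k) $ i)"
    have N: "N *v f = wedge (transpose ?M *v f)" for f
      by (simp add: N_def wedge_def vec_eq_iff matrix_vector_mult_def transpose_def sum_4)
    have "v = 0" if "wedge v = 0" for v
    proof -
      have "wedge v $ i = 0" for i
        using that by simp
      from this[of 1] this[of 2] this[of 3] this[of 4] this[of 5] this[of 6]
      have "v $ i = 0" for i
        using exhaust_6[of i] by (auto simp: wedge_def)
      then show ?thesis
        by (simp add: vec_eq_iff)
    qed
    then have Nker: "f = 0" if "N *v f = 0" for f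
      using ker that N by simp
    have MN: "?M *v (N *v f) = 0" for f
    proof -
      have "N *v f = f $ 1 *s wedge (?M $ 1) + f $ 2 *s wedge (?M $ 2) + f $ 3 *s wedge (?M $ 3)
          + f $ 4 *s wedge (?M $ 4)"
        by (simp add: N_def vec_eq_iff matrix_vector_mult_def sum_4 mult.commute)
      then show ?thesis
        by (simp add: vec.add vec.scale unimodular_isotropic[OF lie tr])
    qed
    \<comment> \<open>If the rows were independent, \<open>N\<close> would be injective with image
      in the kernel of \<open>?M\<close>, while \<open>?M\<close> is injective on the range of
      \<open>transpose B\<close>. Two spaces of dimension four that meet only in 0 do not fit into
      dimension six.\<close>
    let ?K = "range ((*v) N)" and ?R = "range ((*v) (transpose B))"
    have card4: "vec.dim (UNIV :: (complex ^ 4) set) = 4"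
      unfolding vec_dim_card by simp
    have "inj ((*v) N)"
      using Nker matrix_left_invertible_ker matrix_left_invertible_injective by metis
    then have "vec.dim ?K = 4"
      unfolding card4[symmetric] by (intro vec.dim_image_eq) (auto intro: inj_on_subset)
    moreover have "inj ((*v) (transpose B))"
      using C matrix_left_invertible_injective by blast
    then have "vec.dim ?R = 4"
      unfolding card4[symmetric] by (intro vec.dim_image_eq) (auto intro: inj_on_subset)
    moreover have "?K \<inter> ?R = {0}"
    proof -
      have "w = 0" if KR: "w \<in> ?K" "w \<in> ?R" for w
      proof -
        obtain f g where w: "w = N *v f" "w = transpose B *v g"
          using KR by (elim rangeE)
        have "g = ?M *v w"
          unfolding w(2) matrix_vector_mul_assoc C by simp
        then have "g = 0"
          unfolding w(1) by (simp add: MN)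
        then show ?thesis
          using w by simp
      qed
      moreover have "0 \<in> ?K" "0 \<in> ?R"
        by (metis matrix_vector_mult_0_right rangeI)+
      ultimately show ?thesis
        by blast
    qed
    moreover have "vec.subspace ?K" "vec.subspace ?R"
      by (intro vec.subspace_image vec.subspace_UNIV)+
    ultimately have "vec.dim {x + y |x y. x \<in> ?K \<and> y \<in> ?R} = 8"
      using vec.dim_sums_Int[of ?K ?R] by simp
    then show False
      using dim_subset_UNIV_cart_gen[of "{x + y |x y. x \<in> ?K \<and> y \<in> ?R}"] by simp
  qed
  then obtain f where f: "f \<noteq> 0" "transpose ?M *v f = 0"
    by blast
  note alt = Lie_alternating[OF lie]
  have "(transpose ?M *v f) $ i = 0" for i
    using f(2) by simp
  from this[of 1] this[of 2] this[of 3] this[of 4] this[of 5] this[of 6]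
  have p: "pair f (\<mu> $ 1 $ 2) = 0" "pair f (\<mu> $ 1 $ 3) = 0" "pair f (\<mu> $ 1 $ 4) = 0"
    "pair f (\<mu> $ 2 $ 3) = 0" "pair f (\<mu> $ 2 $ 4) = 0" "pair f (\<mu> $ 3 $ 4) = 0"
    by (simp_all add: matrix_vector_mult_def transpose_def two_forms_def sum_4 pair_def mult.commute)
  have an: "\<mu> $ i $ j = - \<mu> $ j $ i" for i j
    using alt unfolding alternating_def by (metis mult_axis)
  have dg: "\<mu> $ i $ i = 0" for i
    using alternating_self[OF alt] by (metis mult_axis)
  have "pair f (mult \<mu> x y) = 0" for x y
    by (simp add: mult_def sum_4 pair_linear p dg an[of 2 1] an[of 3 1] an[of 4 1] an[of 3 2]
        an[of 4 2] an[of 4 3])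
  then show ?thesis
    using that f(1) by blast
qed

lemma Lie_functional:
  assumes lie: "\<mu> \<in> Lie"
  obtains f where "f \<noteq> 0" "\<And>x y. pair f (mult \<mu> x y) = 0"
    "\<And>y. pair f y = 0 \<Longrightarrow> trace (ad \<mu> y) = 0"
proof (cases "\<forall>y. trace (ad \<mu> y) = 0")
  case True
  then have tr: "trace (ad \<mu> y) = 0" for y
    by blast
  obtain f where f: "f \<noteq> 0" "\<And>x y. pair f (mult \<mu> x y) = 0"
    using unimodular_functional[OF lie tr] by metis
  show ?thesis
    by (rule that[OF f]) (rule tr)
next
  case False
  let ?f = "\<chi> i. trace (ad \<mu> (axis i 1))"
  have "?f \<noteq> 0"
  proof
    assume "?f = 0"
    then have "trace (ad \<mu> y) = 0" for y
      unfolding trace_ad_pair[of \<mu> y] by (simp add: pair_def)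
    then show False
      using False by blast
  qed
  then show ?thesis
  proof (rule that)
    show "pair ?f (mult \<mu> x y) = 0" for x y
      unfolding trace_ad_pair[symmetric] by (rule Lie_trace_ad_mult[OF lie])
    show "trace (ad \<mu> y) = 0" if "pair ?f y = 0" for y
      using that unfolding trace_ad_pair[symmetric] .
  qed
qed

lemma functional_basis:
  assumes "f \<noteq> 0"
  obtains x y z w where "indep4 x y z w" "pair f x = 1" "pair f y = 0" "pair f z = 0" "pair f w = 0"
proof -
  have pe: "pair f (e i) = f $ i" for i
    using exhaust_4[of i] by (auto simp: pair_def axis_def)
  note witness = that
  have gen: thesis if "indep4 (e i) (e j) (e k) (e l)" "f $ i \<noteq> 0" for i j k l
  proof (rule witness)
    show "indep4 ((1 / f $ i) *s e i) (e j - (f $ j / f $ i) *s e i) (e k - (f $ k / f $ i) *s e i)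
      (e l - (f $ l / f $ i) *s e i)"
      by (rule indep4_combI[OF that(1), of _ "1 / f $ i" 0 0 0 _ "- f $ j / f $ i" 1 0 0
            _ "- f $ k / f $ i" 0 1 0 _ "- f $ l / f $ i" 0 0 1])
        (use that(2) in \<open>auto simp: vec_eq_iff\<close>)
  qed (use that(2) in \<open>simp_all add: pair_linear pe\<close>)
  have "\<exists>i. f $ i \<noteq> 0"
    using assms by (auto simp: vec_eq_iff)
  then consider "f $ 1 \<noteq> 0" | "f $ 2 \<noteq> 0" | "f $ 3 \<noteq> 0" | "f $ 4 \<noteq> 0"
    using exhaust_4 by metis
  then show ?thesis
  proof cases
    case 1
    then show ?thesis by (rule gen[OF indep4_axis])
  next
    case 2
    then show ?thesis by (rule gen[OF indep4_perm(3)[OF indep4_axis]])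
  next
    case 3
    then show ?thesis by (rule gen[OF indep4_perm(3)[OF indep4_perm(1)[OF indep4_axis]]])
  next
    case 4
    then show ?thesis by (rule gen[OF indep4_perm(3)[OF indep4_perm(1)[OF indep4_perm(2)[OF indep4_axis]]]])
  qed
qed

section \<open>The classification of four-dimensional Lie algebras\<close>

definition Lie_models :: "4 alg set" where
  "Lie_models = {sl2_C, r2_r2} \<union> abelian_models \<union> heisenberg_models"

lemma Lie_modelsI:
  "\<mu> \<in> orbits abelian_models \<Longrightarrow> \<mu> \<in> orbits Lie_models"
  "\<mu> \<in> orbits heisenberg_models \<Longrightarrow> \<mu> \<in> orbits Lie_models"
  "\<mu> \<in> orbit r2_r2 \<Longrightarrow> \<mu> \<in> orbits Lie_models"
  "\<mu> \<in> orbit sl2_C \<Longrightarrow> \<mu> \<in> orbits Lie_models"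
  "\<mu> \<in> orbit (g4 \<alpha> \<beta>) \<Longrightarrow> \<mu> \<in> orbits Lie_models"
  by (auto simp: orbits_def Lie_models_def abelian_models_def)

text \<open>As \<open>f\<close> kills all products, the trace of \<open>ad y\<close> is its trace on the ideal \<open>ker f\<close>, so the last
  assumption says that this ideal is a unimodular Lie algebra.\<close>

locale lie_functional =
  fixes \<mu> :: "4 alg" and f :: "complex ^ 4"
  assumes lie: "\<mu> \<in> Lie"
    and f_mult: "pair f (mult \<mu> x y) = 0"
    and f_trace: "pair f y = 0 \<Longrightarrow> trace (ad \<mu> y) = 0"
begin

lemmas alt = Lie_alternating[OF lie]

definition adapted :: "complex ^ 4 \<Rightarrow> complex ^ 4 \<Rightarrow> complex ^ 4 \<Rightarrow> complex ^ 4 \<Rightarrow> bool" where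
  "adapted x y z w \<longleftrightarrow> indep4 x y z w \<and> pair f x = 1 \<and> pair f y = 0 \<and> pair f z = 0 \<and> pair f w = 0"

lemma adapted_ker:
  assumes "adapted x y z w" "pair f v = 0"
  obtains b c d where "v = b *s y + c *s z + d *s w"
proof -
  obtain a b c d where v: "v = a *s x + b *s y + c *s z + d *s w"
    using indep4_span assms(1) unfolding adapted_def by metis
  then have "a = 0"
    using assms by (simp add: adapted_def pair_linear)
  then show ?thesis
    using that[of b c d] v by simp
qed

text \<open>Products have no component along \<open>x\<close>, so \<open>ad v\<close> contributes
  nothing to the trace there and its trace is that on the ideal.\<close>

lemma adapted_trace:
  assumes ad: "adapted x y z w" and "pair f v = 0"
    and "mult \<mu> v y = b2 *s y + b3 *s z + b4 *s w"
    and "mult \<mu> v z = c2 *s y + c3 *s z + c4 *s w"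
    and "mult \<mu> v w = d2 *s y + d3 *s z + d4 *s w"
  shows "b2 + c3 + d4 = 0"
proof -
  obtain a2 a3 a4 where "mult \<mu> v x = a2 *s y + a3 *s z + a4 *s w"
    by (rule adapted_ker[OF ad f_mult])
  then have "trace (ad \<mu> v) = 0 + b2 + c3 + d4"
    using ad assms(3-)
    by (intro trace_ad_basis[of x y z w _ _ 0 a2 a3 a4 0 b2 b3 b4 0 c2 c3 c4 0 d2 d3 d4])
      (simp_all add: adapted_def)
  then show ?thesis
    using f_trace[OF assms(2)] by simp
qed

lemma adapted_combI:
  assumes "adapted x y z w"
    and "y' = y2 *s y + y3 *s z + y4 *s w"
    and "z' = z2 *s y + z3 *s z + z4 *s w" "w' = w2 *s y + w3 *s z + w4 *s w"
    and "\<And>b c d. b * y2 + c * z2 + d * w2 = 0 \<Longrightarrow> b * y3 + c * z3 + d * w3 = 0 \<Longrightarrow>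
        b * y4 + c * z4 + d * w4 = 0 \<Longrightarrow> b = 0 \<and> c = 0 \<and> d = 0"
  shows "adapted x y' z' w'"
proof -
  have ind: "indep4 x y z w"
    using assms(1) by (simp add: adapted_def)
  have "indep4 x y' z' w'"
  proof (rule indep4_combI[OF ind, of _ 1 0 0 0 _ 0 y2 y3 y4 _ 0 z2 z3 z4 _ 0 w2 w3 w4])
    fix a b c d :: complex
    assume "a * 1 + b * 0 + c * 0 + d * 0 = 0" "a * 0 + b * y2 + c * z2 + d * w2 = 0"
      "a * 0 + b * y3 + c * z3 + d * w3 = 0" "a * 0 + b * y4 + c * z4 + d * w4 = 0"
    then show "a = 0 \<and> b = 0 \<and> c = 0 \<and> d = 0"
      using assms(5)[of b c d] by simp
  qed (simp_all add: assms(2-4))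
  then show ?thesis
    using assms(1-4) by (simp add: adapted_def pair_linear)
qed

lemma adapted_sl2:
  assumes ad: "adapted x t u w" and t: "mult \<mu> t u = l *s u" "mult \<mu> t w = - (l *s w)"
    "mult \<mu> u w = k *s t" and "l \<noteq> 0" "k \<noteq> 0"
  shows "\<mu> \<in> orbits Lie_models"
proof -
  have ad': "adapted x ((1/l) *s t) u ((1/(k * l)) *s w)"
    by (rule adapted_combI[OF ad, of _ "1/l" 0 0 _ 0 1 0 _ 0 0 "1/(k * l)"])
      (use assms(5,6) in \<open>auto simp: vec_eq_iff\<close>)
  define h b where hb: "h = (1/l) *s t" "b = (1/(k * l)) *s w"
  note ad' = ad'[folded hb]
  obtain p1 p2 p3 where p: "mult \<mu> x h = p1 *s h + p2 *s u + p3 *s b"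
    by (rule adapted_ker[OF ad' f_mult])
  obtain q1 q2 q3 where q: "mult \<mu> x u = q1 *s h + q2 *s u + q3 *s b"
    by (rule adapted_ker[OF ad' f_mult])
  obtain r1 r2 r3 where r: "mult \<mu> x b = r1 *s h + r2 *s u + r3 *s b"
    by (rule adapted_ker[OF ad' f_mult])
  have "\<mu> \<in> orbit sl2_C"
    by (rule sl2_ideal[OF lie _ _ _ _ p q r])
      (use assms(5,6) ad' in \<open>simp_all add: hb mult_linear t vec_eq_iff adapted_def\<close>)
  then show ?thesis
    by (rule Lie_modelsI)
qed

lemma adapted_euclidean:
  assumes ad: "adapted x u w t" and t: "mult \<mu> t u = 0" "mult \<mu> t w = u" "mult \<mu> u w = d *s t"
    and "d \<noteq> 0"
  shows "\<mu> \<in> orbits Lie_models"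
proof -
  define k where "k = csqrt d"
  have d: "d = k * k" "k \<noteq> 0"
    using \<open>d \<noteq> 0\<close> power2_csqrt[of d] by (auto simp: k_def power2_eq_square)
  \<comment> \<open>Since w t = -u and w u = -d t, the vectors \<open>u - k *s t\<close> and
    \<open>u + k *s t\<close> are eigenvectors of w/k for 1 and -1.\<close>
  define h a b where hab: "h = (1/k) *s w" "a = u - k *s t" "b = u + k *s t"
  have ad': "adapted x h a b"
    by (rule adapted_combI[OF ad, of _ 0 "1/k" 0 _ 1 0 "- k" _ 1 0 k])
      (use d in \<open>auto simp: hab vec_eq_iff\<close>)
  obtain p1 p2 p3 where p: "mult \<mu> x h = p1 *s h + p2 *s a + p3 *s b"
    by (rule adapted_ker[OF ad' f_mult])
  obtain q1 q2 q3 where q: "mult \<mu> x a = q1 *s h + q2 *s a + q3 *s b"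
    by (rule adapted_ker[OF ad' f_mult])
  obtain r1 r2 r3 where r: "mult \<mu> x b = r1 *s h + r2 *s a + r3 *s b"
    by (rule adapted_ker[OF ad' f_mult])
  note sw = t alternating_swap0[OF alt t(1)] alternating_swap[OF alt t(2)] alternating_swap[OF alt t(3)]
    alternating_self[OF alt]
  have "mult \<mu> h a = a" "mult \<mu> h b = - b" "mult \<mu> a b = 0"
    using d(2) by (simp_all add: hab mult_linear sw vec_eq_iff d(1) field_simps)
  moreover have "indep4 x h a b"
    using ad' by (simp add: adapted_def)
  ultimately have "\<mu> \<in> orbit r2_r2 \<or> \<mu> \<in> orbit (g4 (- 1) 0)"
    by (intro euclidean_ideal[OF lie _ _ _ _ p q r])
  then show ?thesis
    using Lie_modelsI by blast
qed

text \<open>Unimodularity makes \<open>t\<close> act on the span of \<open>u\<close>,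
  \<open>w\<close> by a traceless matrix with eigenvalues l and -l. If l is nonzero the ideal is
  sl2; a nonzero nilpotent matrix gives the Euclidean algebra, the zero matrix the Heisenberg
  algebra.\<close>

lemma adapted_nonabelian:
  assumes ad: "adapted x u w t" and t: "mult \<mu> u w = t"
  shows "\<mu> \<in> orbits Lie_models"
proof -
  have ind: "indep4 x u w t" and f0: "pair f u = 0" "pair f w = 0" "pair f t = 0"
    using ad by (simp_all add: adapted_def)
  obtain a1 a2 a3 where tu: "mult \<mu> t u = a1 *s u + a2 *s w + a3 *s t"
    by (rule adapted_ker[OF ad f_mult])
  obtain b1 b2 b3 where tw: "mult \<mu> t w = b1 *s u + b2 *s w + b3 *s t"
    by (rule adapted_ker[OF ad f_mult])
  note sw = alternating_swap[OF alt t] alternating_swap[OF alt tu] alternating_swap[OF alt tw]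
    alternating_self[OF alt]
  have "0 + 0 + (- a3) = 0"
    by (rule adapted_trace[OF ad f0(1), of _ 0 0 0 0 1 "- a1" "- a2"]) (simp_all add: t sw vec_eq_iff)
  moreover have "0 + 0 + (- b3) = 0"
    by (rule adapted_trace[OF ad f0(2), of 0 0 "-1" 0 _ 0 "- b1" "- b2"]) (simp_all add: t sw vec_eq_iff)
  moreover have "a1 + b2 + 0 = 0"
    by (rule adapted_trace[OF ad f0(3), of _ a2 a3 b1 _ b3 0 0]) (simp_all add: tu tw sw)
  ultimately have tu: "mult \<mu> t u = a1 *s u + a2 *s w" and tw: "mult \<mu> t w = b1 *s u - a1 *s w"
    using tu tw by (simp_all add: vec_eq_iff add_eq_0_iff)
  note sw = alternating_swap[OF alt t] alternating_swap[OF alt tu] alternating_swap[OF alt tw]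
    alternating_self[OF alt]
  define l where "l = csqrt (a1\<^sup>2 + a2 * b1)"
  have l: "l * l = a1 * a1 + a2 * b1"
    using power2_csqrt[of "a1\<^sup>2 + a2 * b1"] by (simp add: l_def power2_eq_square)
  consider (sl2) "l \<noteq> 0" "b1 \<noteq> 0" | (sl2') "l \<noteq> 0" "b1 = 0" | (euclidean) "l = 0" "b1 \<noteq> 0"
    | (euclidean') "l = 0" "b1 = 0" "a2 \<noteq> 0" | (heisenberg) "a1 = 0" "a2 = 0" "b1 = 0"
  proof -
    have "l = 0 \<Longrightarrow> b1 = 0 \<Longrightarrow> a1 = 0"
      using l by simp
    then show ?thesis
      using that by blast
  qed
  then show ?thesis
  proof cases
    case sl2
    have ll: "a1 * a1 = l * l - a2 * b1"
      using l by simp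
    \<comment> \<open>Eigenvectors of \<open>t\<close> for l and -l; the determinant of their
      coordinates, -2 b1 l, is the factor in their product.\<close>
    have "adapted x t (b1 *s u + (l - a1) *s w) (b1 *s u - (l + a1) *s w)"
    proof (rule adapted_combI[OF ad, of _ 0 0 1 _ b1 "l - a1" 0 _ b1 "- (l + a1)" 0])
      fix b c d :: complex
      assume h: "b * 0 + c * b1 + d * b1 = 0" "b * 0 + c * (l - a1) + d * - (l + a1) = 0"
        "b * 1 + c * 0 + d * 0 = 0"
      then have "(c + d) * b1 = 0"
        by (simp add: algebra_simps)
      then have c: "c = - d"
        using sl2 by (simp add: add_eq_0_iff2)
      then have "2 * (l * d) = 0"
        using h(2) by (simp add: algebra_simps)
      then show "b = 0 \<and> c = 0 \<and> d = 0"
        using sl2 h c by simp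
    qed (simp_all add: vec_eq_iff algebra_simps)
    then show ?thesis
      by (rule adapted_sl2[of _ _ _ _ l "- (2 * b1 * l)"])
        (use sl2 in \<open>simp_all add: mult_linear t tu tw sw vec_eq_iff algebra_simps ll\<close>)
  next
    case sl2'
    then have "a1 \<noteq> 0"
      using l by auto
    have "adapted x t ((2 * a1) *s u + a2 *s w) w"
      by (rule adapted_combI[OF ad, of _ 0 0 1 _ "2 * a1" a2 0 _ 0 1 0])
        (use \<open>a1 \<noteq> 0\<close> in \<open>auto simp: vec_eq_iff\<close>)
    then show ?thesis
      by (rule adapted_sl2[of _ _ _ _ a1 "2 * a1"])
        (use \<open>a1 \<noteq> 0\<close> sl2' in \<open>simp_all add: mult_linear t tu tw sw vec_eq_iff algebra_simps\<close>)
  next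
    case euclidean
    \<comment> \<open>The matrix of \<open>t\<close> squares to zero, so the image t w of
      \<open>w\<close> spans its kernel.\<close>
    have "adapted x (b1 *s u - a1 *s w) w t"
      by (rule adapted_combI[OF ad, of _ b1 "- a1" 0 _ 0 1 0 _ 0 0 1])
        (use euclidean in \<open>auto simp: vec_eq_iff\<close>)
    moreover have "a1 * a1 = - a2 * b1"
      using l euclidean by (simp add: eq_neg_iff_add_eq_0)
    ultimately show ?thesis
      by (intro adapted_euclidean[of x "b1 *s u - a1 *s w" w t b1])
        (use euclidean in \<open>simp_all add: mult_linear t tu tw sw vec_eq_iff algebra_simps\<close>)
  next
    case euclidean'
    then have "a1 = 0"
      using l by simp
    have "adapted x (a2 *s w) u t"
      by (rule adapted_combI[OF ad, of _ 0 a2 0 _ 1 0 0 _ 0 0 1])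
        (use euclidean' in \<open>auto simp: vec_eq_iff\<close>)
    then show ?thesis
      by (rule adapted_euclidean[of _ _ _ _ "- a2"])
        (use euclidean' \<open>a1 = 0\<close> in \<open>simp_all add: mult_linear t tu tw sw vec_eq_iff algebra_simps\<close>)
  next
    case heisenberg
    then have c: "mult \<mu> u t = 0" "mult \<mu> w t = 0" "mult \<mu> t u = 0" "mult \<mu> t w = 0"
      by (simp_all add: tu tw sw)
    obtain p1 p2 p3 where p: "mult \<mu> x u = p1 *s u + p2 *s w + p3 *s t"
      by (rule adapted_ker[OF ad f_mult])
    obtain q1 q2 q3 where q: "mult \<mu> x w = q1 *s u + q2 *s w + q3 *s t"
      by (rule adapted_ker[OF ad f_mult])
    have "mult \<mu> x t = (p1 + q2) *s t"
      using lie_derivation[OF lie, of x u w] unfolding t p q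
      by (simp add: mult_linear c t sw vec_eq_iff algebra_simps)
    then have "\<mu> \<in> orbits heisenberg_models"
      by (intro heisenberg_ideal[OF alt ind t c(1,2) p q])
    then show ?thesis
      by (rule Lie_modelsI)
  qed
qed

lemma adapted_perm:
  assumes "adapted x y z w"
  shows "adapted x z y w" "adapted x y w z"
  using assms indep4_perm[of x y z w] unfolding adapted_def by blast+

lemma adapted_nonabelian':
  assumes ad: "adapted x u w s" and "mult \<mu> u w = a *s u + b *s w + c *s s" "c \<noteq> 0"
  shows "\<mu> \<in> orbits Lie_models"
proof -
  have "adapted x u w (mult \<mu> u w)"
    by (rule adapted_combI[OF ad, of _ 1 0 0 _ 0 1 0 _ a b c]) (use assms(2,3) in auto)
  then show ?thesis
    by (rule adapted_nonabelian) simp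
qed

text \<open>If every product in the ideal stays in the span of its factors, it is phi(y) z - phi(z)
  y for a functional phi; then \<open>ad y\<close> has trace 2 phi(y) on the ideal, and
  unimodularity makes the ideal abelian. Otherwise some product is independent of its
  factors.\<close>

lemma Lie_models_if_adapted:
  assumes ad: "adapted x u v w"
  shows "\<mu> \<in> orbits Lie_models"
proof -
  have ind: "indep4 x u v w" and f0: "pair f u = 0" "pair f v = 0" "pair f w = 0"
    using ad by (simp_all add: adapted_def)
  obtain a1 a2 a3 where uv: "mult \<mu> u v = a1 *s u + a2 *s v + a3 *s w"
    by (rule adapted_ker[OF ad f_mult])
  obtain b1 b2 b3 where uw: "mult \<mu> u w = b1 *s u + b2 *s v + b3 *s w"
    by (rule adapted_ker[OF ad f_mult])
  obtain c1 c2 c3 where vw: "mult \<mu> v w = c1 *s u + c2 *s v + c3 *s w"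
    by (rule adapted_ker[OF ad f_mult])
  note sw = alternating_swap[OF alt uv] alternating_swap[OF alt uw] alternating_swap[OF alt vw]
    alternating_self[OF alt]
  have "0 + a2 + b3 = 0"
    by (rule adapted_trace[OF ad f0(1), of _ 0 0 a1 _ a3 b1 b2]) (simp_all add: uv uw sw)
  then have b3: "b3 = - a2"
    by (simp add: add_eq_0_iff)
  have "- a1 + 0 + c3 = 0"
    by (rule adapted_trace[OF ad f0(2), of _ "- a2" "- a3" 0 _ 0 c1 c2])
      (simp_all add: uv vw sw vec_eq_iff)
  then have c3: "c3 = a1"
    by simp
  have "- b1 + (- c2) + 0 = 0"
    by (rule adapted_trace[OF ad f0(3), of _ "- b2" "- b3" "- c1" _ "- c3" 0 0])
      (simp_all add: uw vw sw vec_eq_iff)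
  then have c2: "c2 = - b1"
    by (simp add: add_eq_0_iff)
  consider "a3 \<noteq> 0" | "b2 \<noteq> 0" | "c1 \<noteq> 0" | "a3 = 0" "b2 = 0" "c1 = 0" "a1 \<noteq> 0"
    | "a3 = 0" "b2 = 0" "c1 = 0" "a2 \<noteq> 0" | "a3 = 0" "b2 = 0" "c1 = 0" "b1 \<noteq> 0"
    | "a3 = 0" "b2 = 0" "c1 = 0" "a1 = 0" "a2 = 0" "b1 = 0"
    by blast
  then show ?thesis
  proof cases
    case 1
    then show ?thesis
      by (rule adapted_nonabelian'[OF ad uv])
  next
    case 2
    have "mult \<mu> u w = b1 *s u + b3 *s w + b2 *s v"
      by (simp add: uw vec_eq_iff)
    then show ?thesis
      using 2 by (rule adapted_nonabelian'[OF adapted_perm(2)[OF ad]])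
  next
    case 3
    have "mult \<mu> v w = c2 *s v + c3 *s w + c1 *s u"
      by (simp add: vw vec_eq_iff)
    then show ?thesis
      using 3 by (rule adapted_nonabelian'[OF adapted_perm(2)[OF adapted_perm(1)[OF ad]]])
  next
    case 4
    \<comment> \<open>Each product of two of \<open>u\<close>, \<open>v\<close>, \<open>w\<close>
      now lies in the span of its factors, but that of \<open>v\<close> and \<open>u + w\<close>
      does not: in the basis v, u + w, w its last coordinate is 2 a1.\<close>
    have "adapted x v (u + w) w"
      by (rule adapted_combI[OF ad, of _ 0 1 0 _ 1 0 1 _ 0 0 1]) (auto simp: vec_eq_iff)
    then show ?thesis
      by (rule adapted_nonabelian'[of _ _ _ _ "- (a2 + b1)" "- a1" "2 * a1"])
        (use 4 in \<open>simp_all add: mult_linear uv vw sw b3 c2 c3 vec_eq_iff algebra_simps\<close>)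
  next
    case 5
    have "adapted x u (v + w) w"
      by (rule adapted_combI[OF ad, of _ 1 0 0 _ 0 1 1 _ 0 0 1]) (auto simp: vec_eq_iff)
    then show ?thesis
      by (rule adapted_nonabelian'[of _ _ _ _ "a1 + b1" "a2" "- (2 * a2)"])
        (use 5 in \<open>simp_all add: mult_linear uv uw sw b3 c2 c3 vec_eq_iff algebra_simps\<close>)
  next
    case 6
    have "adapted x w (u + v) v"
      by (rule adapted_combI[OF ad, of _ 0 0 1 _ 1 1 0 _ 0 1 0]) (auto simp: vec_eq_iff)
    then show ?thesis
      by (rule adapted_nonabelian'[of _ _ _ _ "a2 - a1" "- b1" "2 * b1"])
        (use 6 in \<open>simp_all add: mult_linear uw vw sw b3 c2 c3 vec_eq_iff algebra_simps\<close>)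
  next
    case 7
    then have ab: "mult \<mu> u v = 0" "mult \<mu> u w = 0" "mult \<mu> v w = 0"
      by (simp_all add: uv uw vw b3 c2 c3)
    obtain p1 p2 p3 where p: "mult \<mu> x u = p1 *s u + p2 *s v + p3 *s w"
      by (rule adapted_ker[OF ad f_mult])
    obtain q1 q2 q3 where q: "mult \<mu> x v = q1 *s u + q2 *s v + q3 *s w"
      by (rule adapted_ker[OF ad f_mult])
    obtain r1 r2 r3 where r: "mult \<mu> x w = r1 *s u + r2 *s v + r3 *s w"
      by (rule adapted_ker[OF ad f_mult])
    show ?thesis
      by (rule Lie_modelsI(1)[OF abelian_ideal[OF alt ind ab p q r]])
  qed
qed

end

theorem Lie_classification:
  assumes "\<mu> \<in> Lie"
  shows "\<mu> \<in> orbits Lie_models"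
proof -
  obtain f where f: "f \<noteq> 0" "\<And>x y. pair f (mult \<mu> x y) = 0"
    "\<And>y. pair f y = 0 \<Longrightarrow> trace (ad \<mu> y) = 0"
    using Lie_functional[OF assms] by metis
  interpret lie_functional \<mu> f
    by unfold_locales (fact assms f)+
  obtain x u v w where "adapted x u v w"
    using functional_basis[OF f(1)] unfolding adapted_def by metis
  then show ?thesis
    by (rule Lie_models_if_adapted)
qed

section \<open>The classification of the non-Lie algebras\<close>

lemma jacobian_linear:
  "jacobian \<mu> (x + x') y z = jacobian \<mu> x y z + jacobian \<mu> x' y z"
  "jacobian \<mu> x (y + y') z = jacobian \<mu> x y z + jacobian \<mu> x y' z"
  "jacobian \<mu> x y (z + z') = jacobian \<mu> x y z + jacobian \<mu> x y z'"
  "jacobian \<mu> (c *s x) y z = c *s jacobian \<mu> x y z"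
  "jacobian \<mu> x (c *s y) z = c *s jacobian \<mu> x y z"
  "jacobian \<mu> x y (c *s z) = c *s jacobian \<mu> x y z"
  "jacobian \<mu> (- x) y z = - jacobian \<mu> x y z"
  "jacobian \<mu> x (- y) z = - jacobian \<mu> x y z"
  "jacobian \<mu> x y (- z) = - jacobian \<mu> x y z"
  "jacobian \<mu> (x - x') y z = jacobian \<mu> x y z - jacobian \<mu> x' y z"
  "jacobian \<mu> x (y - y') z = jacobian \<mu> x y z - jacobian \<mu> x y' z"
  "jacobian \<mu> x y (z - z') = jacobian \<mu> x y z - jacobian \<mu> x y z'"
  by (simp_all add: jacobian_def mult_linear vec.scale_right_distrib)

lemma jacobian_sum:
  "jacobian \<mu> (\<Sum>i\<in>A. f i) y z = (\<Sum>i\<in>A. jacobian \<mu> (f i) y z)"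
  "jacobian \<mu> x (\<Sum>i\<in>A. f i) z = (\<Sum>i\<in>A. jacobian \<mu> x (f i) z)"
  "jacobian \<mu> x y (\<Sum>i\<in>A. f i) = (\<Sum>i\<in>A. jacobian \<mu> x y (f i))"
  by (simp_all add: jacobian_def mult_sum_left mult_sum_right sum.distrib)

lemma jacobian_swap:
  assumes "alternating \<mu>"
  shows "jacobian \<mu> y x z = - jacobian \<mu> x y z" "jacobian \<mu> x z y = - jacobian \<mu> x y z"
proof -
  have sw: "mult \<mu> a b = - mult \<mu> b a" for a b
    using assms unfolding alternating_def by blast
  show "jacobian \<mu> y x z = - jacobian \<mu> x y z" "jacobian \<mu> x z y = - jacobian \<mu> x y z"
    unfolding jacobian_def using sw[of y x] sw[of z x] sw[of z y] by simp_all
qed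

lemma jacobian_eq:
  assumes "alternating \<mu>"
  shows "jacobian \<mu> x x z = 0" "jacobian \<mu> z x x = 0" "jacobian \<mu> x z x = 0"
proof -
  have "a = 0" if "a = - a" for a :: "complex ^ 'a"
  proof -
    have "a $ i = - (a $ i)" for i
      using that by (metis vector_uminus_component)
    then show ?thesis
      by (simp add: vec_eq_iff equal_neg_zero)
  qed
  then show x: "jacobian \<mu> x x z = 0" "jacobian \<mu> z x x = 0"
    using jacobian_swap[OF assms] by metis+
  then show "jacobian \<mu> x z x = 0"
    using jacobian_swap(2)[OF assms, of x x z] by simp
qed

lemma jacobian_perm:
  assumes "alternating \<mu>"
  shows "jacobian \<mu> y z x = jacobian \<mu> x y z" "jacobian \<mu> z x y = jacobian \<mu> x y z"
    "jacobian \<mu> z y x = - jacobian \<mu> x y z"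
proof -
  show "jacobian \<mu> y z x = jacobian \<mu> x y z" "jacobian \<mu> z x y = jacobian \<mu> x y z"
    by (simp_all add: jacobian_def add_ac)
  then show "jacobian \<mu> z y x = - jacobian \<mu> x y z"
    using jacobian_swap(1)[OF assms, of z y x] by simp
qed

lemma jacobian_basis:
  fixes \<mu> :: "4 alg"
  assumes alt: "alternating \<mu>"
    and 0: "jacobian \<mu> (e 1) (e 2) (e 3) = 0" "jacobian \<mu> (e 1) (e 2) (e 4) = 0"
    "jacobian \<mu> (e 1) (e 3) (e 4) = 0" "jacobian \<mu> (e 2) (e 3) (e 4) = 0"
  shows "jacobian \<mu> x y z = 0"
proof -
  have perm: "jacobian \<mu> b a c = 0 \<and> jacobian \<mu> a c b = 0 \<and> jacobian \<mu> b c a = 0 \<and>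
      jacobian \<mu> c a b = 0 \<and> jacobian \<mu> c b a = 0" if "jacobian \<mu> a b c = 0" for a b c
    using that by (simp add: jacobian_swap(1)[OF alt, of b a c] jacobian_swap(2)[OF alt, of a c b]
        jacobian_perm(1)[OF alt, of b c a] jacobian_perm(2)[OF alt, of c a b] jacobian_perm(3)[OF alt, of c b a])
  have "\<forall>i j k. jacobian \<mu> (e i) (e j) (e k) = 0"
    unfolding forall_4
    using 0 perm[OF 0(1)] perm[OF 0(2)] perm[OF 0(3)] perm[OF 0(4)] jacobian_eq[OF alt] by simp
  moreover have "jacobian \<mu> x y z = jacobian \<mu> (\<Sum>i\<in>UNIV. x $ i *s e i) (\<Sum>i\<in>UNIV. y $ i *s e i)
      (\<Sum>i\<in>UNIV. z $ i *s e i)"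
    by (simp flip: basis_sum)
  ultimately show ?thesis
    by (simp add: jacobian_sum jacobian_linear)
qed

text \<open>The equational form of \<open>BL\<close>. That \<open>BL\<close> satisfies it is
  immediate; the converse is obtained in dimension four only after the classification, in
  \<open>BL_eq_binary\<close>.\<close>

definition binary :: "'n::finite alg set" where
  "binary = {\<mu>. alternating \<mu> \<and> (\<forall>x y. jacobian \<mu> x y (mult \<mu> x y) = 0)}"

text \<open>Polarisation in \<open>y\<close>: the terms mixed in \<open>y\<close> and
  \<open>z\<close>.\<close>

lemma binary_linear:
  assumes "\<mu> \<in> binary"
  shows "jacobian \<mu> x z (mult \<mu> x y) + jacobian \<mu> x y (mult \<mu> x z) = 0"
proof -
  have J: "jacobian \<mu> x y (mult \<mu> x y) = 0" for y
    using assms by (simp add: binary_def)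
  have "jacobian \<mu> x (y + z) (mult \<mu> x (y + z)) = jacobian \<mu> x y (mult \<mu> x y)
    + jacobian \<mu> x z (mult \<mu> x z) + (jacobian \<mu> x z (mult \<mu> x y) + jacobian \<mu> x y (mult \<mu> x z))"
    by (simp add: mult_add_right jacobian_linear algebra_simps)
  then show ?thesis
    by (simp add: J)
qed

text \<open>Modulo \<open>v\<close> the product is f(a) b - f(b) a, and \<open>v\<close> is scaled
  by a functional n proportional to f. The number in the last hypothesis is the coefficient of
  \<open>v\<close> in the Jacobian of \<open>x\<close>, \<open>y\<close>, \<open>z\<close>.\<close>

lemma orbit_g3_of_products:
  assumes alt: "alternating \<mu>" and ind: "indep4 x y z v" and "f1 \<noteq> 0"
    and xy: "mult \<mu> x y = - f2 *s x + f1 *s y + P *s v" and xz: "mult \<mu> x z = - f3 *s x + f1 *s z + Q *s v"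
    and yz: "mult \<mu> y z = - f3 *s y + f2 *s z + R *s v"
    and xv: "mult \<mu> x v = n1 *s v" "mult \<mu> y v = n2 *s v" "mult \<mu> z v = n3 *s v"
    and n: "f1 * n2 = f2 * n1" "f1 * n3 = f3 * n1"
    and c: "2 * (f1 * R - f2 * Q + f3 * P) - (P * n3 + R * n1 - Q * n2) \<noteq> 0"
  shows "\<mu> \<in> orbit (g3 (n1 / f1))"
proof -
  \<comment> \<open>S / f1 is the coefficient of \<open>v\<close> in the product of \<open>y\<close>
    and \<open>z\<close> once both are moved into the kernel of f. The Jacobian coefficient times f1
    equals (2 f1 - n1) S, so S is nonzero; n1 = 2 f1 would be the Lie algebra
    \<open>g3 2\<close>.\<close>
  define S where "S = f1 * R - f2 * Q + f3 * P"
  have "f1 * (2 * S - (P * n3 + R * n1 - Q * n2)) = (2 * f1 - n1) * S + (Q * (f1 * n2 - f2 * n1) - P * (f1 * n3 - f3 * n1))"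
    by (simp add: S_def algebra_simps)
  then have S: "S \<noteq> 0"
    using c \<open>f1 \<noteq> 0\<close> by (auto simp: n S_def)
  have n': "n2 = f2 * n1 / f1" "n3 = f3 * n1 / f1"
    using n \<open>f1 \<noteq> 0\<close> by (simp_all add: field_simps)
  have R: "R = (S + f2 * Q - f3 * P) / f1"
    using \<open>f1 \<noteq> 0\<close> by (simp add: S_def)
  note sw = alternating_swap[OF alt xy] alternating_swap[OF alt xz] alternating_swap[OF alt yz]
    alternating_swap[OF alt xv(1)] alternating_swap[OF alt xv(2)] alternating_swap[OF alt xv(3)]
    alternating_self[OF alt]
  have ind1: "indep4 ((1/f1) *s x) (y - (f2/f1) *s x) (z - (f3/f1) *s x) ((S/f1) *s v)"
    by (rule indep4_combI[OF ind, of _ "1/f1" 0 0 0 _ "-f2/f1" 1 0 0 _ "-f3/f1" 0 1 0 _ 0 0 0 "S/f1"])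
      (use S \<open>f1 \<noteq> 0\<close> in \<open>auto simp: vec_eq_iff\<close>)
  define x' y' z' w where d: "x' = (1/f1) *s x" "y' = y - (f2/f1) *s x" "z' = z - (f3/f1) *s x"
    "w = (S/f1) *s v"
  have 1: "mult \<mu> x' y' = y' + (P/S) *s w" "mult \<mu> x' z' = z' + (Q/S) *s w" "mult \<mu> y' z' = w"
    "mult \<mu> x' w = (n1/f1) *s w" "mult \<mu> y' w = 0" "mult \<mu> z' w = 0"
    using S \<open>f1 \<noteq> 0\<close> by (simp_all add: d mult_linear xy xz yz xv sw vec_eq_iff n' R field_simps)
  note sw = alternating_swap[OF alt 1(3)] alternating_self[OF alt]
  \<comment> \<open>Multiples of \<open>y'\<close> and \<open>z'\<close> added to \<open>x'\<close>
    cancel the components along \<open>w\<close>.\<close>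
  have "indep4 (x' + (P/S) *s z' - (Q/S) *s y') y' z' w"
    by (rule indep4_combI[OF ind1[folded d], of _ 1 "-Q/S" "P/S" 0 _ 0 1 0 0 _ 0 0 1 0 _ 0 0 0 1])
      (auto simp: vec_eq_iff)
  then show ?thesis
    by (rule orbit_g3I[OF alt]) (simp_all add: mult_linear 1 sw vec_eq_iff)
qed

lemma orbit_g6_of_products:
  assumes alt: "alternating \<mu>" and ind: "indep4 x y z v" and "n1 \<noteq> 0"
    and xy: "mult \<mu> x y = P *s v" and xz: "mult \<mu> x z = Q *s v" and yz: "mult \<mu> y z = R *s v"
    and xv: "mult \<mu> x v = n1 *s v" "mult \<mu> y v = n2 *s v" "mult \<mu> z v = n3 *s v"
    and c: "P * n3 + R * n1 - Q * n2 \<noteq> 0"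
  shows "\<mu> \<in> orbit g6"
proof -
  define S where "S = P * n3 + R * n1 - Q * n2"
  have S: "S \<noteq> 0"
    using c by (simp add: S_def)
  have R: "R = (S + Q * n2 - P * n3) / n1"
    using \<open>n1 \<noteq> 0\<close> by (simp add: S_def)
  note sw = alternating_swap[OF alt xy] alternating_swap[OF alt xz] alternating_swap[OF alt yz]
    alternating_swap[OF alt xv(1)] alternating_swap[OF alt xv(2)] alternating_swap[OF alt xv(3)]
    alternating_self[OF alt]
  \<comment> \<open>Multiples of \<open>x\<close> move \<open>y\<close> and \<open>z\<close> into
    the kernel of n, and multiples of \<open>v\<close> make the results commute with
    \<open>x\<close>.\<close>
  have "indep4 (y - (n2/n1) *s x - (P/n1) *s v) ((n1/S) *s (z - (n3/n1) *s x - (Q/n1) *s v)) v ((-1/n1) *s x)"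
    by (rule indep4_combI[OF ind, of _ "-n2/n1" 1 0 "-P/n1" _ "-n3/S" 0 "n1/S" "-Q/S" _ 0 0 0 1 _ "-1/n1" 0 0 0])
      (use S \<open>n1 \<noteq> 0\<close> in \<open>auto simp: vec_eq_iff field_simps\<close>)
  then show ?thesis
    by (rule orbit_g6I[OF alt])
      (use S \<open>n1 \<noteq> 0\<close> in \<open>simp_all add: mult_linear xy xz yz xv sw vec_eq_iff R field_simps\<close>)
qed

definition nonlie_models :: "4 alg set" where
  "nonlie_models = {g6} \<union> (\<Union>\<beta>. {g3 \<beta>})"

text \<open>Each of \<open>x\<close>, \<open>y\<close>, \<open>z\<close> may be taken as the first
  vector, so a nonzero f leads to \<open>g3\<close> and f = 0 to \<open>g6\<close>.\<close>

lemma nonlie_of_products: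
  assumes alt: "alternating \<mu>" and ind: "indep4 x y z v"
    and xy: "mult \<mu> x y = - f2 *s x + f1 *s y + P *s v" and xz: "mult \<mu> x z = - f3 *s x + f1 *s z + Q *s v"
    and yz: "mult \<mu> y z = - f3 *s y + f2 *s z + R *s v"
    and xv: "mult \<mu> x v = n1 *s v" "mult \<mu> y v = n2 *s v" "mult \<mu> z v = n3 *s v"
    and n: "f1 * n2 = f2 * n1" "f1 * n3 = f3 * n1" "f2 * n3 = f3 * n2"
    and c: "2 * (f1 * R - f2 * Q + f3 * P) - (P * n3 + R * n1 - Q * n2) \<noteq> 0"
  shows "\<mu> \<in> orbits nonlie_models"
proof -
  note ind2 = indep4_perm(3)[OF ind]
  note ind3 = indep4_perm(3)[OF indep4_perm(1)[OF indep4_perm(3)[OF ind]]]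
  have sw: "mult \<mu> y x = - f1 *s y + f2 *s x + (- P) *s v" "mult \<mu> z y = - f2 *s z + f3 *s y + (- R) *s v"
    "mult \<mu> z x = - f1 *s z + f3 *s x + (- Q) *s v"
    using alternating_swap[OF alt xy] alternating_swap[OF alt xz] alternating_swap[OF alt yz]
    by (simp_all add: vec_eq_iff)
  have g3: "\<mu> \<in> orbits nonlie_models" if "\<mu> \<in> orbit (g3 \<beta>)" for \<beta>
    using that by (auto simp: orbits_def nonlie_models_def)
  have g6: "\<mu> \<in> orbits nonlie_models" if "\<mu> \<in> orbit g6"
    using that by (auto simp: orbits_def nonlie_models_def)
  consider "f1 \<noteq> 0" | "f2 \<noteq> 0" | "f3 \<noteq> 0" | "f1 = 0" "f2 = 0" "f3 = 0"
    by blast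
  then show ?thesis
  proof cases
    case 1
    then show ?thesis
      by (rule g3[OF orbit_g3_of_products[OF alt ind _ xy xz yz xv n(1,2) c]])
  next
    case 2
    show ?thesis
      by (rule g3[OF orbit_g3_of_products[OF alt ind2 2 sw(1) yz xz xv(2,1,3) n(1)[symmetric] n(3)]])
        (use c in \<open>auto simp: algebra_simps\<close>)
  next
    case 3
    show ?thesis
      by (rule g3[OF orbit_g3_of_products[OF alt ind3 3 sw(2,3,1) xv(3,2,1) n(3)[symmetric] n(2)[symmetric]]])
        (use c in \<open>auto simp: algebra_simps\<close>)
  next
    case 4
    have p: "mult \<mu> x y = P *s v" "mult \<mu> x z = Q *s v" "mult \<mu> y z = R *s v"
      "mult \<mu> y x = (- P) *s v" "mult \<mu> z y = (- R) *s v" "mult \<mu> z x = (- Q) *s v"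
      using xy xz yz sw 4 by (simp_all add: vec_eq_iff)
    have c: "P * n3 + R * n1 - Q * n2 \<noteq> 0"
      using c 4 by simp
    then consider "n1 \<noteq> 0" | "n2 \<noteq> 0" | "n3 \<noteq> 0"
      by fastforce
    then show ?thesis
    proof cases
      case 1
      then show ?thesis
        by (rule g6[OF orbit_g6_of_products[OF alt ind _ p(1-3) xv c]])
    next
      case 2
      show ?thesis
        by (rule g6[OF orbit_g6_of_products[OF alt ind2 2 p(4,3,2) xv(2,1,3)]])
          (use c in \<open>auto simp: algebra_simps\<close>)
    next
      case 3
      show ?thesis
        by (rule g6[OF orbit_g6_of_products[OF alt ind3 3 p(5,6,4) xv(3,2,1)]])
          (use c in \<open>auto simp: algebra_simps\<close>)
    qed
  qed
qed

text \<open>A coordinate of the Jacobian is an alternating trilinear form on a four-dimensional space, so it has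
  a radical vector \<open>v\<close>. The identity \<open>J(x, y, xy) = 0\<close> then forces \<open>xy\<close> into the span of \<open>x\<close>, \<open>y\<close>, \<open>v\<close>.\<close>

lemma nonlie_of_radical:
  assumes bin: "\<mu> \<in> binary" and ind: "indep4 x y z v"
    and nz: "jacobian \<mu> x y z $ k \<noteq> 0"
    and rad: "jacobian \<mu> x y v $ k = 0" "jacobian \<mu> x z v $ k = 0" "jacobian \<mu> y z v $ k = 0"
  shows "\<mu> \<in> orbits nonlie_models"
proof -
  have alt: "alternating \<mu>" and J: "\<And>x y. jacobian \<mu> x y (mult \<mu> x y) = 0"
    using bin by (auto simp: binary_def)
  note L = binary_linear[OF bin]
  define K where "K a b c = jacobian \<mu> a b c $ k" for a b c
  have K_lin: "K (a + a') b c = K a b c + K a' b c" "K a (b + b') c = K a b c + K a b' c"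
    "K a b (c + c') = K a b c + K a b c'" "K (r *s a) b c = r * K a b c" "K a (r *s b) c = r * K a b c"
    "K a b (r *s c) = r * K a b c" "K (- a) b c = - K a b c" "K a (- b) c = - K a b c"
    "K a b (- c) = - K a b c" "K a b (c - c') = K a b c - K a b c'" for a a' b b' c c' r
    by (simp_all add: K_def jacobian_linear)
  have K_eq: "K a a b = 0" "K b a a = 0" "K a b a = 0" for a b
    by (simp_all add: K_def jacobian_eq[OF alt])
  have K_sw: "K b a c = - K a b c" "K a c b = - K a b c" for a b c
    by (simp_all add: K_def jacobian_swap(1)[OF alt, of b a c] jacobian_swap(2)[OF alt, of a c b])
  have K0: "K x y z \<noteq> 0"
    using nz by (simp add: K_def)
  have K_xyz: "K y x z = - K x y z" "K x z y = - K x y z" "K z y x = - K x y z" "K y z x = K x y z"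
    "K z x y = K x y z"
    by (simp_all add: K_def jacobian_swap(1)[OF alt, of y x z] jacobian_swap(2)[OF alt, of x z y]
        jacobian_perm(1)[OF alt, of y z x] jacobian_perm(2)[OF alt, of z x y] jacobian_perm(3)[OF alt, of z y x])
  have K_v: "K a b v = 0" for a b
  proof -
    obtain a1 a2 a3 a4 where a: "a = a1 *s x + a2 *s y + a3 *s z + a4 *s v"
      by (rule indep4_span[OF ind])
    obtain b1 b2 b3 b4 where b: "b = b1 *s x + b2 *s y + b3 *s z + b4 *s v"
      by (rule indep4_span[OF ind])
    have "K x y v = 0" "K x z v = 0" "K y z v = 0" "K y x v = 0" "K z x v = 0" "K z y v = 0"
      using rad by (simp_all add: K_def jacobian_swap(1)[OF alt, of y x v]
          jacobian_swap(1)[OF alt, of z x v] jacobian_swap(1)[OF alt, of z y v])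
    then show ?thesis
      unfolding a b K_lin by (simp add: K_eq)
  qed
  have K_v': "K a v b = 0" "K v a b = 0" for a b
    using K_sw(2)[where a = a and b = b and c = v] K_sw(1)[where a = a and b = v and c = b] K_v[of a b] by simp_all
  note K_simps = K_lin K_eq K_xyz K_v K_v'
  have KJ: "K a b (mult \<mu> a b) = 0" for a b
    by (simp add: K_def J)
  have KL: "K a c (mult \<mu> a b) + K a b (mult \<mu> a c) = 0" for a b c
    using L[of a c b] by (simp add: K_def vec_eq_iff)
  obtain p1 p2 p3 p4 where p: "mult \<mu> x y = p1 *s x + p2 *s y + p3 *s z + p4 *s v"
    by (rule indep4_span[OF ind])
  obtain q1 q2 q3 q4 where q: "mult \<mu> x z = q1 *s x + q2 *s y + q3 *s z + q4 *s v"
    by (rule indep4_span[OF ind])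
  obtain r1 r2 r3 r4 where r: "mult \<mu> y z = r1 *s x + r2 *s y + r3 *s z + r4 *s v"
    by (rule indep4_span[OF ind])
  obtain s1 s2 s3 s4 where s: "mult \<mu> x v = s1 *s x + s2 *s y + s3 *s z + s4 *s v"
    by (rule indep4_span[OF ind])
  obtain t1 t2 t3 t4 where t: "mult \<mu> y v = t1 *s x + t2 *s y + t3 *s z + t4 *s v"
    by (rule indep4_span[OF ind])
  obtain u1 u2 u3 u4 where u: "mult \<mu> z v = u1 *s x + u2 *s y + u3 *s z + u4 *s v"
    by (rule indep4_span[OF ind])
  note sw = alternating_swap[OF alt p] alternating_swap[OF alt q] alternating_swap[OF alt r]
  \<comment> \<open>The form \<open>K\<close> vanishes as soon as one argument is \<open>v\<close>
    or two agree, so each instance of the identity isolates coordinates of the products.\<close>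
  have "p3 = 0" "q2 = 0" "r1 = 0"
    using KJ[of x y] KJ[of x z] KJ[of y z] K0 by (simp_all add: p q r K_simps)
  moreover have "r3 * K x y z = (- p1) * K x y z"
    using KL[of y z x] by (simp add: p r sw K_simps)
  then have "r3 = - p1"
    using K0 mult_right_cancel by blast
  moreover have "q3 = p2" "r2 = q1"
    using KL[of x z y] KL[of z y x] K0
    by (simp_all add: p q r sw K_simps add_eq_0_iff flip: distrib_right left_diff_distrib)
  moreover have Z: "s2 = 0" "s3 = 0" "t1 = 0" "t3 = 0" "u1 = 0" "u2 = 0"
    using KL[of x z v] KL[of x y v] KL[of y z v] KL[of y x v] KL[of z y v] KL[of z x v] K0
    by (simp_all add: s t u K_simps)
  \<comment> \<open>Sums of basis vectors compare the diagonal entries: modulo \<open>v\<close>,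
    multiplication by \<open>v\<close> is a single scalar.\<close>
  moreover have "t2 = s1" "u3 = s1"
    using KL[of "x + y" z v] KL[of "x + z" y v] K0
    by (auto simp: mult_linear s t u K_simps Z simp flip: distrib_right left_diff_distrib)
  ultimately have p: "mult \<mu> x y = - (- p1) *s x + p2 *s y + p4 *s v"
    and q: "mult \<mu> x z = - (- q1) *s x + p2 *s z + q4 *s v"
    and r: "mult \<mu> y z = - (- q1) *s y + (- p1) *s z + r4 *s v"
    and s: "mult \<mu> x v = s1 *s x + s4 *s v" and t: "mult \<mu> y v = s1 *s y + t4 *s v"
    and u: "mult \<mu> z v = s1 *s z + u4 *s v"
    by (simp_all add: p q r s t u)
  note prods = p q r s t u alternating_swap[OF alt p] alternating_swap[OF alt q] alternating_swap[OF alt r]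
    alternating_swap[OF alt s] alternating_swap[OF alt t] alternating_swap[OF alt u] alternating_self[OF alt]
  have Jv: "jacobian \<mu> a b v = - (s1 * (n2 - f2)) *s a + (s1 * (n1 - f1)) *s b + (f1 * n2 - f2 * n1 - 2 * s1 * P) *s v"
    if "mult \<mu> a b = - f2 *s a + f1 *s b + P *s v" "mult \<mu> a v = s1 *s a + n1 *s v"
      "mult \<mu> b v = s1 *s b + n2 *s v" for a b f1 f2 n1 n2 P
    unfolding jacobian_def
    by (simp add: mult_linear that alternating_swap[OF alt that(1)] alternating_swap[OF alt that(2)] alternating_swap[OF alt that(3)]
        alternating_self[OF alt] vec_eq_iff algebra_simps)
  define J12 J13 J23 where Jd: "J12 = jacobian \<mu> x y v" "J13 = jacobian \<mu> x z v" "J23 = jacobian \<mu> y z v"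
  \<comment> \<open>In J(a, b, ab) the parts of ab along a and b drop out, leaving the coefficient
    of \<open>v\<close> times J(a, b, v).\<close>
  have J0: "p4 *s J12 = 0" "q4 *s J13 = 0" "r4 *s J23 = 0"
    using J[of x y] J[of x z] J[of y z]
    by (simp_all add: p q r jacobian_linear jacobian_eq[OF alt] Jd)
  have J1: "p4 *s J13 + q4 *s J12 = 0" "- (p4 *s J23) - r4 *s J12 = 0" "q4 *s J23 + r4 *s J13 = 0"
    using L[of x z y] L[of y z x] L[of z y x]
    by (simp_all add: prods jacobian_linear jacobian_eq[OF alt] Jd jacobian_swap(1)[OF alt, of y x]
        jacobian_swap(1)[OF alt, of z x] jacobian_swap(1)[OF alt, of z y] jacobian_swap(2)[OF alt, of x z y]
        jacobian_perm(1)[OF alt, of y z x])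
  have P: "p4 \<noteq> 0 \<or> q4 \<noteq> 0 \<or> r4 \<noteq> 0"
  proof (rule ccontr)
    assume "\<not> ?thesis"
    then have "jacobian \<mu> x y z = 0"
      unfolding jacobian_def by (simp add: mult_linear prods vec_eq_iff algebra_simps)
    then show False
      using nz by simp
  qed
  then have JJ: "J12 = 0" "J13 = 0" "J23 = 0"
    using J0 J1 by auto
  have e12: "s1 * (t4 + p1) = 0 \<and> s1 * (s4 - p2) = 0 \<and> p2 * t4 + p1 * s4 - 2 * s1 * p4 = 0"
    using indep4_eq[OF ind, of "- (s1 * (t4 + p1))" "s1 * (s4 - p2)" 0 "p2 * t4 + p1 * s4 - 2 * s1 * p4" 0 0 0 0]
      Jv[OF p s t] JJ(1) Jd(1) by simp
  have e13: "s1 * (u4 + q1) = 0 \<and> s1 * (s4 - p2) = 0 \<and> p2 * u4 + q1 * s4 - 2 * s1 * q4 = 0"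
    using indep4_eq[OF ind, of "- (s1 * (u4 + q1))" 0 "s1 * (s4 - p2)" "p2 * u4 + q1 * s4 - 2 * s1 * q4" 0 0 0 0]
      Jv[OF q s u] JJ(2) Jd(2) by simp
  have e23: "s1 * (u4 + q1) = 0 \<and> s1 * (t4 + p1) = 0 \<and> - p1 * u4 + q1 * t4 - 2 * s1 * r4 = 0"
    using indep4_eq[OF ind, of 0 "- (s1 * (u4 + q1))" "s1 * (t4 + p1)" "- p1 * u4 + q1 * t4 - 2 * s1 * r4" 0 0 0 0]
      Jv[OF r t u] JJ(3) Jd(3) by simp
  \<comment> \<open>For nonzero s1 the action on \<open>v\<close> is by the functional f itself, and
    the last equations of \<open>e12\<close>, \<open>e13\<close>, \<open>e23\<close> become s1 p4 =
    s1 q4 = s1 r4 = 0, against \<open>P\<close>.\<close>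
  have s1: "s1 = 0"
  proof (rule ccontr)
    assume "s1 \<noteq> 0"
    then have "t4 = - p1" "s4 = p2" "u4 = - q1"
      using e12 e13 by (simp_all add: eq_neg_iff_add_eq_0)
    then show False
      using e12 e13 e23 P \<open>s1 \<noteq> 0\<close> by simp
  qed
  have n: "p2 * t4 = - p1 * s4" "p2 * u4 = - q1 * s4" "- p1 * u4 = - q1 * t4"
    using e12 e13 e23 by (simp_all add: s1 eq_neg_iff_add_eq_0)
  show ?thesis
  proof (rule nonlie_of_products[OF alt ind p q r])
    let ?c = "2 * (p2 * r4 - (- p1) * q4 + (- q1) * p4) - (p4 * u4 + r4 * s4 - q4 * t4)"
    have "jacobian \<mu> x y z = ?c *s v"
      unfolding jacobian_def by (simp add: mult_linear prods s1 vec_eq_iff algebra_simps)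
    then have "?c * v $ k \<noteq> 0"
      using nz by (simp only: vector_smult_component simp_thms)
    then show "?c \<noteq> 0"
      using mult_not_zero by blast
  qed (use s t u s1 n in simp_all)
qed

theorem nonlie_classification:
  assumes bin: "\<mu> \<in> binary" and "\<mu> \<notin> Lie"
  shows "\<mu> \<in> orbits nonlie_models"
proof -
  have alt: "alternating \<mu>"
    using bin by (simp add: binary_def)
  have step: "\<mu> \<in> orbits nonlie_models"
    if ind: "indep4 x y z w" and nz: "jacobian \<mu> x y z $ k \<noteq> 0" for x y z w k
  proof -
    \<comment> \<open>Solved for a radical vector: with these coefficients the chosen coordinate of
      the Jacobian vanishes on \<open>w - a *s x - b *s y - c *s z\<close> and any two of
      \<open>x\<close>, \<open>y\<close>, \<open>z\<close>.\<close>
    define a b c where "a = jacobian \<mu> y z w $ k / jacobian \<mu> x y z $ k"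
      "b = - jacobian \<mu> x z w $ k / jacobian \<mu> x y z $ k" "c = jacobian \<mu> x y w $ k / jacobian \<mu> x y z $ k"
    then have abc: "a * jacobian \<mu> x y z $ k = jacobian \<mu> y z w $ k"
      "b * jacobian \<mu> x y z $ k = - jacobian \<mu> x z w $ k" "c * jacobian \<mu> x y z $ k = jacobian \<mu> x y w $ k"
      using nz by simp_all
    have "indep4 x y z (w - a *s x - b *s y - c *s z)"
      by (rule indep4_combI[OF ind, of _ 1 0 0 0 _ 0 1 0 0 _ 0 0 1 0 _ "- a" "- b" "- c" 1])
        (auto simp: vec_eq_iff)
    then show ?thesis
      by (rule nonlie_of_radical[OF bin _ nz])
        (simp_all add: jacobian_linear jacobian_eq[OF alt] abc jacobian_perm(1)[OF alt, of y z x]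
          jacobian_swap(2)[OF alt, of x z y])
  qed
  have "\<not> (jacobian \<mu> (e 1) (e 2) (e 3) = 0 \<and> jacobian \<mu> (e 1) (e 2) (e 4) = 0 \<and>
    jacobian \<mu> (e 1) (e 3) (e 4) = 0 \<and> jacobian \<mu> (e 2) (e 3) (e 4) = 0)"
    using assms(2) jacobian_basis[OF alt] alt unfolding Lie_def lie_on_def alternating_def by blast
  then consider "jacobian \<mu> (e 1) (e 2) (e 3) \<noteq> 0" | "jacobian \<mu> (e 1) (e 2) (e 4) \<noteq> 0"
    | "jacobian \<mu> (e 1) (e 3) (e 4) \<noteq> 0" | "jacobian \<mu> (e 2) (e 3) (e 4) \<noteq> 0"
    by blast
  then show ?thesis
  proof cases
    case 1
    then obtain k where "jacobian \<mu> (e 1) (e 2) (e 3) $ k \<noteq> 0"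
      by (auto simp: vec_eq_iff)
    then show ?thesis
      by (rule step[OF indep4_axis])
  next
    case 2
    then obtain k where "jacobian \<mu> (e 1) (e 2) (e 4) $ k \<noteq> 0"
      by (auto simp: vec_eq_iff)
    then show ?thesis
      by (rule step[OF indep4_perm(2)[OF indep4_axis]])
  next
    case 3
    then obtain k where "jacobian \<mu> (e 1) (e 3) (e 4) $ k \<noteq> 0"
      by (auto simp: vec_eq_iff)
    then show ?thesis
      by (rule step[OF indep4_perm(2)[OF indep4_perm(1)[OF indep4_axis]]])
  next
    case 4
    then obtain k where "jacobian \<mu> (e 2) (e 3) (e 4) $ k \<noteq> 0"
      by (auto simp: vec_eq_iff)
    then show ?thesis
      by (rule step[OF indep4_perm(2)[OF indep4_perm(1)[OF indep4_perm(3)[OF indep4_axis]]]])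
  qed
qed

section \<open>Polynomial curves and Zariski closures\<close>

definition poly_fun :: "(complex \<Rightarrow> complex) \<Rightarrow> bool" where
  "poly_fun f \<longleftrightarrow> (\<exists>P. \<forall>t. f t = poly P t)"

lemma poly_fun_const: "poly_fun (\<lambda>t. c)"
  unfolding poly_fun_def by (rule exI[of _ "[:c:]"]) simp

lemma poly_fun_id: "poly_fun (\<lambda>t. t)"
  unfolding poly_fun_def by (rule exI[of _ "[:0, 1:]"]) simp

lemma poly_fun_add: "poly_fun f \<Longrightarrow> poly_fun g \<Longrightarrow> poly_fun (\<lambda>t. f t + g t)"
  unfolding poly_fun_def by (metis poly_add)

lemma poly_fun_mult: "poly_fun f \<Longrightarrow> poly_fun g \<Longrightarrow> poly_fun (\<lambda>t. f t * g t)"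
  unfolding poly_fun_def by (metis poly_mult)

lemma poly_fun_minus: "poly_fun f \<Longrightarrow> poly_fun (\<lambda>t. - f t)"
  unfolding poly_fun_def by (metis poly_minus)

lemma poly_fun_diff: "poly_fun f \<Longrightarrow> poly_fun g \<Longrightarrow> poly_fun (\<lambda>t. f t - g t)"
  unfolding poly_fun_def by (metis poly_diff)

lemma poly_fun_sum: "(\<And>i. i \<in> A \<Longrightarrow> poly_fun (f i)) \<Longrightarrow> poly_fun (\<lambda>t. \<Sum>i\<in>A. f i t)"
  by (induction A rule: infinite_finite_induct) (simp_all add: poly_fun_const poly_fun_add)

lemma poly_fun_prod: "(\<And>i. i \<in> A \<Longrightarrow> poly_fun (f i)) \<Longrightarrow> poly_fun (\<lambda>t. \<Prod>i\<in>A. f i t)"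
  by (induction A rule: infinite_finite_induct) (simp_all add: poly_fun_const poly_fun_mult)

lemmas poly_fun_intros = poly_fun_const poly_fun_id poly_fun_add poly_fun_mult poly_fun_minus
  poly_fun_diff

lemma poly_fun_det:
  fixes A :: "complex \<Rightarrow> complex ^ 'n ^ 'n"
  assumes "\<And>i j. poly_fun (\<lambda>t. A t $ i $ j)"
  shows "poly_fun (\<lambda>t. det (A t))"
  unfolding det_def by (intro poly_fun_sum poly_fun_mult poly_fun_const poly_fun_prod assms)

lemma poly_fun_zero:
  assumes "poly_fun f" "finite {t. f t \<noteq> 0}"
  shows "f t = 0"
proof -
  obtain P where P: "\<And>t. f t = poly P t"
    using assms(1) unfolding poly_fun_def by blast
  have "infinite (UNIV :: complex set)"
    by (rule infinite_UNIV_char_0)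
  then have "infinite {t. poly P t = 0}"
    using assms(2) unfolding P by (metis (mono_tags) Collect_neg_eq finite_Diff2 Compl_eq_Diff_UNIV)
  then have "P = 0"
    using poly_roots_finite by blast
  then show ?thesis
    by (simp add: P)
qed

definition poly_curve :: "(complex \<Rightarrow> 'n::finite alg) \<Rightarrow> bool" where
  "poly_curve c \<longleftrightarrow> (\<forall>i j k. poly_fun (\<lambda>t. c t $ i $ j $ k))"

lemma poly_fun_curve:
  assumes "p \<in> poly_functions" "poly_curve c"
  shows "poly_fun (\<lambda>t. p (c t))"
  using assms(1) by induction (use assms(2) in \<open>auto simp: poly_curve_def intro: poly_fun_intros\<close>)

lemma poly_curve_add: "poly_curve c \<Longrightarrow> poly_curve d \<Longrightarrow> poly_curve (\<lambda>t. c t + d t)"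
  by (simp add: poly_curve_def poly_fun_add)

lemma poly_curve_bracket:
  assumes "\<And>k. poly_fun (\<lambda>t. v t $ k)"
  shows "poly_curve (\<lambda>t. bracket i j (v t))"
  unfolding poly_curve_def
proof (intro allI)
  fix a b k
  have b: "bracket i j (v t) $ a $ b $ k
      = (if a = i \<and> b = j then v t $ k else if a = j \<and> b = i then - (v t $ k) else 0)" for t
    by (simp add: bracket_def)
  consider "a = i \<and> b = j" | "\<not> (a = i \<and> b = j)" "a = j \<and> b = i"
    | "\<not> (a = i \<and> b = j)" "\<not> (a = j \<and> b = i)"
    by blast
  then show "poly_fun (\<lambda>t. bracket i j (v t) $ a $ b $ k)"
  proof cases
    case 1
    then show ?thesis
      unfolding b using assms by simp
  next
    case 2
    then show ?thesis
      unfolding b if_not_P[OF 2(1)] if_P[OF 2(2)] by (intro poly_fun_minus assms)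
  next
    case 3
    then show ?thesis
      unfolding b if_not_P[OF 3(1)] if_not_P[OF 3(2)] by (intro poly_fun_const)
  qed
qed

text \<open>A defining polynomial pulled back along the curve has only finitely many nonzero values,
  hence none. This both passes to limits and fills in exceptional parameters.\<close>

lemma closedin_curve:
  assumes "closedin zariski E" "poly_curve c" "finite F" "\<And>t. t \<notin> F \<Longrightarrow> c t \<in> E"
  shows "c t \<in> E"
proof -
  obtain P where P: "P \<subseteq> poly_functions" "E = zero_locus P"
    using assms(1) closedin_zariski by blast
  have "p (c t) = 0" if "p \<in> P" for p
  proof (rule poly_fun_zero[where f = "\<lambda>t. p (c t)"])
    show "poly_fun (\<lambda>t. p (c t))"
      using that P(1) by (intro poly_fun_curve assms(2)) blast
    have "{t. p (c t) \<noteq> 0} \<subseteq> F"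
      using assms(4) that unfolding P(2) zero_locus_def by blast
    then show "finite {t. p (c t) \<noteq> 0}"
      using assms(3) finite_subset by blast
  qed
  then show ?thesis
    unfolding P(2) zero_locus_def by blast
qed

lemma closedin_polyI:
  assumes "\<And>a. p a \<in> poly_functions"
  shows "closedin zariski {\<mu>. \<forall>a. p a \<mu> = 0}"
  unfolding closedin_zariski by (rule exI[of _ "range p"]) (use assms in \<open>auto simp: zero_locus_def\<close>)

lemma poly_functions_sum:
  "(\<And>i. i \<in> A \<Longrightarrow> f i \<in> poly_functions) \<Longrightarrow> (\<lambda>\<mu>. \<Sum>i\<in>A. f i \<mu>) \<in> poly_functions"
  by (induction A rule: infinite_finite_induct) (simp_all add: poly_functions.const poly_functions.add)

lemma poly_functions_prod:
  "(\<And>i. i \<in> A \<Longrightarrow> f i \<in> poly_functions) \<Longrightarrow> (\<lambda>\<mu>. \<Prod>i\<in>A. f i \<mu>) \<in> poly_functions"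
  by (induction A rule: infinite_finite_induct) (simp_all add: poly_functions.const poly_functions.mult)

lemma poly_functions_minus: "p \<in> poly_functions \<Longrightarrow> (\<lambda>\<mu>. - p \<mu>) \<in> poly_functions"
  using poly_functions.mult[OF poly_functions.const[of "-1"]] by fastforce

lemma poly_functions_diff:
  "p \<in> poly_functions \<Longrightarrow> q \<in> poly_functions \<Longrightarrow> (\<lambda>\<mu>. p \<mu> - q \<mu>) \<in> poly_functions"
  using poly_functions.add[OF _ poly_functions_minus] by fastforce

lemma poly_functions_power: "p \<in> poly_functions \<Longrightarrow> (\<lambda>\<mu>. p \<mu> ^ n) \<in> poly_functions"
  by (induction n) (simp_all add: poly_functions.const poly_functions.mult)

lemmas poly_functions_intros = poly_functions.const poly_functions.coord poly_functions.add
  poly_functions.mult poly_functions_minus poly_functions_diff poly_functions_power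

lemma poly_functions_mult:
  assumes "\<And>k. (\<lambda>\<mu>. X \<mu> $ k) \<in> poly_functions" "\<And>k. (\<lambda>\<mu>. Y \<mu> $ k) \<in> poly_functions"
  shows "(\<lambda>\<mu>. mult \<mu> (X \<mu>) (Y \<mu>) $ k) \<in> poly_functions"
  unfolding mult_def by (simp, intro poly_functions_sum poly_functions_intros assms)

lemma poly_functions_act:
  assumes "p \<in> poly_functions"
  shows "(\<lambda>\<mu>. p (act g \<mu>)) \<in> poly_functions"
  using assms
proof induction
  case (coord i j k)
  show ?case
    unfolding act_def matrix_vector_mult_def
    by (simp, intro poly_functions_sum poly_functions_intros poly_functions_mult)
qed (auto intro: poly_functions_intros)

definition invariant :: "'n::finite alg set \<Rightarrow> bool" where
  "invariant E \<longleftrightarrow> (\<forall>\<mu>\<in>E. orbit \<mu> \<subseteq> E)"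

lemma invariant_orbits: "invariant (orbits M)"
  unfolding invariant_def orbits_def using orbit_trans by blast

text \<open>A fixed g acts by polynomial functions, so the preimage of the closure under
  \<open>act g\<close> is closed and contains \<open>S\<close>.\<close>

lemma invariant_closure:
  assumes "invariant S"
  shows "invariant (zariski closure_of S)"
  unfolding invariant_def
proof (intro ballI subsetI)
  fix \<mu> \<nu>
  assume \<mu>: "\<mu> \<in> zariski closure_of S" and "\<nu> \<in> orbit \<mu>"
  then obtain g where g: "invertible g" "\<nu> = act g \<mu>"
    unfolding orbit_def by blast
  obtain P where P: "P \<subseteq> poly_functions" "zariski closure_of S = zero_locus P"
    using closedin_zariski closedin_closure_of by metis
  have "p \<nu> = 0" if "p \<in> P" for p
  proof -
    \<comment> \<open>The dummy variable of type \<open>unit\<close> brings a single equation into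
      the form of \<open>closedin_polyI\<close>.\<close>
    let ?E = "{\<mu>. \<forall>a :: unit. p (act g \<mu>) = 0}"
    have "closedin zariski ?E"
      by (rule closedin_polyI) (use that P(1) poly_functions_act in blast)
    moreover have "S \<subseteq> ?E"
    proof
      fix \<rho>
      assume "\<rho> \<in> S"
      then have "act g \<rho> \<in> S"
        using assms g(1) unfolding invariant_def orbit_def by blast
      then have "act g \<rho> \<in> zero_locus P"
        using P(2) closure_of_subset[of S zariski] by auto
      then show "\<rho> \<in> ?E"
        using that unfolding zero_locus_def by blast
    qed
    ultimately have "zariski closure_of S \<subseteq> ?E"
      by (rule closure_of_minimal[rotated])
    then show ?thesis
      using \<mu> g(2) by blast
  qed
  then show "\<nu> \<in> zariski closure_of S"
    unfolding P(2) zero_locus_def by blast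
qed

section \<open>Irreducibility of families of orbits\<close>

text \<open>A quotient of a polynomial by a power of D. Nothing is asked at the zeros of D, where
  \<open>matrix_inv\<close> of a singular matrix has an unspecified value.\<close>

definition rat_fun :: "(complex \<Rightarrow> complex) \<Rightarrow> (complex \<Rightarrow> complex) \<Rightarrow> bool" where
  "rat_fun D f \<longleftrightarrow> (\<exists>n g. poly_fun g \<and> (\<forall>t. D t \<noteq> 0 \<longrightarrow> D t ^ n * f t = g t))"

lemma rat_fun_poly: "poly_fun f \<Longrightarrow> rat_fun D f"
  unfolding rat_fun_def by (rule exI[of _ 0]) auto

lemma poly_fun_power: "poly_fun f \<Longrightarrow> poly_fun (\<lambda>t. f t ^ n)"
  by (induction n) (auto intro: poly_fun_intros)

lemma rat_fun_add:
  assumes "poly_fun D" "rat_fun D f" "rat_fun D g"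
  shows "rat_fun D (\<lambda>t. f t + g t)"
proof -
  obtain n f' where f: "poly_fun f'" "\<And>t. D t \<noteq> 0 \<Longrightarrow> D t ^ n * f t = f' t"
    using assms(2) unfolding rat_fun_def by metis
  obtain m g' where g: "poly_fun g'" "\<And>t. D t \<noteq> 0 \<Longrightarrow> D t ^ m * g t = g' t"
    using assms(3) unfolding rat_fun_def by metis
  have "D t ^ (n + m) * (f t + g t) = D t ^ m * f' t + D t ^ n * g' t" if "D t \<noteq> 0" for t
    unfolding f(2)[OF that, symmetric] g(2)[OF that, symmetric] by (simp add: power_add algebra_simps)
  moreover have "poly_fun (\<lambda>t. D t ^ m * f' t + D t ^ n * g' t)"
    by (intro poly_fun_add poly_fun_mult poly_fun_power assms(1) f(1) g(1))
  ultimately show ?thesis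
    unfolding rat_fun_def by (intro exI[of _ "n + m"] exI[of _ "\<lambda>t. D t ^ m * f' t + D t ^ n * g' t"]) simp
qed

lemma rat_fun_mult:
  assumes "rat_fun D f" "rat_fun D g"
  shows "rat_fun D (\<lambda>t. f t * g t)"
proof -
  obtain n f' where f: "poly_fun f'" "\<And>t. D t \<noteq> 0 \<Longrightarrow> D t ^ n * f t = f' t"
    using assms(1) unfolding rat_fun_def by metis
  obtain m g' where g: "poly_fun g'" "\<And>t. D t \<noteq> 0 \<Longrightarrow> D t ^ m * g t = g' t"
    using assms(2) unfolding rat_fun_def by metis
  have "D t ^ (n + m) * (f t * g t) = f' t * g' t" if "D t \<noteq> 0" for t
    unfolding f(2)[OF that, symmetric] g(2)[OF that, symmetric] by (simp add: power_add algebra_simps)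
  moreover have "poly_fun (\<lambda>t. f' t * g' t)"
    by (intro poly_fun_mult f(1) g(1))
  ultimately show ?thesis
    unfolding rat_fun_def by (intro exI[of _ "n + m"] exI[of _ "\<lambda>t. f' t * g' t"]) simp
qed

lemma rat_fun_sum:
  assumes "poly_fun D" "\<And>i. i \<in> A \<Longrightarrow> rat_fun D (f i)"
  shows "rat_fun D (\<lambda>t. \<Sum>i\<in>A. f i t)"
  using assms(2)
  by (induction A rule: infinite_finite_induct)
    (simp_all add: rat_fun_poly poly_fun_const rat_fun_add[OF assms(1)])

lemma rat_fun_poly_functions:
  assumes "p \<in> poly_functions" "poly_fun D" "\<And>i j k. rat_fun D (\<lambda>t. c t $ i $ j $ k)"
  shows "rat_fun D (\<lambda>t. p (c t))"
  using assms(1)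
  by induction (auto intro: rat_fun_poly poly_fun_const rat_fun_add rat_fun_mult assms(2,3))

lemma matrix_inv_cramer:
  fixes A :: "complex ^ 'n ^ 'n"
  assumes "det A \<noteq> 0"
  shows "det A * matrix_inv A $ k $ l = det (\<chi> i j. if j = k then axis l 1 $ i else A $ i $ j)"
proof -
  have "invertible A"
    using assms invertible_det_nz by blast
  then have "A *v (matrix_inv A *v axis l 1) = axis l 1"
    by (rule invertible_inv_mult)
  then have "matrix_inv A *v axis l 1 = (\<chi> k. det (\<chi> i j. if j = k then axis l 1 $ i else A $ i $ j) / det A)"
    using cramer[OF assms] by blast
  moreover have "(matrix_inv A *v axis l 1) $ k = matrix_inv A $ k $ l"
    by (simp add: matrix_vector_mul_component axis_def inner_vec_def matrix_vector_mult_def if_distrib cong: if_cong)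
  ultimately have "matrix_inv A $ k $ l = det (\<chi> i j. if j = k then axis l 1 $ i else A $ i $ j) / det A"
    by (metis (no_types, lifting) vec_lambda_beta)
  then show ?thesis
    using assms by simp
qed

lemma rat_fun_matrix_inv:
  fixes A :: "complex \<Rightarrow> complex ^ 'n ^ 'n"
  assumes "\<And>i j. poly_fun (\<lambda>t. A t $ i $ j)"
  shows "rat_fun (\<lambda>t. det (A t)) (\<lambda>t. matrix_inv (A t) $ k $ l)"
proof -
  have "poly_fun (\<lambda>t. det (\<chi> i j. if j = k then axis l 1 $ i else A t $ i $ j))"
  proof (rule poly_fun_det)
    show "poly_fun (\<lambda>t. (\<chi> i j. if j = k then axis l 1 $ i else A t $ i $ j) $ i $ j)" for i j
      by (cases "j = k") (simp_all add: assms poly_fun_const)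
  qed
  then show ?thesis
    unfolding rat_fun_def using matrix_inv_cramer[of "A _" k l]
    by (intro exI[of _ 1] exI[of _ "\<lambda>t. det (\<chi> i j. if j = k then axis l 1 $ i else A t $ i $ j)"]) simp
qed

lemma rat_fun_act:
  assumes G: "\<And>i j. poly_fun (\<lambda>t. G t $ i $ j)" and c: "poly_curve c"
  shows "rat_fun (\<lambda>t. det (G t)) (\<lambda>t. act (G t) (c t) $ i $ j $ k)"
proof -
  have "act (G t) (c t) $ i $ j $ k = (\<Sum>l\<in>UNIV. G t $ k $ l * (\<Sum>a\<in>UNIV. \<Sum>b\<in>UNIV.
      matrix_inv (G t) $ a $ i * matrix_inv (G t) $ b $ j * c t $ a $ b $ l))" for t
    by (simp add: act_def matrix_vector_mult_def mult_def axis_def if_distrib cong: if_cong)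
  then show ?thesis
    using poly_fun_det[OF G] c unfolding poly_curve_def
    by (simp only:) (intro rat_fun_sum rat_fun_mult rat_fun_matrix_inv rat_fun_poly G; simp)
qed

text \<open>Two points of the union of orbits are joined by \<open>act ((1 - t) g + t h) (c t)\<close>, a curve rational in
  \<open>t\<close>, along which a product of two polynomials vanishes only if one of them does.\<close>

lemma irreducible_orbits:
  assumes "M \<noteq> {}" and conn: "\<And>\<mu> \<nu>. \<mu> \<in> M \<Longrightarrow> \<nu> \<in> M \<Longrightarrow>
    \<exists>c. poly_curve c \<and> c 0 = \<mu> \<and> c 1 = \<nu> \<and> (\<forall>t. c t \<in> M)"
  shows "irreducible_in zariski (orbits M)"
  unfolding irreducible_in_def
proof (intro conjI allI impI)
  show "orbits M \<noteq> {}"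
    using assms(1) orbit_refl unfolding orbits_def by blast
  fix A B
  assume "closedin zariski A" "closedin zariski B" and AB: "orbits M \<subseteq> A \<union> B"
  then obtain P Q where P: "P \<subseteq> poly_functions" "A = zero_locus P" and Q: "Q \<subseteq> poly_functions" "B = zero_locus Q"
    unfolding closedin_zariski by blast
  show "orbits M \<subseteq> A \<or> orbits M \<subseteq> B"
  proof (rule ccontr)
    assume "\<not> ?thesis"
    then obtain x y where x: "x \<in> orbits M" "x \<notin> A" and y: "y \<in> orbits M" "y \<notin> B"
      by blast
    obtain p q where p: "p \<in> P" "p x \<noteq> 0" and q: "q \<in> Q" "q y \<noteq> 0"
      using x(2) y(2) unfolding P(2) Q(2) zero_locus_def by blast
    obtain g \<mu> where g: "invertible g" "\<mu> \<in> M" "x = act g \<mu>"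
      using x(1) unfolding orbits_def orbit_def by blast
    obtain h \<nu> where h: "invertible h" "\<nu> \<in> M" "y = act h \<nu>"
      using y(1) unfolding orbits_def orbit_def by blast
    obtain c where c: "poly_curve c" "c 0 = \<mu>" "c 1 = \<nu>" "\<And>t. c t \<in> M"
      using conn[OF g(2) h(2)] by blast
    define G where "G t = (\<chi> i j. (1 - t) * g $ i $ j + t * h $ i $ j)" for t
    have G01: "G 0 = g" "G 1 = h"
      by (simp_all add: G_def vec_eq_iff)
    define D where "D t = det (G t)" for t
    define z where "z t = act (G t) (c t)" for t
    have G: "poly_fun (\<lambda>t. G t $ i $ j)" for i j
      unfolding G_def by (simp, intro poly_fun_intros)
    then have D: "poly_fun D"
      unfolding D_def by (rule poly_fun_det)
    have z: "rat_fun D (\<lambda>t. z t $ i $ j $ k)" for i j k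
      unfolding D_def z_def by (rule rat_fun_act[OF G c(1)])
    obtain n p' where p': "poly_fun p'" "\<And>t. D t \<noteq> 0 \<Longrightarrow> D t ^ n * p (z t) = p' t"
      using rat_fun_poly_functions[OF _ D z, of p] p(1) P(1) unfolding rat_fun_def by blast
    obtain m q' where q': "poly_fun q'" "\<And>t. D t \<noteq> 0 \<Longrightarrow> D t ^ m * q (z t) = q' t"
      using rat_fun_poly_functions[OF _ D z, of q] q(1) Q(1) unfolding rat_fun_def by blast
    have D01: "D 0 \<noteq> 0" "D 1 \<noteq> 0"
      using g(1) h(1) invertible_det_nz by (auto simp: D_def G01)
    \<comment> \<open>The factor \<open>D t\<close> extends the identity to the t with singular
      \<open>G t\<close>. It becomes an identity of polynomials, which have no zero
      divisors.\<close>
    have zero: "D t * (p' t * q' t) = 0" for t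
    proof (cases "D t = 0")
      case False
      then have "invertible (G t)"
        unfolding D_def invertible_det_nz .
      then have "z t \<in> orbits M"
        using c(4) unfolding z_def orbits_def orbit_def by blast
      then have "p (z t) * q (z t) = 0"
        using AB p(1) q(1) unfolding P(2) Q(2) zero_locus_def by auto
      then show ?thesis
        using p'(2)[OF False] q'(2)[OF False] by (metis mult_eq_0_iff)
    qed simp
    obtain D' p'' q'' where poly: "\<And>t. D t = poly D' t" "\<And>t. p' t = poly p'' t" "\<And>t. q' t = poly q'' t"
      using D p'(1) q'(1) unfolding poly_fun_def by metis
    have "D' * (p'' * q'') = 0"
      using zero unfolding poly by (metis poly_all_0_iff_0 poly_mult)
    moreover have "p' 0 \<noteq> 0"
      using p'(2)[of 0] D01 p(2) by (auto simp: z_def G01 c g(3)[symmetric])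
    moreover have "q' 1 \<noteq> 0"
      using q'(2)[of 1] D01 q(2) by (auto simp: z_def G01 c h(3)[symmetric])
    ultimately show False
      using D01(1) unfolding poly by (metis mult_eq_0_iff poly_0)
  qed
qed simp

section \<open>Irreducible sets and finite closed covers\<close>

lemma irreducible_closure:
  assumes "irreducible_in X S"
  shows "irreducible_in X (X closure_of S)"
proof -
  have S: "S \<subseteq> topspace X" "S \<noteq> {}"
    "\<And>A B. closedin X A \<Longrightarrow> closedin X B \<Longrightarrow> S \<subseteq> A \<union> B \<Longrightarrow> S \<subseteq> A \<or> S \<subseteq> B"
    using assms unfolding irreducible_in_def by blast+
  have sub: "S \<subseteq> X closure_of S"
    by (rule closure_of_subset[OF S(1)])
  show ?thesis
    unfolding irreducible_in_def
  proof (intro conjI allI impI)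
    show "X closure_of S \<subseteq> topspace X"
      by (rule closure_of_subset_topspace)
    show "X closure_of S \<noteq> {}"
      using sub S(2) by blast
    fix A B
    assume *: "closedin X A" "closedin X B" "X closure_of S \<subseteq> A \<union> B"
    then show "X closure_of S \<subseteq> A \<or> X closure_of S \<subseteq> B"
      using S(3)[OF *(1,2)] sub closure_of_minimal by blast
  qed
qed

lemma irreducible_subtopology:
  assumes "irreducible_in X C" "C \<subseteq> W" "closedin X W"
  shows "irreducible_in (subtopology X W) C"
  using assms unfolding irreducible_in_def closedin_closed_subtopology[OF assms(3)] by auto

text \<open>An irreducible set covered by finitely many closed sets lies in one of them. So every
  component belongs to \<open>F\<close>, and the antichain condition makes each member of
  \<open>F\<close> maximal.\<close>

lemma irreducible_components_finite:
  assumes fin: "finite F" and cl: "\<And>C. C \<in> F \<Longrightarrow> closedin X C" and irr: "\<And>C. C \<in> F \<Longrightarrow> irreducible_in X C"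
    and cover: "topspace X = \<Union>F" and anti: "\<And>C D. C \<in> F \<Longrightarrow> D \<in> F \<Longrightarrow> C \<subseteq> D \<Longrightarrow> C = D"
  shows "irreducible_components X = F"
proof -
  have sub: "\<exists>C\<in>G. D \<subseteq> C" if "finite G" "irreducible_in X D" "D \<subseteq> \<Union>G" "\<And>C. C \<in> G \<Longrightarrow> closedin X C" for G D
    using that
  proof (induction G)
    case empty
    then show ?case
      by (simp add: irreducible_in_def)
  next
    case (insert C G)
    have "closedin X C" "closedin X (\<Union>G)"
      using insert by (auto intro: closedin_Union)
    then have "D \<subseteq> C \<or> D \<subseteq> \<Union>G"
      using insert.prems(1,2) unfolding irreducible_in_def by simp
    then show ?case
      using insert by blast
  qed
  have subF: "\<exists>C\<in>F. D \<subseteq> C" if "irreducible_in X D" for D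
    using sub[OF fin that _ cl] that cover unfolding irreducible_in_def by simp
  show ?thesis
  proof (intro set_eqI iffI)
    fix C
    assume "C \<in> irreducible_components X"
    then have C: "irreducible_in X C" "\<And>D. closedin X D \<Longrightarrow> irreducible_in X D \<Longrightarrow> C \<subseteq> D \<Longrightarrow> D = C"
      unfolding irreducible_components_def by blast+
    obtain D where "D \<in> F" "C \<subseteq> D"
      using subF[OF C(1)] by blast
    then show "C \<in> F"
      using C(2)[OF cl irr] by blast
  next
    fix C
    assume C: "C \<in> F"
    have "D = C" if "irreducible_in X D" "C \<subseteq> D" for D
      using subF[OF that(1)] that(2) anti[OF C] by blast
    then show "C \<in> irreducible_components X"
      using cl[OF C] irr[OF C] unfolding irreducible_components_def by blast
  qed
qed

section \<open>Degenerations\<close>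

lemmas curve_simps = alternating_plus alternating_bracket mult_plus mult_bracket indep4_def vec_eq_iff
  forall_4 axis_def field_simps power2_eq_square

lemmas poly_curve_intros = poly_curve_add poly_curve_bracket

text \<open>For an arbitrary closed invariant set, degenerations become implications between
  memberships and compose by chaining.\<close>

locale stable =
  fixes E :: "4 alg set"
  assumes closed: "closedin zariski E" and inv: "invariant E"
begin

lemma orbitD: "\<mu> \<in> E \<Longrightarrow> \<nu> \<in> orbit \<mu> \<Longrightarrow> \<nu> \<in> E"
  using inv unfolding invariant_def by blast

text \<open>The source \<open>M t\<close> may vary with t, for limits that are reached only as a
  parameter tends to infinity.\<close>

lemma limit:
  assumes "poly_curve c" "\<And>t. t \<noteq> 0 \<Longrightarrow> c t \<in> orbit (M t)" "c 0 \<in> orbit N" "\<And>t. t \<noteq> 0 \<Longrightarrow> M t \<in> E"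
  shows "N \<in> E"
proof -
  have "c 0 \<in> E"
    by (rule closedin_curve[OF closed assms(1), of "{0}"]) (use assms(2,4) orbitD in auto)
  then show ?thesis
    using orbitD orbit_sym[OF assms(3)] by blast
qed

lemma sl2_C_g5:
  assumes "sl2_C \<in> E"
  shows "g5 (- 1) \<in> E"
proof (rule limit[where c = "\<lambda>t. bracket 1 2 (e 2) + bracket 1 3 (e 2 - e 3)
  + bracket 2 3 (e 4 + t *s e 1)" and M = "\<lambda>t. sl2_C"], goal_cases)
  case 1
  show ?case by (intro poly_curve_intros) (simp_all add: poly_fun_intros)
next
  case (2 t)
  show ?case
    \<comment> \<open>\<open>e 4\<close> is central, so adding (1/t) e4 to \<open>e 1\<close> keeps
      its action and makes it the product of \<open>y\<close> and \<open>z\<close>; \<open>z\<close>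
      is the eigenvector for -1.\<close>
    by (rule orbit_sl2_CI[where x = "e 1 + (1/t) *s e 4" and y = "e 2"
      and z = "(1/t) *s (e 3 - (1/2) *s e 2)"
      and w = "e 4"]) (use 2 assms in \<open>auto simp: curve_simps\<close>)
next
  case 3
  show ?case
    by (rule orbit_g5I[OF _ indep4_axis]) (use assms in \<open>auto simp: curve_simps\<close>)
qed (use assms in auto)

text \<open>Rescaling \<open>e 4\<close> switches off e2 e3 = e4. The remaining action has
  eigenvalues 1, \<alpha>, \<alpha> + 1 and a cyclic vector, except at \<alpha> = 0, where the
  double eigenvalue 1 has no Jordan block and the limit is \<open>g2 0\<close>.\<close>

lemma g5_g4:
  assumes "\<alpha> \<noteq> 0" "g5 \<alpha> \<in> E"
  shows "g4 \<alpha> (\<alpha> + 1) \<in> E"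
proof (rule limit[where c = "\<lambda>t. bracket 1 2 (e 2) + bracket 1 3 (e 2 + \<alpha> *s e 3)
  + bracket 1 4 ((\<alpha> + 1) *s e 4) + bracket 2 3 (t *s e 4)" and M = "\<lambda>t. g5 \<alpha>"], goal_cases)
  case 1
  show ?case by (intro poly_curve_intros) (simp_all add: poly_fun_intros)
next
  case (2 t)
  show ?case
    by (rule orbit_g5I[where x = "e 1" and y = "e 2" and z = "e 3"
      and w = "t *s e 4"]) (use 2 assms in \<open>auto simp: curve_simps\<close>)
next
  case 3
  show ?case
    by (rule orbit_g4I[where x = "e 1" and y = "(- \<alpha>) *s e 2" and z = "e 2 - e 3"
      and w = "e 3 + e 4"]) (use assms in \<open>auto simp: curve_simps\<close>)
qed (use assms in auto)

lemma g4_n4: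
  assumes "g4 \<alpha> \<beta> \<in> E"
  shows "n4 \<in> E"
proof (rule limit[where c = "\<lambda>t. bracket 1 2 (t *s e 2) + bracket 1 3 (e 2
  + (t * \<alpha>) *s e 3) + bracket 1 4 (e 3 + (t * \<beta>) *s e 4)" and M = "\<lambda>t. g4 \<alpha> \<beta>"], goal_cases)
  case 1
  show ?case by (intro poly_curve_intros) (simp_all add: poly_fun_intros)
next
  case (2 t)
  show ?case
    by (rule orbit_g4I[where x = "(1/t) *s e 1" and y = "(1/t\<^sup>2) *s e 2"
      and z = "(1/t) *s e 3" and w = "e 4"]) (use 2 assms in \<open>auto simp: curve_simps\<close>)
next
  case 3
  show ?case
    by (rule orbit_n4I[where x = "e 1" and y = "e 4" and z = "e 3"
      and w = "e 2"]) (use assms in \<open>auto simp: curve_simps\<close>)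
qed (use assms in auto)

lemma n4_n3_C:
  assumes "n4 \<in> E"
  shows "n3_C \<in> E"
proof (rule limit[where c = "\<lambda>t. bracket 1 2 (e 3) + bracket 1 3 (t *s e 4)" and M = "\<lambda>t. n4"], goal_cases)
  case 1
  show ?case by (intro poly_curve_intros) (simp_all add: poly_fun_intros)
next
  case (2 t)
  show ?case
    by (rule orbit_n4I[where x = "e 1" and y = "e 2" and z = "e 3"
      and w = "t *s e 4"]) (use 2 assms in \<open>auto simp: curve_simps\<close>)
next
  case 3
  show ?case
    by (rule orbit_n3_CI[OF _ indep4_axis]) (use assms in \<open>auto simp: curve_simps\<close>)
qed (use assms in auto)

lemma n3_C_C4:
  assumes "n3_C \<in> E"
  shows "C4 \<in> E"
proof (rule limit[where c = "\<lambda>t. bracket 1 2 (t *s e 3)" and M = "\<lambda>t. n3_C"], goal_cases)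
  case 1
  show ?case by (intro poly_curve_intros) (simp_all add: poly_fun_intros)
next
  case (2 t)
  show ?case
    by (rule orbit_n3_CI[where x = "e 1" and y = "e 2" and z = "t *s e 3"
      and w = "e 4"]) (use 2 assms in \<open>auto simp: curve_simps\<close>)
next
  case 3
  show ?case
    by (rule orbit_C4I[OF _ indep4_axis]) (use assms in \<open>auto simp: curve_simps\<close>)
qed (use assms in auto)

lemma r2_r2_g5:
  assumes "r2_r2 \<in> E"
  shows "g5 0 \<in> E"
proof (rule limit[where c = "\<lambda>t. bracket 1 2 (e 2) + bracket 1 3 (e 2) + bracket 1 4 (e 4)
  + bracket 2 3 (e 4) + bracket 3 4 ((- t) *s e 4)" and M = "\<lambda>t. r2_r2"], goal_cases)
  case 1
  show ?case by (intro poly_curve_intros) (simp_all add: poly_fun_intros)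
next
  case (2 t)
  show ?case
    \<comment> \<open>\<open>e 3 - e 2\<close> commutes with \<open>e 1\<close>; these combinations
      of the two act as 1 on one of \<open>y\<close>, \<open>w\<close> and as 0 on the
      other.\<close>
    by (rule orbit_r2_r2I[where x = "e 1 + (1/t) *s (e 3 - e 2)" and y = "e 2 - (1/t) *s e 4"
      and z = "(-1/t) *s (e 3 - e 2)"
      and w = "e 4"]) (use 2 assms in \<open>auto simp: curve_simps\<close>)
next
  case 3
  show ?case
    by (rule orbit_g5I[OF _ indep4_axis]) (use assms in \<open>auto simp: curve_simps\<close>)
qed (use assms in auto)

lemma g5_g2:
  assumes "g5 0 \<in> E"
  shows "g2 0 \<in> E"
proof (rule limit[where c = "\<lambda>t. bracket 1 2 (e 2) + bracket 1 3 (e 2) + bracket 1 4 (e 4)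
  + bracket 2 3 (t *s e 4)" and M = "\<lambda>t. g5 0"], goal_cases)
  case 1
  show ?case by (intro poly_curve_intros) (simp_all add: poly_fun_intros)
next
  case (2 t)
  show ?case
    by (rule orbit_g5I[where x = "e 1" and y = "e 2" and z = "e 3"
      and w = "t *s e 4"]) (use 2 assms in \<open>auto simp: curve_simps\<close>)
next
  case 3
  show ?case
    by (rule orbit_g2I[where x = "e 1" and y = "e 2" and z = "e 4"
      and w = "e 4 + e 3 - e 2"]) (use assms in \<open>auto simp: curve_simps\<close>)
qed (use assms in auto)

lemma r2_r2_r2_C2:
  assumes "r2_r2 \<in> E"
  shows "r2_C2 \<in> E"
proof (rule limit[where c = "\<lambda>t. bracket 1 2 (e 2) + bracket 3 4 (t *s e 4)" and M = "\<lambda>t. r2_r2"], goal_cases)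
  case 1
  show ?case by (intro poly_curve_intros) (simp_all add: poly_fun_intros)
next
  case (2 t)
  show ?case
    by (rule orbit_r2_r2I[where x = "e 1" and y = "e 2" and z = "(1/t) *s e 3"
      and w = "e 4"]) (use 2 assms in \<open>auto simp: curve_simps\<close>)
next
  case 3
  show ?case
    by (rule orbit_r2_C2I[OF _ indep4_axis]) (use assms in \<open>auto simp: curve_simps\<close>)
qed (use assms in auto)

text \<open>Along the curve \<open>e 4\<close> acts on \<open>e 2\<close>, \<open>e 3\<close> as t
  times the identity. In the limit \<open>e 1\<close> remains, with eigenvalues 1, \<alpha>, 0;
  these are distinct, so there is a cyclic vector.\<close>

lemma r2_r2_g4:
  assumes "\<alpha> \<noteq> 0" "\<alpha> \<noteq> 1" "r2_r2 \<in> E"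
  shows "g4 \<alpha> 0 \<in> E"
proof (rule limit[where c = "\<lambda>t. bracket 1 2 (e 2) + bracket 1 3 (\<alpha> *s e 3)
  + bracket 2 4 ((- t) *s e 2) + bracket 3 4 ((- t) *s e 3)" and M = "\<lambda>t. r2_r2"], goal_cases)
  case 1
  show ?case by (intro poly_curve_intros) (simp_all add: poly_fun_intros)
next
  case (2 t)
  show ?case
  proof -
    define k where "k = 1 - \<alpha>"
    have k: "k \<noteq> 0" "\<alpha> = 1 - k"
      using assms by (simp_all add: k_def)
    show ?thesis
      unfolding k(2)
      by (rule orbit_r2_r2I[where x = "(1/k) *s (e 1 - ((1 - k)/t) *s e 4)" and y = "e 2"
            and z = "(1/k) *s ((1/t) *s e 4 - e 1)" and w = "e 3"])
        (use 2 k(1) in \<open>auto simp: curve_simps\<close>)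
  qed
next
  case 3
  show ?case
    by (rule orbit_g4I[where x = "e 1" and y = "(1 - \<alpha>) *s e 2"
      and z = "e 2 + \<alpha> *s e 3"
      and w = "e 2 + e 3 + e 4"]) (use assms in \<open>auto simp: curve_simps\<close>)
qed (use assms in auto)

lemma g5_g3:
  assumes "g5 1 \<in> E"
  shows "g3 2 \<in> E"
proof (rule limit[where c = "\<lambda>t. bracket 1 2 (e 2) + bracket 1 3 (t *s e 2 + e 3)
  + bracket 1 4 (2 *s e 4) + bracket 2 3 (e 4)" and M = "\<lambda>t. g5 1"], goal_cases)
  case 1
  show ?case by (intro poly_curve_intros) (simp_all add: poly_fun_intros)
next
  case (2 t)
  show ?case
    by (rule orbit_g5I[where x = "e 1" and y = "t *s e 2" and z = "e 3"
      and w = "t *s e 4"]) (use 2 assms in \<open>auto simp: curve_simps\<close>)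
next
  case 3
  show ?case
    by (rule orbit_g3I[OF _ indep4_axis]) (use assms in \<open>auto simp: curve_simps\<close>)
qed (use assms in auto)

lemma g3_g2:
  assumes "\<beta> \<noteq> 1" "g3 \<beta> \<in> E"
  shows "g2 \<beta> \<in> E"
proof (rule limit[where c = "\<lambda>t. bracket 1 2 (e 2) + bracket 1 3 (e 3)
  + bracket 1 4 (\<beta> *s e 4) + bracket 2 3 (t *s e 4)" and M = "\<lambda>t. g3 \<beta>"], goal_cases)
  case 1
  show ?case by (intro poly_curve_intros) (simp_all add: poly_fun_intros)
next
  case (2 t)
  show ?case
    by (rule orbit_g3I[where x = "e 1" and y = "e 2" and z = "e 3"
      and w = "t *s e 4"]) (use 2 assms in \<open>auto simp: curve_simps\<close>)
next
  case 3
  show ?case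
    by (rule orbit_g2I[where x = "e 1" and y = "e 2" and z = "e 3"
      and w = "e 4 + (1/(1 - \<beta>)) *s e 3"]) (use assms in \<open>auto simp: curve_simps\<close>)
qed (use assms in auto)

lemma g4_g2:
  assumes "g4 1 \<beta> \<in> E"
  shows "g2 \<beta> \<in> E"
proof (rule limit[where c = "\<lambda>t. bracket 1 2 (e 2) + bracket 1 3 (t *s e 2 + e 3)
  + bracket 1 4 (e 3 + \<beta> *s e 4)" and M = "\<lambda>t. g4 1 \<beta>"], goal_cases)
  case 1
  show ?case by (intro poly_curve_intros) (simp_all add: poly_fun_intros)
next
  case (2 t)
  show ?case
    by (rule orbit_g4I[where x = "e 1" and y = "t *s e 2" and z = "e 3"
      and w = "e 4"]) (use 2 assms in \<open>auto simp: curve_simps\<close>)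
next
  case 3
  show ?case
    by (rule orbit_g2I[OF _ indep4_axis]) (use assms in \<open>auto simp: curve_simps\<close>)
qed (use assms in auto)

lemma g2_g1:
  assumes "g2 1 \<in> E"
  shows "g1 \<in> E"
proof (rule limit[where c = "\<lambda>t. bracket 1 2 (e 2) + bracket 1 3 (e 3) + bracket 1 4 (t *s e 3
  + e 4)" and M = "\<lambda>t. g2 1"], goal_cases)
  case 1
  show ?case by (intro poly_curve_intros) (simp_all add: poly_fun_intros)
next
  case (2 t)
  show ?case
    by (rule orbit_g2I[where x = "e 1" and y = "e 2" and z = "t *s e 3"
      and w = "e 4"]) (use 2 assms in \<open>auto simp: curve_simps\<close>)
next
  case 3
  show ?case
    by (rule orbit_g1I[OF _ indep4_axis]) (use assms in \<open>auto simp: curve_simps\<close>)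
qed (use assms in auto)

text \<open>The parameter 1/t tends to infinity: rescaling \<open>e 1\<close> turns the eigenvalues
  into t, t, 1, and two of them vanish in the limit.\<close>

lemma g2_r2_C2:
  assumes "\<And>\<beta>. g2 \<beta> \<in> E"
  shows "r2_C2 \<in> E"
proof (rule limit[where c = "\<lambda>t. bracket 1 2 (t *s e 2) + bracket 1 3 (t *s e 3)
  + bracket 1 4 (e 3 + e 4)" and M = "\<lambda>t. g2 (1/t)"], goal_cases)
  case 1
  show ?case by (intro poly_curve_intros) (simp_all add: poly_fun_intros)
next
  case (2 t)
  show ?case
    by (rule orbit_g2I[where x = "(1/t) *s e 1" and y = "e 2" and z = "(1/t) *s e 3"
      and w = "e 4"]) (use 2 assms in \<open>auto simp: curve_simps\<close>)
next
  case 3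
  show ?case
    by (rule orbit_r2_C2I[where x = "e 1" and y = "e 3 + e 4" and z = "e 2"
      and w = "e 3"]) (use assms in \<open>auto simp: curve_simps\<close>)
qed (use assms in auto)

lemma r2_C2_n3_C:
  assumes "r2_C2 \<in> E"
  shows "n3_C \<in> E"
proof (rule limit[where c = "\<lambda>t. bracket 1 2 (e 3 + t *s e 2)" and M = "\<lambda>t. r2_C2"], goal_cases)
  case 1
  show ?case by (intro poly_curve_intros) (simp_all add: poly_fun_intros)
next
  case (2 t)
  show ?case
    by (rule orbit_r2_C2I[where x = "(1/t) *s e 1" and y = "e 3 + t *s e 2" and z = "e 3"
      and w = "e 4"]) (use 2 assms in \<open>auto simp: curve_simps\<close>)
next
  case 3
  show ?case
    by (rule orbit_n3_CI[OF _ indep4_axis]) (use assms in \<open>auto simp: curve_simps\<close>)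
qed (use assms in auto)

text \<open>Again the parameter tends to infinity: \<open>e 4\<close> acts on \<open>e 1\<close>,
  \<open>e 2\<close>, \<open>e 3\<close> with eigenvalues t, t, t - 1, while e1 e2 = e3 is
  kept.\<close>

lemma g3_g6:
  assumes "\<And>\<beta>. g3 \<beta> \<in> E"
  shows "g6 \<in> E"
proof (rule limit[where c = "\<lambda>t. bracket 1 2 (e 3) + bracket 1 4 ((- t) *s e 1)
  + bracket 2 4 ((- t) *s e 2) + bracket 3 4 ((1 - t) *s e 3)" and M = "\<lambda>t. g3 ((t - 1)/t)"], goal_cases)
  case 1
  show ?case by (intro poly_curve_intros) (simp_all add: poly_fun_intros)
next
  case (2 t)
  show ?case
    by (rule orbit_g3I[where x = "(1/t) *s e 4" and y = "e 1" and z = "e 2"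
      and w = "e 3"]) (use 2 assms in \<open>auto simp: curve_simps\<close>)
next
  case 3
  show ?case
    by (rule orbit_g6I[OF _ indep4_axis]) (use assms in \<open>auto simp: curve_simps\<close>)
qed (use assms in auto)

text \<open>Recovers the parameters at which the change of basis of a degeneration breaks
  down.\<close>

lemma g4_family:
  assumes "finite F" "\<And>t. t \<notin> F \<Longrightarrow> g4 t (a * t + b) \<in> E"
  shows "g4 s (a * s + b) \<in> E"
proof (rule closedin_curve[OF closed _ assms(1), where c = "\<lambda>t. g4 t (a * t + b)"])
  show "poly_curve (\<lambda>t. g4 t (a * t + b))"
    unfolding g4_def by (intro poly_curve_intros) (simp_all add: poly_fun_intros)
qed (rule assms(2))

lemma g2_family:
  assumes "finite F" "\<And>t. t \<notin> F \<Longrightarrow> g2 t \<in> E"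
  shows "g2 s \<in> E"
proof (rule closedin_curve[OF closed _ assms(1), where c = g2])
  show "poly_curve g2"
    unfolding g2_def by (intro poly_curve_intros) (simp_all add: poly_fun_intros)
qed (rule assms(2))

end

section \<open>Closed conditions\<close>

definition tr1 :: "'n::finite alg \<Rightarrow> complex ^ 'n \<Rightarrow> complex" where
  "tr1 \<mu> x = trace (ad \<mu> x)"

definition tr2 :: "'n::finite alg \<Rightarrow> complex ^ 'n \<Rightarrow> complex ^ 'n \<Rightarrow> complex" where
  "tr2 \<mu> x y = trace (ad \<mu> x ** ad \<mu> y)"

definition tr3 :: "'n::finite alg \<Rightarrow> complex ^ 'n \<Rightarrow> complex" where
  "tr3 \<mu> x = trace (ad \<mu> x ** ad \<mu> x ** ad \<mu> x)"

definition metabelian :: "'n::finite alg set" where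
  "metabelian = {\<mu>. \<forall>x y z w. mult \<mu> (mult \<mu> x y) (mult \<mu> z w) = 0}"

section \<open>Invariance of the conditions under isomorphism\<close>

lemma trace_conj:
  fixes A :: "complex ^ 'n ^ 'n"
  assumes "invertible g"
  shows "trace (g ** A ** matrix_inv g) = trace A"
proof -
  have "trace (g ** A ** matrix_inv g) = trace (matrix_inv g ** (g ** A))"
    by (rule trace_mul_sym)
  then show ?thesis
    by (simp add: matrix_mul_assoc matrix_inv_mult[OF assms])
qed

lemma conj_mult:
  fixes A B :: "complex ^ 'n ^ 'n"
  assumes "invertible g"
  shows "(g ** A ** matrix_inv g) ** (g ** B ** matrix_inv g) = g ** (A ** B) ** matrix_inv g"
proof -
  have "(g ** A ** matrix_inv g) ** (g ** B ** matrix_inv g)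
      = g ** A ** (matrix_inv g ** g) ** B ** matrix_inv g"
    by (simp only: matrix_mul_assoc)
  then show ?thesis
    by (simp add: matrix_inv_mult[OF assms] matrix_mul_assoc)
qed

lemma iso_ad:
  assumes "iso g \<mu> \<nu>"
  shows "ad \<nu> (g *v x) = g ** ad \<mu> x ** matrix_inv g"
proof -
  have g: "invertible g" "\<And>x y. mult \<nu> (g *v x) (g *v y) = g *v mult \<mu> x y"
    using assms unfolding iso_def by blast+
  have "ad \<nu> (g *v x) *v y = (g ** ad \<mu> x ** matrix_inv g) *v y" for y
    using g(2)[of x "matrix_inv g *v y"]
    by (simp add: ad_mult invertible_inv_mult[OF g(1)] flip: matrix_vector_mul_assoc)
  then show ?thesis
    by (simp add: matrix_eq)
qed

lemma iso_tr:
  assumes "iso g \<mu> \<nu>"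
  shows "tr1 \<nu> (g *v x) = tr1 \<mu> x" "tr2 \<nu> (g *v x) (g *v y) = tr2 \<mu> x y" "tr3 \<nu> (g *v x) = tr3 \<mu> x"
proof -
  have g: "invertible g"
    using assms unfolding iso_def by blast
  show "tr1 \<nu> (g *v x) = tr1 \<mu> x" "tr2 \<nu> (g *v x) (g *v y) = tr2 \<mu> x y" "tr3 \<nu> (g *v x) = tr3 \<mu> x"
    by (simp_all add: tr1_def tr2_def tr3_def iso_ad[OF assms] trace_conj[OF g] conj_mult[OF g])
qed

lemma iso_mult: "iso g \<mu> \<nu> \<Longrightarrow> mult \<nu> (g *v x) (g *v y) = g *v mult \<mu> x y"
  by (simp add: iso_def)

lemma invariantI:
  assumes "\<And>g \<mu> \<nu>. iso g \<mu> \<nu> \<Longrightarrow> \<mu> \<in> E \<Longrightarrow> \<nu> \<in> E"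
  shows "invariant E"
  using assms orbit_iso unfolding invariant_def by blast

lemma invariant_Int: "invariant A \<Longrightarrow> invariant B \<Longrightarrow> invariant (A \<inter> B)"
  unfolding invariant_def by blast

lemma invariant_orbits_subset: "invariant E \<Longrightarrow> orbits M \<subseteq> E \<longleftrightarrow> M \<subseteq> E"
  unfolding invariant_def orbits_def using orbit_refl by blast

lemma iso_alternating:
  assumes "iso g \<mu> \<nu>" "alternating \<mu>"
  shows "alternating \<nu>"
  unfolding alternating_def
proof (intro allI)
  fix x y
  obtain x' y' where xy: "x = g *v x'" "y = g *v y'"
    using iso_surj[OF assms(1)] by blast
  have "mult \<mu> x' y' = - mult \<mu> y' x'"
    using assms(2) unfolding alternating_def by blast
  then show "mult \<nu> x y = - mult \<nu> y x"
    unfolding xy iso_mult[OF assms(1)] by (simp add: vec.neg)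
qed

lemma Lie_iff: "\<mu> \<in> Lie \<longleftrightarrow> alternating \<mu> \<and> (\<forall>x y z. jacobian \<mu> x y z = 0)"
  unfolding Lie_def lie_on_def alternating_def by blast

lemma invariant_Lie: "invariant Lie"
proof (rule invariantI)
  fix g and \<mu> \<nu> :: "'a alg"
  assume iso: "iso g \<mu> \<nu>" and \<mu>: "\<mu> \<in> Lie"
  have "jacobian \<nu> x y z = 0" for x y z
  proof -
    obtain x' y' z' where xyz: "x = g *v x'" "y = g *v y'" "z = g *v z'"
      using iso_surj[OF iso] by metis
    show ?thesis
      unfolding xyz iso_jacobian[OF iso] using \<mu> by (simp add: Lie_iff)
  qed
  then show "\<nu> \<in> Lie"
    using iso_alternating[OF iso] \<mu> by (simp add: Lie_iff)
qed

lemma invariant_binary: "invariant binary"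
proof (rule invariantI)
  fix g and \<mu> \<nu> :: "'a alg"
  assume iso: "iso g \<mu> \<nu>" and \<mu>: "\<mu> \<in> binary"
  have "jacobian \<nu> x y (mult \<nu> x y) = 0" for x y
  proof -
    obtain x' y' where xy: "x = g *v x'" "y = g *v y'"
      using iso_surj[OF iso] by metis
    show ?thesis
      unfolding xy iso_mult[OF iso] iso_jacobian[OF iso] using \<mu> by (simp add: binary_def)
  qed
  then show "\<nu> \<in> binary"
    using iso_alternating[OF iso] \<mu> by (simp add: binary_def)
qed

lemma invariant_metabelian: "invariant metabelian"
proof (rule invariantI)
  fix g and \<mu> \<nu> :: "'a alg"
  assume iso: "iso g \<mu> \<nu>" and \<mu>: "\<mu> \<in> metabelian"
  have "mult \<nu> (mult \<nu> x y) (mult \<nu> z w) = 0" for x y z w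
  proof -
    obtain x' y' z' w' where xyz: "x = g *v x'" "y = g *v y'" "z = g *v z'" "w = g *v w'"
      using iso_surj[OF iso] by metis
    show ?thesis
      unfolding xyz iso_mult[OF iso] using \<mu> by (simp add: metabelian_def)
  qed
  then show "\<nu> \<in> metabelian"
    by (simp add: metabelian_def)
qed

lemma invariant_tr:
  assumes "\<And>\<mu>. \<mu> \<in> E \<longleftrightarrow> (\<forall>x. P (tr1 \<mu> x) (tr2 \<mu> x x) (tr3 \<mu> x))"
  shows "invariant E"
proof (rule invariantI)
  fix g and \<mu> \<nu> :: "'a alg"
  assume iso: "iso g \<mu> \<nu>" and \<mu>: "\<mu> \<in> E"
  have "P (tr1 \<nu> x) (tr2 \<nu> x x) (tr3 \<nu> x)" for x
  proof -
    obtain x' where x: "x = g *v x'"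
      using iso_surj[OF iso] by metis
    show ?thesis
      unfolding x iso_tr[OF iso] using \<mu> assms by blast
  qed
  then show "\<nu> \<in> E"
    using assms by blast
qed

section \<open>Closedness of the conditions\<close>

lemma closedin_polyI2:
  assumes "\<And>a b. p a b \<in> poly_functions"
  shows "closedin zariski {\<mu>. \<forall>a b. p a b \<mu> = 0}"
  using closedin_polyI[of "\<lambda>(a, b). p a b"] assms by auto

lemma closedin_polyI3:
  assumes "\<And>a b c. p a b c \<in> poly_functions"
  shows "closedin zariski {\<mu>. \<forall>a b c. p a b c \<mu> = 0}"
  using closedin_polyI[of "\<lambda>(a, b, c). p a b c"] assms by auto

lemma closedin_polyI4:
  assumes "\<And>a b c d. p a b c d \<in> poly_functions"
  shows "closedin zariski {\<mu>. \<forall>a b c d. p a b c d \<mu> = 0}"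
  using closedin_polyI[of "\<lambda>(a, b, c, d). p a b c d"] assms by auto

lemma closedin_polyI5:
  assumes "\<And>a b c d k. p a b c d k \<in> poly_functions"
  shows "closedin zariski {\<mu>. \<forall>a b c d k. p a b c d k \<mu> = 0}"
  using closedin_polyI[of "\<lambda>(a, b, c, d, k). p a b c d k"] assms by auto

lemma poly_functions_jacobian:
  assumes "\<And>k. (\<lambda>\<mu>. X \<mu> $ k) \<in> poly_functions" "\<And>k. (\<lambda>\<mu>. Y \<mu> $ k) \<in> poly_functions"
    "\<And>k. (\<lambda>\<mu>. Z \<mu> $ k) \<in> poly_functions"
  shows "(\<lambda>\<mu>. jacobian \<mu> (X \<mu>) (Y \<mu>) (Z \<mu>) $ k) \<in> poly_functions"
  unfolding jacobian_def by (simp, intro poly_functions_intros poly_functions_mult assms)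

lemma poly_functions_ad:
  assumes "\<And>k. (\<lambda>\<mu>. X \<mu> $ k) \<in> poly_functions"
  shows "(\<lambda>\<mu>. ad \<mu> (X \<mu>) $ i $ j) \<in> poly_functions"
  unfolding ad_def by (simp, intro poly_functions_mult assms poly_functions.const)

lemma poly_functions_tr1:
  assumes "\<And>k. (\<lambda>\<mu>. X \<mu> $ k) \<in> poly_functions"
  shows "(\<lambda>\<mu>. tr1 \<mu> (X \<mu>)) \<in> poly_functions"
  unfolding tr1_def trace_def by (intro poly_functions_sum poly_functions_ad assms)

lemma poly_functions_tr2:
  assumes "\<And>k. (\<lambda>\<mu>. X \<mu> $ k) \<in> poly_functions" "\<And>k. (\<lambda>\<mu>. Y \<mu> $ k) \<in> poly_functions"
  shows "(\<lambda>\<mu>. tr2 \<mu> (X \<mu>) (Y \<mu>)) \<in> poly_functions"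
  unfolding tr2_def trace_def matrix_matrix_mult_def
  by (simp, intro poly_functions_sum poly_functions_intros poly_functions_ad assms)

lemma poly_functions_tr3:
  assumes "\<And>k. (\<lambda>\<mu>. X \<mu> $ k) \<in> poly_functions"
  shows "(\<lambda>\<mu>. tr3 \<mu> (X \<mu>)) \<in> poly_functions"
  unfolding tr3_def trace_def matrix_matrix_mult_def
  by (simp, intro poly_functions_sum poly_functions_intros poly_functions_ad assms)

lemmas poly_functions_tr = poly_functions_tr1 poly_functions_tr2 poly_functions_tr3

lemma tr_mult:
  "tr1 \<mu> x = (\<Sum>i\<in>UNIV. mult \<mu> x (axis i 1) $ i)"
  "tr2 \<mu> x y = (\<Sum>i\<in>UNIV. mult \<mu> x (mult \<mu> y (axis i 1)) $ i)"
  "tr3 \<mu> x = (\<Sum>i\<in>UNIV. mult \<mu> x (mult \<mu> x (mult \<mu> x (axis i 1))) $ i)"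
proof -
  have "A $ i $ i = (A *v axis i 1) $ i" for A :: "complex ^ 'a ^ 'a" and i
    by (simp add: matrix_vector_mult_def axis_def if_distrib cong: if_cong)
  then show "tr1 \<mu> x = (\<Sum>i\<in>UNIV. mult \<mu> x (axis i 1) $ i)"
    "tr2 \<mu> x y = (\<Sum>i\<in>UNIV. mult \<mu> x (mult \<mu> y (axis i 1)) $ i)"
    "tr3 \<mu> x = (\<Sum>i\<in>UNIV. mult \<mu> x (mult \<mu> x (mult \<mu> x (axis i 1))) $ i)"
    unfolding tr1_def tr2_def tr3_def trace_def
    by (simp_all add: ad_mult flip: matrix_vector_mul_assoc)
qed

lemma closedin_alternating: "closedin zariski {\<mu>. alternating \<mu>}"
proof -
  have "{\<mu> :: 'a alg. alternating \<mu>} = {\<mu>. \<forall>x y k. mult \<mu> x y $ k + mult \<mu> y x $ k = 0}"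
    unfolding alternating_def by (auto simp: vec_eq_iff eq_neg_iff_add_eq_0)
  also have "closedin zariski \<dots>"
    by (intro closedin_polyI3 poly_functions_intros poly_functions_mult)
  finally show ?thesis .
qed

lemma closedin_Lie: "closedin zariski Lie"
proof -
  have "Lie = {\<mu>. alternating \<mu>} \<inter> {\<mu> :: 'a alg. \<forall>x y z k. jacobian \<mu> x y z $ k = 0}"
    by (auto simp: Lie_iff vec_eq_iff)
  also have "closedin zariski \<dots>"
    by (intro closedin_Int closedin_alternating closedin_polyI4 poly_functions_jacobian poly_functions.const)
  finally show ?thesis .
qed

lemma closedin_binary: "closedin zariski binary"
proof -
  have "binary = {\<mu>. alternating \<mu>} \<inter> {\<mu> :: 'a alg. \<forall>x y k. jacobian \<mu> x y (mult \<mu> x y) $ k = 0}"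
    by (auto simp: binary_def vec_eq_iff)
  also have "closedin zariski \<dots>"
    by (intro closedin_Int closedin_alternating closedin_polyI3 poly_functions_jacobian
        poly_functions_mult poly_functions.const)
  finally show ?thesis .
qed

lemma closedin_metabelian: "closedin zariski metabelian"
proof -
  have "metabelian = {\<mu> :: 'a alg. \<forall>x y z w k. mult \<mu> (mult \<mu> x y) (mult \<mu> z w) $ k = 0}"
    by (auto simp: metabelian_def vec_eq_iff)
  also have "closedin zariski \<dots>"
    by (intro closedin_polyI5 poly_functions_mult poly_functions.const)
  finally show ?thesis .
qed

text \<open>If \<open>ad x\<close> has eigenvalues \<open>0, a, b, c\<close>, the cubic in \<open>K2\<close> is \<open>6abc\<close> and the one in \<open>K3\<close> is
  \<open>3(a + b - c)(b + c - a)(c + a - b)\<close>. The determinant in \<open>K5\<close> vanishes iff no \<open>ad x\<close> acts cyclically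
  on the quotient of the algebra by the line of \<open>x\<close>.\<close>

definition K1 :: "4 alg set" where
  "K1 = Lie \<inter> {\<mu>. \<forall>x. tr1 \<mu> x = 0} \<inter> {\<mu>. \<forall>x. tr3 \<mu> x = 0}"

text \<open>The cubic also holds on \<open>sl2_C\<close> and \<open>g5 (- 1)\<close>, where the
  traces in it vanish; \<open>metabelian\<close> excludes both.\<close>

definition K2 :: "4 alg set" where
  "K2 = Lie \<inter> metabelian \<inter> {\<mu>. \<forall>x. tr1 \<mu> x ^ 3 - 3 * tr1 \<mu> x * tr2 \<mu> x x + 2 * tr3 \<mu> x = 0}"

text \<open>The condition on \<open>tr2\<close> is Cartan's criterion, a polynomial form of
  solvability; it excludes \<open>sl2_C\<close>.\<close>

definition K3 :: "4 alg set" where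
  "K3 = Lie \<inter> {\<mu>. \<forall>x y z. tr2 \<mu> x (mult \<mu> y z) = 0}
     \<inter> {\<mu>. \<forall>x. 6 * tr1 \<mu> x * tr2 \<mu> x x - tr1 \<mu> x ^ 3 - 8 * tr3 \<mu> x = 0}"

text \<open>If some \<open>x\<close> has nonzero trace, taking \<open>y\<close>, \<open>z\<close> of
  trace zero gives yz = 0: the kernel of the trace is abelian. For unimodular algebras the last
  condition is empty and \<open>metabelian\<close> does the work.\<close>

definition K4 :: "4 alg set" where
  "K4 = Lie \<inter> metabelian \<inter> {\<mu>. \<forall>x y z k. tr1 \<mu> z * mult \<mu> x y $ k + tr1 \<mu> x * mult \<mu> y z $ k
     + tr1 \<mu> y * mult \<mu> z x $ k = 0}"

definition K5 :: "4 alg set" where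
  "K5 = binary \<inter> {\<mu>. \<forall>x y. det (basis_matrix x y (mult \<mu> x y) (mult \<mu> x (mult \<mu> x y))) = 0}"

lemma closedin_K: "closedin zariski K1" "closedin zariski K2" "closedin zariski K3"
  "closedin zariski K4"
  unfolding K1_def K2_def K3_def K4_def
  by (intro closedin_Int closedin_Lie closedin_metabelian closedin_polyI closedin_polyI3 closedin_polyI4
      poly_functions_intros poly_functions_tr poly_functions_mult)+

lemma closedin_K5: "closedin zariski K5"
proof -
  have "(\<lambda>\<mu> :: 4 alg. basis_matrix x y (mult \<mu> x y) (mult \<mu> x (mult \<mu> x y)) $ i $ j) \<in> poly_functions"
    for x y i j
  proof -
    have "(\<lambda>\<mu> :: 4 alg. mult \<mu> x y $ i) \<in> poly_functions" "(\<lambda>\<mu> :: 4 alg. mult \<mu> x (mult \<mu> x y) $ i) \<in> poly_functions"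
      by (intro poly_functions_mult poly_functions.const)+
    then show ?thesis
      using exhaust_4[of j] by (auto simp: basis_matrix_def poly_functions.const)
  qed
  then show ?thesis
    unfolding K5_def det_def
    by (intro closedin_Int closedin_binary closedin_polyI2 poly_functions_sum poly_functions_prod
        poly_functions_intros)
qed

lemma invariant_K: "invariant K1" "invariant K2" "invariant K3" "invariant K4" "invariant K5"
proof -
  have "invariant {\<mu> :: 4 alg. \<forall>x. tr1 \<mu> x = 0}"
    by (rule invariant_tr[where P = "\<lambda>a b c. a = 0"]) simp
  moreover have "invariant {\<mu> :: 4 alg. \<forall>x. tr3 \<mu> x = 0}"
    by (rule invariant_tr[where P = "\<lambda>a b c. c = 0"]) simp
  ultimately show "invariant K1"
    unfolding K1_def by (intro invariant_Int invariant_Lie)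
  have "invariant {\<mu> :: 4 alg. \<forall>x. tr1 \<mu> x ^ 3 - 3 * tr1 \<mu> x * tr2 \<mu> x x + 2 * tr3 \<mu> x = 0}"
    by (rule invariant_tr[where P = "\<lambda>a b c. a ^ 3 - 3 * a * b + 2 * c = 0"]) simp
  then show "invariant K2"
    unfolding K2_def by (intro invariant_Int invariant_Lie invariant_metabelian)
  have "invariant {\<mu> :: 4 alg. \<forall>x. 6 * tr1 \<mu> x * tr2 \<mu> x x - tr1 \<mu> x ^ 3 - 8 * tr3 \<mu> x = 0}"
    by (rule invariant_tr[where P = "\<lambda>a b c. 6 * a * b - a ^ 3 - 8 * c = 0"]) simp
  moreover have "invariant {\<mu> :: 4 alg. \<forall>x y z. tr2 \<mu> x (mult \<mu> y z) = 0}"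
  proof (rule invariantI, clarify)
    fix g x y z and \<mu> \<nu> :: "4 alg"
    assume iso: "iso g \<mu> \<nu>" and \<mu>: "\<forall>x y z. tr2 \<mu> x (mult \<mu> y z) = 0"
    obtain x' y' z' where xyz: "x = g *v x'" "y = g *v y'" "z = g *v z'"
      using iso_surj[OF iso] by metis
    show "tr2 \<nu> x (mult \<nu> y z) = 0"
      unfolding xyz iso_mult[OF iso] iso_tr[OF iso] using \<mu> by blast
  qed
  ultimately show "invariant K3"
    unfolding K3_def by (intro invariant_Int invariant_Lie)
  have "invariant {\<mu> :: 4 alg. \<forall>x y z k. tr1 \<mu> z * mult \<mu> x y $ k + tr1 \<mu> x * mult \<mu> y z $ k
     + tr1 \<mu> y * mult \<mu> z x $ k = 0}"
  proof (rule invariantI, clarify)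
    fix g x y z k and \<mu> \<nu> :: "4 alg"
    assume iso: "iso g \<mu> \<nu>" and \<mu>: "\<forall>x y z k. tr1 \<mu> z * mult \<mu> x y $ k + tr1 \<mu> x * mult \<mu> y z $ k
     + tr1 \<mu> y * mult \<mu> z x $ k = 0"
    obtain x' y' z' where xyz: "x = g *v x'" "y = g *v y'" "z = g *v z'"
      using iso_surj[OF iso] by metis
    have "tr1 \<mu> z' *s mult \<mu> x' y' + tr1 \<mu> x' *s mult \<mu> y' z' + tr1 \<mu> y' *s mult \<mu> z' x' = 0"
      using \<mu> by (simp add: vec_eq_iff)
    then have "g *v (tr1 \<mu> z' *s mult \<mu> x' y' + tr1 \<mu> x' *s mult \<mu> y' z' + tr1 \<mu> y' *s mult \<mu> z' x') = 0"
      by simp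
    then show "tr1 \<nu> z * mult \<nu> x y $ k + tr1 \<nu> x * mult \<nu> y z $ k + tr1 \<nu> y * mult \<nu> z x $ k = 0"
      unfolding xyz iso_mult[OF iso] iso_tr[OF iso] vec.add vec.scale by (simp add: vec_eq_iff)
  qed
  then show "invariant K4"
    unfolding K4_def by (intro invariant_Int invariant_Lie invariant_metabelian)
  have "invariant {\<mu> :: 4 alg. \<forall>x y. det (basis_matrix x y (mult \<mu> x y) (mult \<mu> x (mult \<mu> x y))) = 0}"
  proof (rule invariantI, clarify)
    fix g x y and \<mu> \<nu> :: "4 alg"
    assume iso: "iso g \<mu> \<nu>"
      and \<mu>: "\<forall>x y. det (basis_matrix x y (mult \<mu> x y) (mult \<mu> x (mult \<mu> x y))) = 0"
    obtain x' y' where xy: "x = g *v x'" "y = g *v y'"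
      using iso_surj[OF iso] by metis
    have "basis_matrix (g *v a) (g *v b) (g *v c) (g *v d) = g ** basis_matrix a b c d" for a b c d
      by (simp add: matrix_eq basis_matrix_mult vec.add vec.scale flip: matrix_vector_mul_assoc)
    then show "det (basis_matrix x y (mult \<nu> x y) (mult \<nu> x (mult \<nu> x y))) = 0"
      unfolding xy iso_mult[OF iso] using \<mu> by (simp add: det_mul)
  qed
  then show "invariant K5"
    unfolding K5_def by (intro invariant_Int invariant_binary)
qed

section \<open>Evaluating the conditions on the list\<close>

lemma Lie_basisI:
  fixes \<mu> :: "4 alg"
  assumes "alternating \<mu>" "jacobian \<mu> (e 1) (e 2) (e 3) = 0" "jacobian \<mu> (e 1) (e 2) (e 4) = 0"
    "jacobian \<mu> (e 1) (e 3) (e 4) = 0" "jacobian \<mu> (e 2) (e 3) (e 4) = 0"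
  shows "\<mu> \<in> Lie"
  using assms jacobian_basis by (simp add: Lie_iff)

lemmas model_mult = mult_plus mult_bracket axis_def

lemma generic_Lie: "sl2_C \<in> Lie" "r2_r2 \<in> Lie" "g5 \<alpha> \<in> Lie" "g4 \<alpha> \<beta> \<in> Lie"
proof -
  show "sl2_C \<in> Lie"
    by (rule Lie_basisI[OF alternating_sl2_C])
      (simp_all add: jacobian_def sl2_C_def model_mult vec_eq_iff forall_4)
  show "r2_r2 \<in> Lie"
    by (rule Lie_basisI[OF alternating_r2_r2])
      (simp_all add: jacobian_def r2_r2_def model_mult vec_eq_iff forall_4)
  show "g5 \<alpha> \<in> Lie"
    by (rule Lie_basisI[OF alternating_g5])
      (simp_all add: jacobian_def g5_def model_mult vec_eq_iff forall_4 algebra_simps)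
  show "g4 \<alpha> \<beta> \<in> Lie"
    by (rule Lie_basisI[OF alternating_g4])
      (simp_all add: jacobian_def g4_def model_mult vec_eq_iff forall_4 algebra_simps)
qed

lemmas tr_eval = tr_mult sum_4 model_mult

lemma sl2_C_in_K1: "sl2_C \<in> K1"
  by (simp add: K1_def generic_Lie) (simp add: tr_eval sl2_C_def algebra_simps)

lemma r2_r2_in_K2: "r2_r2 \<in> K2"
  by (simp add: K2_def generic_Lie metabelian_def)
    (simp add: tr_eval r2_r2_def vec_eq_iff forall_4 power3_eq_cube algebra_simps)

lemma g5_in_K3: "g5 \<alpha> \<in> K3"
  by (simp add: K3_def generic_Lie) (simp add: tr_eval g5_def power3_eq_cube algebra_simps)

lemma g4_in_K4: "g4 \<alpha> \<beta> \<in> K4"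
  by (simp add: K4_def generic_Lie metabelian_def)
    (simp add: tr_eval g4_def vec_eq_iff forall_4 algebra_simps)

text \<open>In the models with parameters \<open>e 1\<close> carries them, so most tests only need
  the power sums of its eigenvalues.\<close>

lemma tr_e1:
  "tr1 sl2_C (e 1) = 0" "tr2 sl2_C (e 1) (e 1) = 2" "tr3 sl2_C (e 1) = 0"
  "tr1 r2_r2 (e 1) = 1" "tr2 r2_r2 (e 1) (e 1) = 1" "tr3 r2_r2 (e 1) = 1"
  "tr1 r2_C2 (e 1) = 1" "tr2 r2_C2 (e 1) (e 1) = 1" "tr3 r2_C2 (e 1) = 1"
  "tr1 g1 (e 1) = 3" "tr2 g1 (e 1) (e 1) = 3" "tr3 g1 (e 1) = 3"
  "tr1 (g2 \<beta>) (e 1) = 2 + \<beta>" "tr2 (g2 \<beta>) (e 1) (e 1) = 2 + \<beta>\<^sup>2" "tr3 (g2 \<beta>) (e 1) = 2 + \<beta> ^ 3"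
  "tr1 (g3 \<beta>) (e 1) = 2 + \<beta>" "tr2 (g3 \<beta>) (e 1) (e 1) = 2 + \<beta>\<^sup>2" "tr3 (g3 \<beta>) (e 1) = 2 + \<beta> ^ 3"
  "tr1 (g4 \<alpha> \<beta>) (e 1) = 1 + \<alpha> + \<beta>" "tr2 (g4 \<alpha> \<beta>) (e 1) (e 1) = 1 + \<alpha>\<^sup>2 + \<beta>\<^sup>2"
  "tr3 (g4 \<alpha> \<beta>) (e 1) = 1 + \<alpha> ^ 3 + \<beta> ^ 3"
  "tr1 (g5 \<alpha>) (e 1) = 2 * (1 + \<alpha>)" "tr2 (g5 \<alpha>) (e 1) (e 1) = 1 + \<alpha>\<^sup>2 + (1 + \<alpha>)\<^sup>2"
  "tr3 (g5 \<alpha>) (e 1) = 1 + \<alpha> ^ 3 + (1 + \<alpha>) ^ 3"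
  by (simp_all add: tr_eval model_defs power2_eq_square power3_eq_cube algebra_simps)

lemma det_basis_matrix_nz: "indep4 x y z w \<Longrightarrow> det (basis_matrix x y z w) \<noteq> 0"
  using invertible_basis_matrix invertible_det_nz by blast

lemma not_K5I: "indep4 x y (mult \<mu> x y) (mult \<mu> x (mult \<mu> x y)) \<Longrightarrow> \<mu> \<notin> K5"
  unfolding K5_def using det_basis_matrix_nz by blast

lemma det_basis_matrix_eq_0:
  assumes "basis_matrix x y z w *v c = 0" "c \<noteq> 0"
  shows "det (basis_matrix x y z w) = 0"
proof (rule ccontr)
  assume "det (basis_matrix x y z w) \<noteq> 0"
  then have "invertible (basis_matrix x y z w)"
    using invertible_det_nz by blast
  then have "c = matrix_inv (basis_matrix x y z w) *v (basis_matrix x y z w *v c)"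
    by (simp add: invertible_inv_mult(2))
  then show False
    using assms by simp
qed

section \<open>Binary Lie algebras\<close>

lemma Lie_subset_BL: "Lie \<subseteq> BL"
  unfolding Lie_def BL_def lie_on_def by blast

lemma BL_subset_binary: "BL \<subseteq> binary"
proof
  fix \<mu> :: "'a alg"
  assume \<mu>: "\<mu> \<in> BL"
  have lie: "lie_on \<mu> (subalgebra \<mu> hull {x, y})" for x y
    using \<mu> by (simp add: BL_def)
  have in_hull: "x \<in> subalgebra \<mu> hull {x, y}" "y \<in> subalgebra \<mu> hull {x, y}" for x y
    by (simp_all add: hull_inc)
  have "subalgebra \<mu> (subalgebra \<mu> hull {x, y})" for x y
    by (rule hull_in) (auto simp: subalgebra_def intro: vec.subspace_Inter)
  then have "mult \<mu> x y \<in> subalgebra \<mu> hull {x, y}" for x y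
    using in_hull unfolding subalgebra_def by blast
  then have "jacobian \<mu> x y (mult \<mu> x y) = 0" "mult \<mu> x y = - mult \<mu> y x" for x y
    using lie[of x y] in_hull unfolding lie_on_def by blast+
  then show "\<mu> \<in> binary"
    unfolding binary_def alternating_def by blast
qed

lemma lie_on_subset: "lie_on \<mu> S \<Longrightarrow> T \<subseteq> S \<Longrightarrow> lie_on \<mu> T"
  unfolding lie_on_def by (meson subsetD)

lemma invariant_BL: "invariant BL"
proof (rule invariantI)
  fix g and \<mu> \<nu> :: "'a alg"
  assume iso: "iso g \<mu> \<nu>" and \<mu>: "\<mu> \<in> BL"
  show "\<nu> \<in> BL"
    unfolding BL_def
  proof (intro CollectI allI)
    fix x y
    obtain x' y' where xy: "x = g *v x'" "y = g *v y'"
      using iso_surj[OF iso] by metis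
    define S where "S = subalgebra \<mu> hull {x', y'}"
    have S: "subalgebra \<mu> S"
      unfolding S_def by (rule hull_in) (auto simp: subalgebra_def intro: vec.subspace_Inter)
    have "subalgebra \<nu> ((*v) g ` S)"
      using S unfolding subalgebra_def
      by (auto simp: iso_mult[OF iso] intro!: vec.subspace_image)
    moreover have "{x, y} \<subseteq> (*v) g ` S"
      unfolding xy S_def by (auto simp: hull_inc)
    ultimately have hull: "subalgebra \<nu> hull {x, y} \<subseteq> (*v) g ` S"
      by (intro hull_minimal)
    have "lie_on \<mu> S"
      using \<mu> by (simp add: BL_def S_def)
    then have S_lie: "\<And>p q. p \<in> S \<Longrightarrow> q \<in> S \<Longrightarrow> mult \<mu> p q = - mult \<mu> q p"
      "\<And>p q r. p \<in> S \<Longrightarrow> q \<in> S \<Longrightarrow> r \<in> S \<Longrightarrow> jacobian \<mu> p q r = 0"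
      unfolding lie_on_def by blast+
    have "lie_on \<nu> ((*v) g ` S)"
      unfolding lie_on_def
    proof (intro conjI ballI; elim imageE; clarify)
      fix p q
      assume "p \<in> S" "q \<in> S"
      then show "mult \<nu> (g *v p) (g *v q) = - mult \<nu> (g *v q) (g *v p)"
        unfolding iso_mult[OF iso] by (subst S_lie(1)) (simp_all add: vec.neg)
    next
      fix p q r
      assume "p \<in> S" "q \<in> S" "r \<in> S"
      then show "jacobian \<nu> (g *v p) (g *v q) (g *v r) = 0"
        unfolding iso_jacobian[OF iso] by (simp add: S_lie(2))
    qed
    then show "lie_on \<nu> (subalgebra \<nu> hull {x, y})"
      by (rule lie_on_subset[OF _ hull])
  qed
qed

text \<open>If all products \<open>xy\<close> lie in the span of \<open>x\<close>, \<open>y\<close> and a fixed vector \<open>v\<close>, the subalgebra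
  generated by \<open>x\<close> and \<open>y\<close> lies in that span, where only the Jacobian of \<open>x, y, v\<close> matters.\<close>

lemma BL_I:
  assumes alt: "alternating \<mu>" and prod: "\<And>x y. \<exists>a b c. mult \<mu> x y = a *s x + b *s y + c *s v"
    and jac: "\<And>x y. jacobian \<mu> x y v = 0"
  shows "\<mu> \<in> BL"
  unfolding BL_def
proof (intro CollectI allI)
  fix x y
  define S where "S = {a *s x + b *s y + c *s v |a b c. True}"
  have S_add: "p + q \<in> S" if pq: "p \<in> S" "q \<in> S" for p q
  proof -
    obtain a b c a' b' c' where "p = a *s x + b *s y + c *s v" "q = a' *s x + b' *s y + c' *s v"
      using pq unfolding S_def by blast
    then have "p + q = (a + a') *s x + (b + b') *s y + (c + c') *s v"
      by (simp add: vec_eq_iff algebra_simps)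
    then show ?thesis
      unfolding S_def by blast
  qed
  have S_scale: "r *s p \<in> S" if p: "p \<in> S" for p r
  proof -
    obtain a b c where "p = a *s x + b *s y + c *s v"
      using p unfolding S_def by blast
    then have "r *s p = (r * a) *s x + (r * b) *s y + (r * c) *s v"
      by (simp add: vec_eq_iff algebra_simps)
    then show ?thesis
      unfolding S_def by blast
  qed
  have "x = 1 *s x + 0 *s y + 0 *s v" "y = 0 *s x + 1 *s y + 0 *s v" "v = 0 *s x + 0 *s y + 1 *s v"
    "0 = 0 *s x + 0 *s y + 0 *s v"
    by simp_all
  then have mem: "x \<in> S" "y \<in> S" "v \<in> S" "0 \<in> S"
    unfolding S_def by blast+
  have "mult \<mu> p q \<in> S" if "p \<in> S" "q \<in> S" for p q
  proof -
    obtain a b c where "mult \<mu> p q = a *s p + b *s q + c *s v"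
      using prod by blast
    then show ?thesis
      using that S_add S_scale mem(3) by simp
  qed
  then have "subalgebra \<mu> S"
    unfolding subalgebra_def by (intro conjI vec.subspaceI ballI S_add S_scale mem(4))
  then have "subalgebra \<mu> hull {x, y} \<subseteq> S"
    using hull_minimal[of "{x, y}" S "subalgebra \<mu>"] mem by blast
  moreover have "jacobian \<mu> p q r = 0" if S: "p \<in> S" "q \<in> S" "r \<in> S" for p q r
  proof -
    have swap: "jacobian \<mu> a v b = 0" "jacobian \<mu> v a b = 0" for a b
      by (simp_all add: jacobian_swap(2)[OF alt, of a v b] jacobian_perm(2)[OF alt, of v a b] jac)
    obtain a b c where p: "p = a *s x + b *s y + c *s v"
      using S(1) unfolding S_def by blast
    obtain a' b' c' where q: "q = a' *s x + b' *s y + c' *s v"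
      using S(2) unfolding S_def by blast
    obtain a'' b'' c'' where r: "r = a'' *s x + b'' *s y + c'' *s v"
      using S(3) unfolding S_def by blast
    have 1: "jacobian \<mu> p x y = 0" "jacobian \<mu> p y x = 0"
      unfolding p by (simp_all add: jacobian_linear jacobian_eq[OF alt] swap)
    have 2: "jacobian \<mu> p q x = 0" "jacobian \<mu> p q y = 0"
      unfolding q by (simp_all add: jacobian_linear jacobian_eq[OF alt] swap 1)
    show ?thesis
      unfolding r by (simp add: jacobian_linear jac 2)
  qed
  ultimately show "lie_on \<mu> (subalgebra \<mu> hull {x, y})"
    using alt unfolding lie_on_def alternating_def by blast
qed

lemma g3_in_BL: "g3 \<beta> \<in> BL"
proof (rule BL_I[OF alternating_g3])
  show "\<exists>a b c. mult (g3 \<beta>) x y = a *s x + b *s y + c *s e 4" for x y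
    by (rule exI[of _ "- y $ 1"], rule exI[of _ "x $ 1"],
        rule exI[of _ "(\<beta> - 1) * (x $ 1 * y $ 4 - x $ 4 * y $ 1) + (x $ 2 * y $ 3 - x $ 3 * y $ 2)"])
      (simp add: g3_def model_mult vec_eq_iff forall_4 algebra_simps)
  show "jacobian (g3 \<beta>) x y (e 4) = 0" for x y
    by (simp add: jacobian_def g3_def model_mult vec_eq_iff forall_4 algebra_simps)
qed

lemma g6_in_BL: "g6 \<in> BL"
proof (rule BL_I[OF alternating_g6])
  show "\<exists>a b c. mult g6 x y = a *s x + b *s y + c *s e 3" for x y
    by (rule exI[of _ 0], rule exI[of _ 0],
        rule exI[of _ "(x $ 1 * y $ 2 - x $ 2 * y $ 1) + (x $ 3 * y $ 4 - x $ 4 * y $ 3)"])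
      (simp add: g6_def model_mult vec_eq_iff forall_4 algebra_simps)
  show "jacobian g6 x y (e 3) = 0" for x y
    by (simp add: jacobian_def g6_def model_mult vec_eq_iff forall_4 algebra_simps)
qed

text \<open>Members of \<open>binary\<close> that are not Lie are isomorphic to some
  \<open>g3\<close> or to \<open>g6\<close>, where two-generated subalgebras can be
  inspected.\<close>

lemma BL_eq_binary: "(BL :: 4 alg set) = binary"
proof
  have "orbits nonlie_models \<subseteq> BL"
    unfolding invariant_orbits_subset[OF invariant_BL] nonlie_models_def
    using g3_in_BL g6_in_BL by blast
  then show "(binary :: 4 alg set) \<subseteq> BL"
    using nonlie_classification Lie_subset_BL by blast
qed (rule BL_subset_binary)

section \<open>The five closed sets\<close>

definition L1 :: "4 alg set" where
  "L1 = {sl2_C, g5 (-1), g4 (-1) 0, n4, n3_C, C4}"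

definition L2 :: "4 alg set" where
  "L2 = {r2_r2, g5 0, g2 0, r2_C2, n4, n3_C, C4} \<union> (\<Union>\<alpha>. {g4 \<alpha> 0})"

definition L3 :: "4 alg set" where
  "L3 = (\<Union>\<alpha>. {g5 \<alpha>, g4 \<alpha> (\<alpha> + 1)}) \<union> {g2 0, g2 2, g3 2, n4, n3_C, C4}"

definition L4 :: "4 alg set" where
  "L4 = (\<Union>\<alpha>. \<Union>\<beta>. {g4 \<alpha> \<beta>, g2 \<beta>}) \<union> {r2_C2, n4, n3_C, g1, C4}"

definition L5 :: "4 alg set" where
  "L5 = (\<Union>\<beta>. {g3 \<beta>, g2 \<beta>}) \<union> {g6, r2_C2, n3_C, g1, C4}"

lemma Lie_models_cases [consumes 1, case_names sl2_C r2_r2 n4 n3_C C4 r2_C2 g1 g2 g4 g3 g5]: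
  assumes "\<mu> \<in> Lie_models"
  obtains "\<mu> = sl2_C" | "\<mu> = r2_r2" | "\<mu> = n4" | "\<mu> = n3_C" | "\<mu> = C4" | "\<mu> = r2_C2" | "\<mu> = g1"
    | \<beta> where "\<mu> = g2 \<beta>" | \<alpha> \<beta> where "\<mu> = g4 \<alpha> \<beta>" | "\<mu> = g3 2" | \<alpha> where "\<mu> = g5 \<alpha>"
  using assms unfolding Lie_models_def abelian_models_def heisenberg_models_def by blast

lemma in_orbits: "\<mu> \<in> L \<Longrightarrow> \<mu> \<in> orbits L"
  using orbit_refl unfolding orbits_def by blast

lemma orbits_orbit: "\<mu> \<in> orbit \<nu> \<Longrightarrow> \<nu> \<in> L \<Longrightarrow> \<mu> \<in> orbits L"
  unfolding orbits_def by blast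

text \<open>A triangularisation with the last two eigenvalues exchanged. With
  \<open>g4_scale\<close>, which makes another eigenvalue the unit, it generates the permutations of
  1 : \<alpha> : \<beta>.\<close>

lemma g4_swap: "g4 \<alpha> \<beta> \<in> orbit (g4 \<beta> \<alpha>)"
proof -
  have "indep4 (e 1) (e 2) (e 3 + (\<beta> - \<alpha>) *s e 4) (e 4)"
    by (simp add: indep4_def vec_eq_iff forall_4 axis_def)
  then have "g4 \<alpha> \<beta> \<in> orbit (g4 (\<beta> / 1) (\<alpha> / 1))"
    by (rule abelian_triangular[OF alternating_g4])
      (simp_all add: g4_def model_mult vec_eq_iff forall_4 algebra_simps)
  then show ?thesis
    by simp
qed

lemma g4_scale:
  assumes "\<alpha> \<noteq> 0"
  shows "g4 \<alpha> \<beta> \<in> orbit (g4 (1 / \<alpha>) (\<beta> / \<alpha>))"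
proof -
  have "indep4 (e 1) (e 2 + (\<alpha> - 1) *s e 3) (e 3) (e 4)"
    by (simp add: indep4_def vec_eq_iff forall_4 axis_def)
  then show ?thesis
    by (rule abelian_triangular[OF alternating_g4])
      (use assms in \<open>simp_all add: g4_def model_mult vec_eq_iff forall_4 algebra_simps\<close>)
qed

lemma K_E1:
  assumes "\<mu> \<in> K1"
  shows "tr1 \<mu> (e 1) = 0" "tr3 \<mu> (e 1) = 0"
  using assms unfolding K1_def by blast+

lemma K_E2:
  assumes "\<mu> \<in> K2"
  shows "tr1 \<mu> (e 1) ^ 3 - 3 * tr1 \<mu> (e 1) * tr2 \<mu> (e 1) (e 1) + 2 * tr3 \<mu> (e 1) = 0"
    "mult \<mu> (mult \<mu> x y) (mult \<mu> z w) = 0"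
  using assms unfolding K2_def metabelian_def by blast+

lemma K_E3:
  assumes "\<mu> \<in> K3"
  shows "6 * tr1 \<mu> (e 1) * tr2 \<mu> (e 1) (e 1) - tr1 \<mu> (e 1) ^ 3 - 8 * tr3 \<mu> (e 1) = 0"
    "tr2 \<mu> x (mult \<mu> y z) = 0"
  using assms unfolding K3_def by blast+

lemma K_E4:
  assumes "\<mu> \<in> K4"
  shows "tr1 \<mu> z * mult \<mu> x y $ k + tr1 \<mu> x * mult \<mu> y z $ k + tr1 \<mu> y * mult \<mu> z x $ k = 0"
    "mult \<mu> (mult \<mu> x y) (mult \<mu> z w) = 0"
  using assms unfolding K4_def metabelian_def by blast+

lemma not_metabelian:
  "mult sl2_C (mult sl2_C (e 1) (e 2)) (mult sl2_C (e 2) (e 3)) \<noteq> 0"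
  "mult (g3 \<beta>) (mult (g3 \<beta>) (e 1) (e 2)) (mult (g3 \<beta>) (e 1) (e 3)) \<noteq> 0"
  "\<alpha> \<noteq> 0 \<Longrightarrow> mult (g5 \<alpha>) (mult (g5 \<alpha>) (e 1) (e 2)) (mult (g5 \<alpha>) (e 1) (e 3)) \<noteq> 0"
  by (simp_all add: sl2_C_def g3_def g5_def model_mult vec_eq_iff forall_4)

lemma models_K1:
  assumes "\<mu> \<in> Lie_models" "\<mu> \<in> K1"
  shows "\<mu> \<in> orbits L1"
  using assms(1)
proof (cases rule: Lie_models_cases)
  case (g4 \<alpha> \<beta>)
  have \<beta>: "\<beta> = - 1 - \<alpha>"
    using K_E1(1)[OF assms(2)] by (simp add: g4 tr_e1 eq_neg_iff_add_eq_0 algebra_simps)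
  \<comment> \<open>For three numbers of sum zero the sum of the cubes is three times the
    product.\<close>
  have "1 + \<alpha> ^ 3 + \<beta> ^ 3 = - 3 * (\<alpha> * (\<alpha> + 1))"
    by (simp add: \<beta> power3_eq_cube algebra_simps)
  then have "\<alpha> = 0 \<or> \<alpha> = - 1"
    using K_E1(2)[OF assms(2)] by (simp add: g4 tr_e1 eq_neg_iff_add_eq_0)
  then show ?thesis
    using orbits_orbit[OF g4_swap[of 0 "- 1"], of L1] in_orbits[of "g4 (- 1) 0" L1]
    by (auto simp: g4 \<beta> L1_def)
next
  case (g2 \<beta>)
  have "\<beta> = - 2"
    using K_E1(1)[OF assms(2)] by (simp add: g2 tr_e1 eq_neg_iff_add_eq_0 add.commute)
  then show ?thesis
    using K_E1(2)[OF assms(2)] by (simp add: g2 tr_e1)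
next
  case (g5 \<alpha>)
  have "1 + \<alpha> = 0"
    using K_E1(1)[OF assms(2)] unfolding g5 tr_e1 mult_eq_0_iff by simp
  then have "\<alpha> = - 1"
    by (simp add: add_eq_0_iff)
  then show ?thesis
    by (simp add: g5 in_orbits L1_def)
qed (use K_E1[OF assms(2)] in \<open>simp_all add: tr_e1 in_orbits L1_def\<close>)

lemma models_K2:
  assumes "\<mu> \<in> Lie_models" "\<mu> \<in> K2"
  shows "\<mu> \<in> orbits L2"
  using assms(1)
proof (cases rule: Lie_models_cases)
  case (g4 \<alpha> \<beta>)
  have "6 * (\<alpha> * \<beta>) = 0"
    using K_E2(1)[OF assms(2)] by (simp add: g4 tr_e1 power2_eq_square power3_eq_cube algebra_simps)
  then show ?thesis
    using orbits_orbit[OF g4_swap[of 0 \<beta>], of L2] in_orbits[of "g4 \<alpha> 0" L2]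
    by (auto simp: g4 L2_def)
next
  case (g2 \<beta>)
  have "6 * \<beta> = 0"
    using K_E2(1)[OF assms(2)] by (simp add: g2 tr_e1 power2_eq_square power3_eq_cube algebra_simps)
  then show ?thesis
    by (simp add: g2 in_orbits L2_def)
next
  case (g5 \<alpha>)
  have "\<alpha> = 0"
    using K_E2(2)[OF assms(2)] not_metabelian(3) unfolding g5 by blast
  then show ?thesis
    by (simp add: g5 in_orbits L2_def)
qed (rule in_orbits, use K_E2[OF assms(2)] not_metabelian in \<open>auto simp: tr_e1 L2_def\<close>)+

lemma models_K3:
  assumes "\<mu> \<in> Lie_models" "\<mu> \<in> K3"
  shows "\<mu> \<in> orbits L3"
  using assms(1)
proof (cases rule: Lie_models_cases)
  case sl2_C
  have "mult sl2_C (e 2) (e 3) = e 1"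
    by (simp add: sl2_C_def model_mult vec_eq_iff forall_4)
  then show ?thesis
    using K_E3(2)[OF assms(2), of "e 1" "e 2" "e 3"] by (simp add: sl2_C tr_e1)
next
  case (g4 \<alpha> \<beta>)
  have "3 * ((1 + \<alpha> - \<beta>) * (1 + \<beta> - \<alpha>) * (\<alpha> + \<beta> - 1)) = 0"
    using K_E3(1)[OF assms(2)] by (simp add: g4 tr_e1 power2_eq_square power3_eq_cube algebra_simps)
  then have "1 + \<alpha> - \<beta> = 0 \<or> 1 + \<beta> - \<alpha> = 0 \<or> \<alpha> + \<beta> - 1 = 0"
    unfolding mult_eq_0_iff by simp
  then consider "\<beta> = \<alpha> + 1" | "\<alpha> = \<beta> + 1" | "\<alpha> + \<beta> = 1"
    by (fastforce simp: algebra_simps)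
  then show ?thesis
  proof cases
    case 1
    then show ?thesis
      by (intro in_orbits) (auto simp: g4 L3_def)
  next
    case 2
    then show ?thesis
      unfolding g4 by (intro orbits_orbit[OF g4_swap]) (auto simp: L3_def)
  next
    case 3
    show ?thesis
    proof (cases "\<alpha> = 0")
      case True
      have "g4 0 (0 + 1) \<in> L3"
        unfolding L3_def by blast
      then show ?thesis
        using True 3 by (intro in_orbits) (simp add: g4)
    next
      case False
      \<comment> \<open>Here the eigenvalue 1 is the sum of the other two, so it is permuted into
        the last place and \<alpha> becomes the unit.\<close>
      then have "1 / \<alpha> = \<beta> / \<alpha> + 1"
        using 3 by (simp add: field_simps)
      then have "g4 (\<beta> / \<alpha>) (1 / \<alpha>) \<in> L3"
        by (auto simp: L3_def)
      then show ?thesis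
        unfolding g4 using orbit_trans[OF g4_scale[OF False] g4_swap] by (intro orbits_orbit)
    qed
  qed
next
  case (g2 \<beta>)
  have "3 * (\<beta> * \<beta> * (2 - \<beta>)) = 0"
    using K_E3(1)[OF assms(2)] by (simp add: g2 tr_e1 power2_eq_square power3_eq_cube algebra_simps)
  then show ?thesis
    by (auto simp: g2 in_orbits L3_def)
qed (rule in_orbits, use K_E3[OF assms(2)] in \<open>auto simp: tr_e1 L3_def\<close>)+

lemma models_K4:
  assumes "\<mu> \<in> Lie_models" "\<mu> \<in> K4"
  shows "\<mu> \<in> orbits L4"
  using assms(1)
proof (cases rule: Lie_models_cases)
  case r2_r2
  show ?thesis
    using K_E4(1)[OF assms(2), where x = "e 1" and y = "e 2" and z = "e 3" and k = 2]
    by (simp add: r2_r2 tr_eval r2_r2_def)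
next
  case g3
  show ?thesis
    using K_E4(2)[OF assms(2)] not_metabelian(2) unfolding g3 by blast
next
  case (g5 \<alpha>)
  have "\<alpha> = 0"
    using K_E4(2)[OF assms(2)] not_metabelian(3) unfolding g5 by blast
  then show ?thesis
    using K_E4(1)[OF assms(2), where x = "e 1" and y = "e 2" and z = "e 3" and k = 4]
    by (simp add: g5 tr_eval g5_def)
qed (rule in_orbits, use K_E4[OF assms(2)] not_metabelian in \<open>auto simp: L4_def\<close>)+

lemma not_in_K5: "sl2_C \<notin> K5" "r2_r2 \<notin> K5" "n4 \<notin> K5" "g4 \<alpha> \<beta> \<notin> K5" "g5 \<alpha> \<notin> K5"
proof -
  show "sl2_C \<notin> K5"
    by (rule not_K5I[where x = "e 1" and y = "e 2 + e 3 + e 4"])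
      (auto simp: sl2_C_def model_mult indep4_def vec_eq_iff forall_4)
  show "r2_r2 \<notin> K5"
    by (rule not_K5I[where x = "e 1 + 2 *s e 3" and y = "e 1 + e 2 + e 4"])
      (auto simp: r2_r2_def model_mult indep4_def vec_eq_iff forall_4 add_eq_0_iff)
  show "n4 \<notin> K5"
    by (rule not_K5I[where x = "e 1" and y = "e 2"])
      (auto simp: n4_def model_mult indep4_def vec_eq_iff forall_4)
  show "g4 \<alpha> \<beta> \<notin> K5"
    by (rule not_K5I[where x = "e 1" and y = "e 4"])
      (auto simp: g4_def model_mult indep4_def vec_eq_iff forall_4)
  show "g5 \<alpha> \<notin> K5"
    \<comment> \<open>At \<alpha> = 0 the element \<open>e 1\<close> has the double eigenvalue 1
      without a Jordan block; adding \<open>e 3\<close> creates one through e2 e3 = e4.\<close>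
    by (rule not_K5I[where x = "e 1 + e 3" and y = "e 3"])
      (auto simp: g5_def model_mult indep4_def vec_eq_iff forall_4)
qed

lemma models_K5:
  assumes "\<mu> \<in> Lie_models" "\<mu> \<in> K5"
  shows "\<mu> \<in> orbits L5"
proof (rule in_orbits)
  show "\<mu> \<in> L5"
    using assms(1) by (cases rule: Lie_models_cases) (use assms(2) not_in_K5 in \<open>auto simp: L5_def\<close>)
qed

lemma g3_in_K5: "g3 \<beta> \<in> K5"
proof -
  have "det (basis_matrix x y (mult (g3 \<beta>) x y) (mult (g3 \<beta>) x (mult (g3 \<beta>) x y))) = 0" for x y
  proof (rule det_basis_matrix_eq_0)
    \<comment> \<open>Modulo x, multiplication by x has only the eigenvalues \<open>x $ 1\<close>
      and \<beta> times \<open>x $ 1\<close>, and satisfies the quadratic equation with these roots;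
      the first entry is the correction along x itself.\<close>
    let ?c = "(\<chi> i. if i = 1 then - (\<beta> * x $ 1 * y $ 1) else if i = 2 then \<beta> * x $ 1 * x $ 1
      else if i = 3 then - (1 + \<beta>) * x $ 1 else 1) :: complex ^ 4"
    show "basis_matrix x y (mult (g3 \<beta>) x y) (mult (g3 \<beta>) x (mult (g3 \<beta>) x y)) *v ?c = 0"
      by (simp add: basis_matrix_mult g3_def model_mult vec_eq_iff forall_4 algebra_simps)
    have "?c $ 4 = 1"
      by simp
    then show "?c \<noteq> 0"
      by (metis zero_index zero_neq_one)
  qed
  moreover have "g3 \<beta> \<in> binary"
    using g3_in_BL BL_eq_binary by blast
  ultimately show ?thesis
    by (simp add: K5_def)
qed

definition M4 :: "4 alg set" where
  "M4 = (\<Union>\<alpha>. \<Union>\<beta>. {g4 \<alpha> \<beta>})"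

lemma K_subset_orbits:
  assumes inv: "invariant K" and lie: "K \<subseteq> Lie" and L: "\<And>\<mu>. \<mu> \<in> Lie_models \<Longrightarrow> \<mu> \<in> K \<Longrightarrow> \<mu> \<in> orbits L"
  shows "K \<subseteq> orbits L"
proof
  fix \<mu>
  assume \<mu>: "\<mu> \<in> K"
  then obtain m where m: "m \<in> Lie_models" "\<mu> \<in> orbit m"
    using Lie_classification lie unfolding orbits_def by blast
  have "m \<in> K"
    using \<mu> orbit_sym[OF m(2)] inv unfolding invariant_def by blast
  then have "m \<in> orbits L"
    by (rule L[OF m(1)])
  then show "\<mu> \<in> orbits L"
    using m(2) invariant_orbits unfolding invariant_def by blast
qed

lemma stable_closure: "stable (zariski closure_of (orbits M))"
  by unfold_locales (simp_all add: invariant_closure invariant_orbits)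

lemma in_closure: "\<mu> \<in> M \<Longrightarrow> \<mu> \<in> zariski closure_of (orbits M)"
  using in_orbits closure_of_subset[of "orbits M" zariski] by auto

lemma closure_eqI:
  assumes "closedin zariski K" "invariant K" "M \<subseteq> K" "K \<subseteq> orbits L"
    and "L \<subseteq> zariski closure_of (orbits M)"
  shows "zariski closure_of (orbits M) = K" "K = orbits L"
proof -
  have "zariski closure_of (orbits M) \<subseteq> K"
    using assms(1-3) by (intro closure_of_minimal) (simp_all add: invariant_orbits_subset)
  moreover have "orbits L \<subseteq> zariski closure_of (orbits M)"
    using assms(5) by (simp add: invariant_orbits_subset invariant_closure invariant_orbits)
  ultimately show "zariski closure_of (orbits M) = K" "K = orbits L"
    using assms(4) by blast+
qed

lemma closure_M1: "zariski closure_of (orbits {sl2_C}) = K1" "K1 = orbits L1"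
proof -
  interpret stable "zariski closure_of (orbits {sl2_C})"
    by (rule stable_closure)
  let ?C = "zariski closure_of (orbits {sl2_C})"
  have 1: "sl2_C \<in> ?C"
    by (rule in_closure) simp
  note 2 = sl2_C_g5[OF 1]
  have 3: "g4 (- 1) 0 \<in> ?C"
    using g5_g4[OF _ 2] by simp
  note 4 = g4_n4[OF 3]
  note 5 = n4_n3_C[OF 4]
  note 6 = n3_C_C4[OF 5]
  have L: "L1 \<subseteq> ?C"
    using 1 2 3 4 5 6 by (simp add: L1_def)
  have "K1 \<subseteq> Lie"
    unfolding K1_def by blast
  then have K: "K1 \<subseteq> orbits L1"
    by (rule K_subset_orbits[OF invariant_K(1) _ models_K1])
  have M: "{sl2_C} \<subseteq> K1"
    using sl2_C_in_K1 by blast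
  show "?C = K1" "K1 = orbits L1"
    by (rule closure_eqI[OF closedin_K(1) invariant_K(1) M K L])+
qed

lemma closure_M2: "zariski closure_of (orbits {r2_r2}) = K2" "K2 = orbits L2"
proof -
  interpret stable "zariski closure_of (orbits {r2_r2})"
    by (rule stable_closure)
  let ?C = "zariski closure_of (orbits {r2_r2})"
  have 1: "r2_r2 \<in> ?C"
    by (rule in_closure) simp
  note 2 = r2_r2_g5[OF 1]
  note 3 = g5_g2[OF 2]
  note 4 = r2_r2_r2_C2[OF 1]
  note 5 = r2_C2_n3_C[OF 4]
  note 6 = n3_C_C4[OF 5]
  \<comment> \<open>The values 0 and 1, outside the scope of \<open>r2_r2_g4\<close>, follow from
    closedness along the family.\<close>
  have 7: "g4 \<alpha> 0 \<in> ?C" for \<alpha>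
    using g4_family[of "{0, 1}" 0 0 \<alpha>] r2_r2_g4[OF _ _ 1] by simp
  note 8 = g4_n4[OF 7]
  have L: "L2 \<subseteq> ?C"
    using 1 2 3 4 5 6 7 8 by (auto simp: L2_def)
  have "K2 \<subseteq> Lie"
    unfolding K2_def by blast
  then have K: "K2 \<subseteq> orbits L2"
    by (rule K_subset_orbits[OF invariant_K(2) _ models_K2])
  have M: "{r2_r2} \<subseteq> K2"
    using r2_r2_in_K2 by blast
  show "?C = K2" "K2 = orbits L2"
    by (rule closure_eqI[OF closedin_K(2) invariant_K(2) M K L])+
qed

lemma closure_M3: "zariski closure_of (orbits (range g5)) = K3" "K3 = orbits L3"
proof -
  interpret stable "zariski closure_of (orbits (range g5))"
    by (rule stable_closure)
  let ?C = "zariski closure_of (orbits (range g5))"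
  have 1: "g5 \<alpha> \<in> ?C" for \<alpha>
    by (rule in_closure) simp
  have 2: "g4 \<alpha> (\<alpha> + 1) \<in> ?C" for \<alpha>
    using g4_family[of "{0}" 1 1 \<alpha>] g5_g4[OF _ 1] by simp
  note 3 = g5_g2[OF 1]
  note 4 = g5_g3[OF 1]
  have 5: "g2 2 \<in> ?C"
    using g3_g2[OF _ 4] by simp
  note 6 = g4_n4[OF 2]
  note 7 = n4_n3_C[OF 6]
  note 8 = n3_C_C4[OF 7]
  have L: "L3 \<subseteq> ?C"
    using 1 2 3 4 5 6 7 8 by (auto simp: L3_def)
  have "K3 \<subseteq> Lie"
    unfolding K3_def by blast
  then have K: "K3 \<subseteq> orbits L3"
    by (rule K_subset_orbits[OF invariant_K(3) _ models_K3])
  have M: "range g5 \<subseteq> K3"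
    using g5_in_K3 by blast
  show "?C = K3" "K3 = orbits L3"
    by (rule closure_eqI[OF closedin_K(3) invariant_K(3) M K L])+
qed

lemma closure_M4: "zariski closure_of (orbits M4) = K4" "K4 = orbits L4"
proof -
  interpret stable "zariski closure_of (orbits M4)"
    by (rule stable_closure)
  let ?C = "zariski closure_of (orbits M4)"
  have 1: "g4 \<alpha> \<beta> \<in> ?C" for \<alpha> \<beta>
    by (rule in_closure) (auto simp: M4_def)
  note 2 = g4_g2[OF 1]
  note 3 = g2_g1[OF 2]
  note 4 = g2_r2_C2[OF 2]
  note 5 = g4_n4[OF 1]
  note 6 = n4_n3_C[OF 5]
  note 7 = n3_C_C4[OF 6]
  have L: "L4 \<subseteq> ?C"
    using 1 2 3 4 5 6 7 by (auto simp: L4_def)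
  have "K4 \<subseteq> Lie"
    unfolding K4_def by blast
  then have K: "K4 \<subseteq> orbits L4"
    by (rule K_subset_orbits[OF invariant_K(4) _ models_K4])
  have M: "M4 \<subseteq> K4"
    using g4_in_K4 unfolding M4_def by blast
  show "?C = K4" "K4 = orbits L4"
    by (rule closure_eqI[OF closedin_K(4) invariant_K(4) M K L])+
qed

lemma closure_M5: "zariski closure_of (orbits (range g3)) = K5" "K5 = orbits L5"
proof -
  interpret stable "zariski closure_of (orbits (range g3))"
    by (rule stable_closure)
  let ?C = "zariski closure_of (orbits (range g3))"
  have 1: "g3 \<beta> \<in> ?C" for \<beta>
    by (rule in_closure) simp
  have 2: "g2 \<beta> \<in> ?C" for \<beta>
    using g2_family[of "{1}" \<beta>] g3_g2[OF _ 1] by simp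
  note 3 = g2_g1[OF 2]
  note 4 = g2_r2_C2[OF 2]
  note 5 = r2_C2_n3_C[OF 4]
  note 6 = n3_C_C4[OF 5]
  note 7 = g3_g6[OF 1]
  have L: "L5 \<subseteq> ?C"
    using 1 2 3 4 5 6 7 by (auto simp: L5_def)
  \<comment> \<open>Unlike the other four sets, \<open>K5\<close> contains algebras that are not
    Lie, so both classifications enter.\<close>
  have K: "K5 \<subseteq> orbits L5"
  proof
    fix \<mu>
    assume \<mu>: "\<mu> \<in> K5"
    show "\<mu> \<in> orbits L5"
    proof (cases "\<mu> \<in> Lie")
      case True
      have "K5 \<inter> Lie \<subseteq> orbits L5"
        by (rule K_subset_orbits[OF invariant_Int[OF invariant_K(5) invariant_Lie]])
          (simp_all add: models_K5)
      then show ?thesis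
        using \<mu> True by blast
    next
      case False
      have "\<mu> \<in> orbits nonlie_models"
        using \<mu> False by (intro nonlie_classification) (simp_all add: K5_def)
      then show ?thesis
        unfolding orbits_def nonlie_models_def L5_def by blast
    qed
  qed
  have M: "range g3 \<subseteq> K5"
    using g3_in_K5 by blast
  show "?C = K5" "K5 = orbits L5"
    by (rule closure_eqI[OF closedin_K5 invariant_K(5) M K L])+
qed

section \<open>Components and rigid algebras\<close>

lemma BL_eq_K: "(BL :: 4 alg set) = K1 \<union> K2 \<union> K3 \<union> K4 \<union> K5"
proof
  show "K1 \<union> K2 \<union> K3 \<union> K4 \<union> K5 \<subseteq> BL"
    using Lie_subset_BL BL_eq_binary by (auto simp: K1_def K2_def K3_def K4_def K5_def)
  have "Lie_models \<subseteq> L1 \<union> L2 \<union> L3 \<union> L4"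
    unfolding Lie_models_def abelian_models_def heisenberg_models_def L1_def L2_def L3_def L4_def
    by blast
  moreover have "nonlie_models \<subseteq> L5"
    unfolding nonlie_models_def L5_def by blast
  moreover have "orbits A \<subseteq> orbits B" if "A \<subseteq> B" for A B :: "4 alg set"
    using that unfolding orbits_def by blast
  moreover have "orbits (A \<union> B) = orbits A \<union> orbits B" for A B :: "4 alg set"
    unfolding orbits_def by blast
  ultimately have "orbits Lie_models \<subseteq> K1 \<union> K2 \<union> K3 \<union> K4" "orbits nonlie_models \<subseteq> K5"
    unfolding closure_M1(2) closure_M2(2) closure_M3(2) closure_M4(2) closure_M5(2) by metis+
  then show "BL \<subseteq> K1 \<union> K2 \<union> K3 \<union> K4 \<union> K5"
    using Lie_classification nonlie_classification BL_eq_binary by blast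
qed

lemma Lie_subset_K: "Lie \<subseteq> K1 \<union> K2 \<union> K3 \<union> K4"
proof -
  have "Lie_models \<subseteq> L1 \<union> L2 \<union> L3 \<union> L4"
    unfolding Lie_models_def abelian_models_def heisenberg_models_def L1_def L2_def L3_def L4_def
    by blast
  then have "orbits Lie_models \<subseteq> K1 \<union> K2 \<union> K3 \<union> K4"
    unfolding closure_M1(2) closure_M2(2) closure_M3(2) closure_M4(2) orbits_def by blast
  then show ?thesis
    using Lie_classification by blast
qed

lemma sl2_C_notin: "sl2_C \<notin> K2" "sl2_C \<notin> K3" "sl2_C \<notin> K4" "sl2_C \<notin> K5"
proof -
  show "sl2_C \<notin> K2" "sl2_C \<notin> K4"
    using K_E2(2) K_E4(2) not_metabelian(1) by blast+
  have "mult sl2_C (e 2) (e 3) = e 1"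
    by (simp add: sl2_C_def model_mult vec_eq_iff forall_4)
  then show "sl2_C \<notin> K3"
    using K_E3(2)[of sl2_C "e 1" "e 2" "e 3"] by (auto simp: tr_e1)
qed (rule not_in_K5)

lemma r2_r2_notin: "r2_r2 \<notin> K1" "r2_r2 \<notin> K3" "r2_r2 \<notin> K4" "r2_r2 \<notin> K5"
proof -
  show "r2_r2 \<notin> K1" "r2_r2 \<notin> K3"
    using K_E1(1)[of r2_r2] K_E3(1)[of r2_r2] by (auto simp: tr_e1)
  show "r2_r2 \<notin> K4"
    using K_E4(1)[of r2_r2, where x = "e 1" and y = "e 2" and z = "e 3" and k = 2]
    by (auto simp: tr_eval r2_r2_def)
qed (rule not_in_K5)

lemma g5_notin: "g5 1 \<notin> K1" "g5 1 \<notin> K2" "g5 1 \<notin> K4" "g5 1 \<notin> K5"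
proof -
  show "g5 1 \<notin> K1"
    using K_E1(1)[of "g5 1"] by (auto simp: tr_e1)
  show "g5 1 \<notin> K2" "g5 1 \<notin> K4"
    using K_E2(2) K_E4(2) not_metabelian(3)[of 1] by auto
qed (rule not_in_K5)

lemma g4_notin: "g4 1 1 \<notin> K1" "g4 1 1 \<notin> K2" "g4 1 1 \<notin> K3" "g4 1 1 \<notin> K5"
  using K_E1(1)[of "g4 1 1"] K_E2(1)[of "g4 1 1"] K_E3(1)[of "g4 1 1"] not_in_K5(4)
  by (auto simp: tr_e1)

lemma g3_notin: "g3 0 \<notin> K1" "g3 0 \<notin> K2" "g3 0 \<notin> K3" "g3 0 \<notin> K4"
proof -
  have "jacobian (g3 0) (e 1) (e 2) (e 3) $ 4 \<noteq> 0"
    by (simp add: jacobian_def g3_def model_mult)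
  then have "jacobian (g3 0) (e 1) (e 2) (e 3) \<noteq> 0"
    by (metis zero_index)
  then have "g3 0 \<notin> Lie"
    unfolding Lie_iff by blast
  then show "g3 0 \<notin> K1" "g3 0 \<notin> K2" "g3 0 \<notin> K3" "g3 0 \<notin> K4"
    unfolding K1_def K2_def K3_def K4_def by blast+
qed

lemmas K_in = sl2_C_in_K1 r2_r2_in_K2 g5_in_K3[of 1] g4_in_K4[of 1 1] g3_in_K5[of 0]

lemma K_distinct: "distinct [K1, K2, K3, K4, K5]"
  using K_in sl2_C_notin r2_r2_notin g5_notin g4_notin by auto

text \<open>Each set has a point in none of the others: \<open>sl2_C\<close>, \<open>r2_r2\<close>,
  \<open>g5 1\<close>, \<open>g4 1 1\<close> and \<open>g3 0\<close>.\<close>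

lemma K_antichain:
  assumes "C \<in> {K1, K2, K3, K4, K5}" "D \<in> {K1, K2, K3, K4, K5}" "C \<subseteq> D"
  shows "C = D"
  using assms K_in sl2_C_notin r2_r2_notin g5_notin g4_notin g3_notin by blast

lemma irreducible_family:
  assumes "poly_curve c"
  shows "irreducible_in zariski (orbits (range c))"
proof (rule irreducible_orbits)
  fix \<mu> \<nu>
  assume "\<mu> \<in> range c" "\<nu> \<in> range c"
  then obtain a b where ab: "\<mu> = c a" "\<nu> = c b"
    by blast
  have "poly_fun (\<lambda>t. f (a + t * (b - a)))" if f: "poly_fun f" for f
  proof -
    obtain P where "\<And>t. f t = poly P t"
      using f unfolding poly_fun_def by blast
    then show ?thesis
      unfolding poly_fun_def by (intro exI[of _ "pcompose P [:a, b - a:]"]) (simp add: poly_pcompose)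
  qed
  then have "poly_curve (\<lambda>t. c (a + t * (b - a)))"
    using assms unfolding poly_curve_def by blast
  then show "\<exists>d. poly_curve d \<and> d 0 = \<mu> \<and> d 1 = \<nu> \<and> (\<forall>t. d t \<in> range c)"
    using ab by (intro exI[of _ "\<lambda>t. c (a + t * (b - a))"]) simp
qed simp

lemma poly_curve_const: "poly_curve (\<lambda>t. \<mu>)"
  by (simp add: poly_curve_def poly_fun_const)

lemma poly_curve_models: "poly_curve g3" "poly_curve g5"
  "poly_fun f \<Longrightarrow> poly_fun g \<Longrightarrow> poly_curve (\<lambda>t. g4 (f t) (g t))"
proof -
  show "poly_curve g3"
    unfolding g3_def by (intro poly_curve_add poly_curve_bracket) (simp_all add: poly_fun_intros)
  show "poly_curve g5"
    unfolding g5_def by (intro poly_curve_add poly_curve_bracket) (simp_all add: poly_fun_intros)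
  show "poly_fun f \<Longrightarrow> poly_fun g \<Longrightarrow> poly_curve (\<lambda>t. g4 (f t) (g t))"
    unfolding g4_def by (intro poly_curve_add poly_curve_bracket) (simp_all add: poly_fun_intros)
qed

lemma irreducible_K:
  assumes "C \<in> {K1, K2, K3, K4, K5}"
  shows "irreducible_in zariski C"
proof -
  have "irreducible_in zariski (orbits M4)"
  proof (rule irreducible_orbits)
    fix \<mu> \<nu>
    assume "\<mu> \<in> M4" "\<nu> \<in> M4"
    then obtain a b a' b' where ab: "\<mu> = g4 a b" "\<nu> = g4 a' b'"
      unfolding M4_def by blast
    have "poly_curve (\<lambda>t. g4 (a + t * (a' - a)) (b + t * (b' - b)))"
      by (intro poly_curve_models poly_fun_intros)
    then show "\<exists>c. poly_curve c \<and> c 0 = \<mu> \<and> c 1 = \<nu> \<and> (\<forall>t. c t \<in> M4)"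
      by (intro exI[of _ "\<lambda>t. g4 (a + t * (a' - a)) (b + t * (b' - b))"]) (auto simp: ab M4_def)
  qed (auto simp: M4_def)
  moreover have "irreducible_in zariski (orbits {\<mu>})" for \<mu> :: "4 alg"
    using irreducible_family[OF poly_curve_const[of \<mu>]] by simp
  moreover note irreducible_family[OF poly_curve_models(1)] irreducible_family[OF poly_curve_models(2)]
  ultimately have "irreducible_in zariski K1" "irreducible_in zariski K2" "irreducible_in zariski K3"
    "irreducible_in zariski K4" "irreducible_in zariski K5"
    unfolding closure_M1(1)[symmetric] closure_M2(1)[symmetric] closure_M3(1)[symmetric]
      closure_M4(1)[symmetric] closure_M5(1)[symmetric]
    by (simp_all add: irreducible_closure)
  then show ?thesis
    using assms by blast
qed

lemma BL_components: "irreducible_components (subtopology zariski (BL :: 4 alg set)) = {K1, K2, K3, K4, K5}"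
proof (rule irreducible_components_finite)
  have cl: "closedin zariski (BL :: 4 alg set)"
    unfolding BL_eq_binary by (rule closedin_binary)
  have sub: "C \<subseteq> BL" if "C \<in> {K1, K2, K3, K4, K5}" for C
    using that unfolding BL_eq_K by blast
  show "closedin (subtopology zariski BL) C" if "C \<in> {K1, K2, K3, K4, K5}" for C
    using sub[OF that] that closedin_K closedin_K5 unfolding closedin_closed_subtopology[OF cl] by blast
  show "irreducible_in (subtopology zariski BL) C" if "C \<in> {K1, K2, K3, K4, K5}" for C
    by (rule irreducible_subtopology[OF irreducible_K[OF that] sub[OF that] cl])
  show "topspace (subtopology zariski (BL :: 4 alg set)) = \<Union> {K1, K2, K3, K4, K5}"
    by (auto simp: BL_eq_K)
qed (simp, rule K_antichain)

text \<open>The complement of an open set cutting out the orbit would contain all but finitely many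
  points of the curve, hence also \<open>c s\<close>.\<close>

lemma not_open_orbit:
  assumes c: "poly_curve c" "\<And>t. c t \<in> W" and fin: "finite {t. c t \<in> orbit (c s)}"
  shows "\<not> openin (subtopology zariski W) (orbit (c s))"
proof
  assume "openin (subtopology zariski W) (orbit (c s))"
  then obtain U where U: "openin zariski U" "orbit (c s) = U \<inter> W"
    unfolding openin_subtopology by blast
  have "c s \<in> UNIV - U"
  proof (rule closedin_curve[OF _ c(1) fin])
    show "closedin zariski (UNIV - U)"
      using U(1) by (simp add: closedin_def Diff_Diff_Int)
    show "c t \<in> UNIV - U" if "t \<notin> {t. c t \<in> orbit (c s)}" for t
      using that c(2)[of t] U(2) by blast
  qed
  then show False
    using U(2) orbit_refl by blast
qed

text \<open>In \<open>g3\<close>, \<open>g4\<close> and \<open>g5\<close> both sides are multiples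
  of the square of \<open>x $ 1\<close>, so the ratio of the two quadratic forms does not depend on
  x and is an isomorphism invariant.\<close>

lemma tr_ratio:
  assumes "\<nu> \<in> orbit \<mu>" "\<And>x. a * tr2 \<mu> x x = b * tr1 \<mu> x ^ 2"
  shows "a * tr2 \<nu> x x = b * tr1 \<nu> x ^ 2"
proof -
  let ?E = "{\<mu>. \<forall>x. a * tr2 \<mu> x x = b * tr1 \<mu> x ^ 2}"
  have "invariant ?E"
    by (rule invariant_tr[where P = "\<lambda>u v w. a * v = b * u ^ 2"]) simp
  then show ?thesis
    using assms unfolding invariant_def by blast
qed

lemma g5_not_open:
  assumes "\<And>\<alpha>. g5 \<alpha> \<in> W"
  shows "\<not> openin (subtopology zariski W) (orbit (g5 \<alpha>))"
proof (rule not_open_orbit[OF poly_curve_models(2) assms])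
  have "{t. g5 t \<in> orbit (g5 \<alpha>)} \<subseteq> {\<alpha>, 1 / \<alpha>}"
  proof
    fix t
    assume "t \<in> {t. g5 t \<in> orbit (g5 \<alpha>)}"
    then have t: "g5 t \<in> orbit (g5 \<alpha>)"
      by simp
    have "(4 * (1 + \<alpha>)\<^sup>2) * tr2 (g5 \<alpha>) x x = (1 + \<alpha>\<^sup>2 + (1 + \<alpha>)\<^sup>2) * tr1 (g5 \<alpha>) x ^ 2" for x
      by (simp add: tr_eval g5_def power2_eq_square algebra_simps)
    from tr_ratio[OF t this, of "e 1"]
    have "(4 * (1 + \<alpha>)\<^sup>2) * (1 + t\<^sup>2 + (1 + t)\<^sup>2) = (1 + \<alpha>\<^sup>2 + (1 + \<alpha>)\<^sup>2) * (2 * (1 + t))\<^sup>2"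
      unfolding tr_e1 .
    \<comment> \<open>The invariant is symmetric under exchanging \<alpha> with 1/\<alpha>, which
      accounts for both factors.\<close>
    moreover have "(4 * (1 + \<alpha>)\<^sup>2) * (1 + t\<^sup>2 + (1 + t)\<^sup>2) - (1 + \<alpha>\<^sup>2 + (1 + \<alpha>)\<^sup>2) * (2 * (1 + t))\<^sup>2
        = 8 * ((\<alpha> * t - 1) * (t - \<alpha>))"
      by (simp add: power2_eq_square algebra_simps)
    ultimately have "8 * ((\<alpha> * t - 1) * (t - \<alpha>)) = 0"
      by simp
    then have "\<alpha> * t = 1 \<or> t = \<alpha>"
      by simp
    then show "t \<in> {\<alpha>, 1 / \<alpha>}"
      by (cases "\<alpha> = 0") (auto simp: field_simps)
  qed
  then show "finite {t. g5 t \<in> orbit (g5 \<alpha>)}"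
    using finite_subset by blast
qed

lemma finite_quadratic:
  fixes a b c :: complex
  assumes "a \<noteq> 0 \<or> b \<noteq> 0 \<or> c \<noteq> 0"
  shows "finite {t. a * t\<^sup>2 + b * t + c = 0}"
proof -
  have "finite {t. poly [:c, b, a:] t = 0}"
    by (rule poly_roots_finite) (use assms in auto)
  then show ?thesis
    by (simp add: power2_eq_square algebra_simps)
qed

lemma g4_not_open:
  assumes "\<And>\<alpha> \<beta>. g4 \<alpha> \<beta> \<in> W"
  shows "\<not> openin (subtopology zariski W) (orbit (g4 \<alpha> \<beta>))"
proof (rule not_open_orbit[where c = "g4 \<alpha>"])
  show "poly_curve (g4 \<alpha>)"
    using poly_curve_models(3)[OF poly_fun_const poly_fun_id] .
  define p q where "p = 1 + \<alpha> + \<beta>" "q = 1 + \<alpha>\<^sup>2 + \<beta>\<^sup>2"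
  have ratio: "p\<^sup>2 * (1 + \<alpha>\<^sup>2 + t\<^sup>2) = q * (1 + \<alpha> + t)\<^sup>2" if "g4 \<alpha> t \<in> orbit (g4 \<alpha> \<beta>)" for t
  proof -
    have "p\<^sup>2 * tr2 (g4 \<alpha> \<beta>) x x = q * tr1 (g4 \<alpha> \<beta>) x ^ 2" for x
      by (simp add: p_q_def tr_eval g4_def power2_eq_square algebra_simps)
    from tr_ratio[OF that this, of "e 1"] show ?thesis
      unfolding tr_e1 .
  qed
  have "finite {t. g4 \<alpha> t \<in> orbit (g4 \<alpha> \<beta>)}"
  proof (cases "p = 0")
    case True
    have "t = \<beta>" if "g4 \<alpha> t \<in> orbit (g4 \<alpha> \<beta>)" for t
    proof -
      have "tr1 (g4 \<alpha> \<beta>) x = x $ 1 * p" for x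
        by (simp add: p_q_def tr_eval g4_def algebra_simps)
      then have "0 * tr2 (g4 \<alpha> \<beta>) x x = 1 * tr1 (g4 \<alpha> \<beta>) x ^ 2" for x
        using True by simp
      from tr_ratio[OF that this, of "e 1"] have "1 + \<alpha> + t = 0"
        unfolding tr_e1 by simp
      then have "1 + \<alpha> + t = 1 + \<alpha> + \<beta>"
        using True by (simp add: p_q_def)
      then show ?thesis
        by simp
    qed
    then have "{t. g4 \<alpha> t \<in> orbit (g4 \<alpha> \<beta>)} \<subseteq> {\<beta>}"
      by blast
    then show ?thesis
      using finite_subset by blast
  next
    case False
    \<comment> \<open>The coefficients do not all vanish: the first two would give q = p^2, nonzero,
      and \<alpha> = -1, and then the third is 2 p^2.\<close>
    have "finite {t. (p\<^sup>2 - q) * t\<^sup>2 + (- 2 * q * (1 + \<alpha>)) * t + (p\<^sup>2 * (1 + \<alpha>\<^sup>2) - q * (1 + \<alpha>)\<^sup>2) = 0}"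
      by (rule finite_quadratic) (use False in \<open>auto simp: add_eq_0_iff\<close>)
    moreover have "{t. g4 \<alpha> t \<in> orbit (g4 \<alpha> \<beta>)}
      \<subseteq> {t. (p\<^sup>2 - q) * t\<^sup>2 + (- 2 * q * (1 + \<alpha>)) * t + (p\<^sup>2 * (1 + \<alpha>\<^sup>2) - q * (1 + \<alpha>)\<^sup>2) = 0}"
      using ratio by (auto simp: power2_eq_square algebra_simps)
    ultimately show ?thesis
      using finite_subset by blast
  qed
  then show "finite {t. g4 \<alpha> t \<in> orbit (g4 \<alpha> \<beta>)}" .
qed (rule assms)

lemma g3_not_open:
  assumes "\<And>\<beta>. g3 \<beta> \<in> W"
  shows "\<not> openin (subtopology zariski W) (orbit (g3 \<beta>))"
proof (rule not_open_orbit[OF poly_curve_models(1) assms])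
  have r: "(2 + \<beta>)\<^sup>2 * tr2 (g3 \<beta>) x x = (2 + \<beta>\<^sup>2) * tr1 (g3 \<beta>) x ^ 2" for x
    by (simp add: tr_eval g3_def power2_eq_square algebra_simps)
  have "(2 + \<beta>)\<^sup>2 * (2 + t\<^sup>2) = (2 + \<beta>\<^sup>2) * (2 + t)\<^sup>2" if "g3 t \<in> orbit (g3 \<beta>)" for t
    using tr_ratio[OF that r, of "e 1"] unfolding tr_e1 .
  then have "{t. g3 t \<in> orbit (g3 \<beta>)} \<subseteq> {t. (2 + 4 * \<beta>) * t\<^sup>2 + (- 4 * (2 + \<beta>\<^sup>2)) * t
      + (2 * (2 + \<beta>)\<^sup>2 - 4 * (2 + \<beta>\<^sup>2)) = 0}"
    by (auto simp: power2_eq_square algebra_simps)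
  moreover have "2 + 4 * \<beta> \<noteq> 0 \<or> - 4 * (2 + \<beta>\<^sup>2) \<noteq> 0"
  proof (rule ccontr)
    assume "\<not> ?thesis"
    then have \<beta>: "2 + 4 * \<beta> = 0" "2 + \<beta>\<^sup>2 = 0"
      by auto
    \<comment> \<open>Elimination of \<beta> from the two equations: a combination of their left
      sides equal to a nonzero constant.\<close>
    have "(9 :: complex) = 4 * (2 + \<beta>\<^sup>2) - \<beta> * (2 + 4 * \<beta>) + (1 / 2) * (2 + 4 * \<beta>)"
      by (simp add: power2_eq_square algebra_simps)
    then show False
      unfolding \<beta> by simp
  qed
  then have "finite {t. (2 + 4 * \<beta>) * t\<^sup>2 + (- 4 * (2 + \<beta>\<^sup>2)) * t + (2 * (2 + \<beta>)\<^sup>2 - 4 * (2 + \<beta>\<^sup>2)) = 0}"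
    by (intro finite_quadratic) blast
  ultimately show "finite {t. g3 t \<in> orbit (g3 \<beta>)}"
    using finite_subset by blast
qed

lemma closedin_K_all: "closedin zariski K1" "closedin zariski K2" "closedin zariski K3"
  "closedin zariski K4" "closedin zariski K5"
  by (fact closedin_K closedin_K5)+

lemma orbit_disjoint:
  assumes "invariant K" "\<mu> \<notin> K"
  shows "orbit \<mu> \<inter> K = {}"
  using assms orbit_sym unfolding invariant_def by blast

text \<open>The boundary of each rigid orbit lies in other components, so removing those leaves
  exactly the orbit.\<close>

lemma orbits_K_cover: "orbits L1 \<subseteq> orbit sl2_C \<union> K2 \<union> K3" "orbits L2 \<subseteq> orbit r2_r2 \<union> K3 \<union> K4"
proof -
  have "g4 (- 1) (- 1 + 1) \<in> L3"
    unfolding L3_def by blast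
  then have "L1 \<subseteq> {sl2_C} \<union> (L2 \<union> L3)"
    by (auto simp: L1_def L2_def L3_def)
  then show "orbits L1 \<subseteq> orbit sl2_C \<union> K2 \<union> K3"
    unfolding closure_M2(2) closure_M3(2) orbits_def by blast
  have "L2 \<subseteq> {r2_r2} \<union> (L3 \<union> L4)"
    unfolding L2_def L3_def L4_def by blast
  then show "orbits L2 \<subseteq> orbit r2_r2 \<union> K3 \<union> K4"
    unfolding closure_M3(2) closure_M4(2) orbits_def by blast
qed

lemma openin_rigid:
  assumes "closedin zariski K" "orbit \<mu> \<inter> K = {}" "orbit \<mu> \<subseteq> W" "W \<subseteq> orbit \<mu> \<union> K"
  shows "openin (subtopology zariski W) (orbit \<mu>)"
proof -
  have "openin zariski (UNIV - K)"
    using assms(1) by (simp add: closedin_def)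
  moreover have "orbit \<mu> = (UNIV - K) \<inter> W"
    using assms(2-4) by blast
  ultimately show ?thesis
    unfolding openin_subtopology by blast
qed

text \<open>An open set containing a point of a closure meets the set itself, and an orbit meeting
  the orbit of m equals it.\<close>

lemma open_orbit_meets:
  assumes "openin (subtopology zariski W) (orbit \<mu>)" "\<mu> \<in> zariski closure_of (orbits M)" "orbits M \<subseteq> W"
  obtains m where "m \<in> M" "orbit \<mu> = orbit m"
proof -
  obtain U where U: "openin zariski U" "orbit \<mu> = U \<inter> W"
    using assms(1) unfolding openin_subtopology by blast
  then have "\<mu> \<in> U"
    using orbit_refl by blast
  then obtain \<nu> where "\<nu> \<in> orbits M" "\<nu> \<in> U"
    using U(1) assms(2) unfolding in_closure_of by blast
  then have "\<nu> \<in> orbit \<mu>"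
    using U(2) assms(3) by blast
  moreover obtain m where "m \<in> M" "\<nu> \<in> orbit m"
    using \<open>\<nu> \<in> orbits M\<close> unfolding orbits_def by blast
  ultimately show ?thesis
    using that orbit_eq by metis
qed

text \<open>Treats \<open>Lie\<close> and \<open>BL\<close> at once. The hypothesis on
  \<open>K1\<close> to \<open>K4\<close> holds for \<open>Lie\<close> through its first alternative
  and for \<open>BL\<close> through the second, where the family \<open>g3\<close> provides the
  curve against openness.\<close>

lemma Rig_eq:
  assumes "Lie \<subseteq> W" "W \<subseteq> BL" and W5: "\<And>\<mu>. \<mu> \<in> W \<Longrightarrow> \<mu> \<in> K1 \<union> K2 \<union> K3 \<union> K4 \<or> range g3 \<subseteq> W"
    and inv: "invariant W"
  shows "Rig W = {orbit sl2_C, orbit r2_r2}"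
proof -
  have W: "W \<subseteq> K1 \<union> K2 \<union> K3 \<union> K4 \<union> K5"
    using assms(2) BL_eq_K by blast
  have sub: "orbit \<mu> \<subseteq> W" if "\<mu> \<in> Lie" for \<mu>
    using that assms(1) inv unfolding invariant_def by blast
  have sl2: "openin (subtopology zariski W) (orbit sl2_C)"
  proof (rule openin_rigid[where K = "K2 \<union> K3 \<union> K4 \<union> K5"])
    show "orbit sl2_C \<inter> (K2 \<union> K3 \<union> K4 \<union> K5) = {}"
      using orbit_disjoint[OF invariant_K(2)] orbit_disjoint[OF invariant_K(3)]
        orbit_disjoint[OF invariant_K(4)] orbit_disjoint[OF invariant_K(5)] sl2_C_notin by blast
    show "W \<subseteq> orbit sl2_C \<union> (K2 \<union> K3 \<union> K4 \<union> K5)"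
      using W orbits_K_cover(1) closure_M1(2) by blast
  qed (intro closedin_Un closedin_K_all sub generic_Lie)+
  have r2: "openin (subtopology zariski W) (orbit r2_r2)"
  proof (rule openin_rigid[where K = "K1 \<union> K3 \<union> K4 \<union> K5"])
    show "orbit r2_r2 \<inter> (K1 \<union> K3 \<union> K4 \<union> K5) = {}"
      using orbit_disjoint[OF invariant_K(1)] orbit_disjoint[OF invariant_K(3)]
        orbit_disjoint[OF invariant_K(4)] orbit_disjoint[OF invariant_K(5)] r2_r2_notin by blast
    show "W \<subseteq> orbit r2_r2 \<union> (K1 \<union> K3 \<union> K4 \<union> K5)"
      using W orbits_K_cover(2) closure_M2(2) by blast
  qed (intro closedin_Un closedin_K_all sub generic_Lie)+
  have "orbit \<mu> \<in> {orbit sl2_C, orbit r2_r2}"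
    if \<mu>: "\<mu> \<in> W" and op: "openin (subtopology zariski W) (orbit \<mu>)" for \<mu>
  proof -
    have inW: "orbits M \<subseteq> W \<longleftrightarrow> M \<subseteq> W" for M
      by (rule invariant_orbits_subset[OF inv])
    consider "\<mu> \<in> K1" | "\<mu> \<in> K2" | "\<mu> \<in> K3" | "\<mu> \<in> K4" | "\<mu> \<in> K5" "range g3 \<subseteq> W"
      using W W5[OF \<mu>] \<mu> by blast
    then show ?thesis
    proof cases
      case 1
      have "orbits {sl2_C} \<subseteq> W"
        unfolding inW using generic_Lie(1) assms(1) by blast
      then show ?thesis
        using open_orbit_meets[OF op 1[folded closure_M1(1)]] by auto
    next
      case 2
      have "orbits {r2_r2} \<subseteq> W"
        unfolding inW using generic_Lie(2) assms(1) by blast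
      then show ?thesis
        using open_orbit_meets[OF op 2[folded closure_M2(1)]] by auto
    next
      case 3
      have W3: "g5 \<alpha> \<in> W" for \<alpha>
        using generic_Lie(3) assms(1) by blast
      then have "orbits (range g5) \<subseteq> W"
        unfolding inW by blast
      then obtain \<alpha> where "orbit \<mu> = orbit (g5 \<alpha>)"
        using open_orbit_meets[OF op 3[folded closure_M3(1)]] by blast
      then show ?thesis
        using g5_not_open[OF W3] op by metis
    next
      case 4
      have W4: "g4 \<alpha> \<beta> \<in> W" for \<alpha> \<beta>
        using generic_Lie(4) assms(1) by blast
      then have "orbits M4 \<subseteq> W"
        unfolding inW M4_def by blast
      then obtain \<alpha> \<beta> where "orbit \<mu> = orbit (g4 \<alpha> \<beta>)"
        using open_orbit_meets[OF op 4[folded closure_M4(1)]] unfolding M4_def by blast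
      then show ?thesis
        using g4_not_open[OF W4] op by metis
    next
      case 5
      have W3: "g3 \<beta> \<in> W" for \<beta>
        using 5(2) by blast
      have "orbits (range g3) \<subseteq> W"
        unfolding inW by (rule 5(2))
      then obtain \<beta> where "orbit \<mu> = orbit (g3 \<beta>)"
        using open_orbit_meets[OF op 5(1)[folded closure_M5(1)]] by blast
      then show ?thesis
        using g3_not_open[OF W3] op by metis
    qed
  qed
  moreover have "sl2_C \<in> W" "r2_r2 \<in> W"
    using generic_Lie assms(1) by blast+
  ultimately show ?thesis
    unfolding Rig_def using sl2 r2 by blast
qed

theorem corollary4:
  shows
    "irreducible_components (subtopology zariski (BL :: 4 alg set)) =
       {zariski closure_of (orbit sl2_C),
        zariski closure_of (orbit r2_r2),
        zariski closure_of (\<Union>\<alpha>. orbit (g5 \<alpha>)),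
        zariski closure_of (\<Union>\<alpha>. \<Union>\<beta>. orbit (g4 \<alpha> \<beta>)),
        zariski closure_of (\<Union>\<beta>. orbit (g3 \<beta>))}
     \<and> card (irreducible_components (subtopology zariski (BL :: 4 alg set))) = 5
     \<and> zariski closure_of (orbit sl2_C) =
         orbits {sl2_C, g5 (-1), g4 (-1) 0, n4, n3_C, C4}
     \<and> zariski closure_of (orbit r2_r2) =
         orbits ({r2_r2, g5 0, g2 0, r2_C2, n4, n3_C, C4} \<union> (\<Union>\<alpha>. {g4 \<alpha> 0}))
     \<and> zariski closure_of (\<Union>\<alpha>. orbit (g5 \<alpha>)) =
         orbits ((\<Union>\<alpha>. {g5 \<alpha>, g4 \<alpha> (\<alpha> + 1)}) \<union> {g2 0, g2 2, g3 2, n4, n3_C, C4})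
     \<and> zariski closure_of (\<Union>\<alpha>. \<Union>\<beta>. orbit (g4 \<alpha> \<beta>)) =
         orbits ((\<Union>\<alpha>. \<Union>\<beta>. {g4 \<alpha> \<beta>, g2 \<beta>}) \<union> {r2_C2, n4, n3_C, g1, C4})
     \<and> zariski closure_of (\<Union>\<beta>. orbit (g3 \<beta>)) =
         orbits ((\<Union>\<beta>. {g3 \<beta>, g2 \<beta>}) \<union> {g6, r2_C2, n3_C, g1, C4})
     \<and> Rig (BL :: 4 alg set) = Rig (Lie :: 4 alg set)
     \<and> Rig (Lie :: 4 alg set) = {orbit sl2_C, orbit r2_r2}"
proof -
  have orb: "orbit sl2_C = orbits {sl2_C}" "orbit r2_r2 = orbits {r2_r2}"
    "(\<Union>\<alpha>. orbit (g5 \<alpha>)) = orbits (range g5)" "(\<Union>\<alpha>. \<Union>\<beta>. orbit (g4 \<alpha> \<beta>)) = orbits M4"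
    "(\<Union>\<beta>. orbit (g3 \<beta>)) = orbits (range g3)"
    by (auto simp: orbits_def M4_def)
  note cl = closure_M1(1) closure_M2(1) closure_M3(1) closure_M4(1) closure_M5(1)
  note L = closure_M1(2)[unfolded L1_def] closure_M2(2)[unfolded L2_def] closure_M3(2)[unfolded L3_def]
    closure_M4(2)[unfolded L4_def] closure_M5(2)[unfolded L5_def]
  have "card {K1, K2, K3, K4, K5} = 5"
    using K_distinct by simp
  moreover have "Rig (Lie :: 4 alg set) = {orbits {sl2_C}, orbits {r2_r2}}"
    unfolding orb[symmetric] using Lie_subset_K Lie_subset_BL by (intro Rig_eq invariant_Lie) auto
  moreover have "Rig (BL :: 4 alg set) = {orbits {sl2_C}, orbits {r2_r2}}"
    unfolding orb[symmetric] using g3_in_BL Lie_subset_BL by (intro Rig_eq invariant_BL) auto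
  ultimately show ?thesis
    unfolding orb cl BL_components using L by simp
qed

end
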